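(* The estimator $\hat\vartheta_n=(\hat\mu_1,\dots,\hat\mu_p,\hat\alpha)$ of $\vartheta=(\mu_1,\dots,\mu_p,\alpha)$ defined in the context is strongly consistent. Precisely, as $n\to\infty$ (over positive integers $n$): (1) for every $i\in\{1,\dots,p\}$, $$\hat\mu_i-\mu_i=\sigma\frac1n\Big(\int_0^n\phi_i(t)\,dB^H_t+\frac1{D_n}\sum_{j=1}^p\Lambda_{n,i}\Lambda_{n,j}\int_0^n\phi_j(t)\,dB^H_t-\frac1{D_n}\Lambda_{n,i}\int_0^nX_t\,dB^H_t\Big)\longrightarrow 0\quad\text{almost surely};$$ (2) $$\hat\alpha-\alpha=-\sigma\frac1{nD_n}\Big(\sum_{i=1}^p\Lambda_{n,i}\int_0^n\phi_i(t)\,dB^H_t-\int_0^nX_t\,dB^H_t\Big)\longrightarrow 0\quad\text{almost surely}.$$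
   Context: Setting. Let $H\in(\tfrac12,1)$ and let $(B^H_t)_{t\ge0}$ be a fractional Brownian motion with Hurst index $H$, i.e. a centred Gaussian process with a.s. continuous paths and $\mathbb E[B^H_tB^H_s]=\frac12(t^{2H}+s^{2H}-|t-s|^{2H})$. Let $p\ge1$ and let $\phi_1,\dots,\phi_p:\mathbb R\to\mathbb R$ be known bounded measurable $1$-periodic functions, orthonormal in $L^2([0,1])$. Let $\mu_1,\dots,\mu_p\in\mathbb R$, $\alpha>0$, $\sigma\neq0$, $x_0\in\mathbb R$, and $L(s)=\sum_{i=1}^p\mu_i\phi_i(s)$. The process $X$ is the solution with a.s. continuous paths of $$X_t=x_0+\int_0^t(L(s)+\alpha X_s)\,ds+\sigma B^H_t,$$ that is, $X_t=e^{\alpha t}x_0+e^{\alpha t}\int_0^te^{-\alpha s}L(s)\,ds+\sigma e^{\alpha t}\int_0^te^{-\alpha s}\,dB^H_s$. Integrals with respect to $B^H$ are pathwise Young integrals; for deterministic integrands they coincide a.s. with Skorokhod (Wiener) integrals with respect to $B^H$, and for $\phi_i$ they are understood in this sense. Integrals with respect to $X$ are given by $\int_0^n g_t\,dX_t=\int_0^n g_t(L(t)+\alpha X_t)\,dt+\sigma\int_0^n g_t\,dB^H_t$. Estimator. For $n\in\mathbb N$, $\hat\vartheta_n=Q_n^{-1}P_n$, where $$P_n=\Big(\int_0^n\phi_1(t)\,dX_t,\dots,\int_0^n\phi_p(t)\,dX_t,\int_0^nX_t\,dX_t\Big)^T,\qquad Q_n=\begin{pmatrix} nE_p & a_n \\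 a_n^T & b_n \end{pmatrix},$$ $E_p$ is the $p\times p$ identity matrix, $a_n^T=(\int_0^n\phi_1(t)X_t\,dt,\dots,\int_0^n\phi_p(t)X_t\,dt)$, $b_n=\int_0^nX_t^2\,dt$. Further notation: $\Lambda_{n,i}=\frac1n\int_0^n\phi_i(t)X_t\,dt$ and $D_n=\frac1n\int_0^nX_t^2\,dt-\sum_{i=1}^p\Lambda_{n,i}^2$. *)

theory Defs
  imports "HOL-Probability.Probability"
begin

text \<open>Gaussian laws include the degenerate ones (Dirac measures).\<close>

definition gaussian_rv :: "'a measure \<Rightarrow> ('a \<Rightarrow> real) \<Rightarrow> bool" where
  "gaussian_rv M Y \<longleftrightarrow> Y \<in> borel_measurable M \<and>
     ((\<exists>m. AE \<omega> in M. Y \<omega> = m) \<or>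
      (\<exists>m s. 0 < s \<and> distributed M lborel Y (\<lambda>y. ennreal (normal_density m s y))))"

text \<open>Processes indexed by \<open>t \<ge> 0\<close> are functions on all of \<^typ>\<open>real\<close>; their values at negative
  times are irrelevant.\<close>

definition gaussian_process :: "'a measure \<Rightarrow> (real \<Rightarrow> 'a \<Rightarrow> real) \<Rightarrow> bool" where
  "gaussian_process M B \<longleftrightarrow> (\<forall>t\<ge>0. B t \<in> borel_measurable M) \<and>
     (\<forall>T c. finite T \<longrightarrow> T \<subseteq> {0..} \<longrightarrow> gaussian_rv M (\<lambda>\<omega>. \<Sum>t\<in>T. c t * B t \<omega>))"

definition fractional_brownian_motion ::
    "'a measure \<Rightarrow> real \<Rightarrow> (real \<Rightarrow> 'a \<Rightarrow> real) \<Rightarrow> bool" where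
  "fractional_brownian_motion M H B \<longleftrightarrow>
     prob_space M \<and> gaussian_process M B \<and>
     (AE \<omega> in M. continuous_on {0..} (\<lambda>t. B t \<omega>)) \<and>
     (\<forall>t\<ge>0. integral\<^sup>L M (B t) = 0) \<and>
     (\<forall>t\<ge>0. \<forall>s\<ge>0. integral\<^sup>L M (\<lambda>\<omega>. B t \<omega> * B s \<omega>) =
        (t powr (2 * H) + s powr (2 * H) - \<bar>t - s\<bar> powr (2 * H)) / 2)"

definition step_fun :: "nat \<Rightarrow> (nat \<Rightarrow> real) \<Rightarrow> (nat \<Rightarrow> real) \<Rightarrow> real \<Rightarrow> real" where
  "step_fun m u c s = (\<Sum>j<m. c j * indicator {u j<..u (Suc j)} s)"

definition step_integral ::
    "(real \<Rightarrow> 'a \<Rightarrow> real) \<Rightarrow> nat \<Rightarrow> (nat \<Rightarrow> real) \<Rightarrow> (nat \<Rightarrow> real) \<Rightarrow> 'a \<Rightarrow> real" where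
  "step_integral B m u c \<omega> = (\<Sum>j<m. c j * (B (u (Suc j)) \<omega> - B (u j) \<omega>))"

text \<open>The squared norm of the space \<open>|\<H>|\<close> of fractional Wiener integrands on \<open>[0, T]\<close>. For step
  functions it dominates the variance of \<^const>\<open>step_integral\<close>, which is given by the same double
  integral without absolute values around \<open>g\<close>. The kernel is \<open>0\<close> instead of \<open>\<infinity>\<close> on the null
  set \<open>s = t\<close>.\<close>

definition wiener_norm_sq :: "real \<Rightarrow> real \<Rightarrow> (real \<Rightarrow> real) \<Rightarrow> ennreal" where
  "wiener_norm_sq H T g =
     (\<integral>\<^sup>+s\<in>{0..T}. (\<integral>\<^sup>+t\<in>{0..T}.
        ennreal (H * (2 * H - 1) * \<bar>g s\<bar> * \<bar>g t\<bar> * \<bar>s - t\<bar> powr (2 * H - 2)) \<partial>lborel) \<partial>lborel)"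

text \<open>The Wiener integral \<open>\<integral>\<^sub>0\<^sup>T f dB\<close> is the limit in \<open>L\<^sup>2(M)\<close> of the integrals of step functions
  that converge to \<open>f\<close> in \<open>|\<H>|\<close>. It is determined up to almost sure equality, and
  \<open>is_wiener_integral M H B T f J\<close> says that \<open>J\<close> is one of its versions. For bounded Borel \<open>f\<close> the
  integral always exists.\<close>

definition is_wiener_integral ::
    "'a measure \<Rightarrow> real \<Rightarrow> (real \<Rightarrow> 'a \<Rightarrow> real) \<Rightarrow> real \<Rightarrow> (real \<Rightarrow> real) \<Rightarrow> ('a \<Rightarrow> real) \<Rightarrow> bool" where
  "is_wiener_integral M H B T f J \<longleftrightarrow> J \<in> borel_measurable M \<and>
     (\<exists>m u c.
        (\<forall>k. 0 \<le> u k 0 \<and> (\<forall>j<m k. u k j \<le> u k (Suc j)) \<and> u k (m k) \<le> T) \<and>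
        (\<lambda>k. wiener_norm_sq H T (\<lambda>s. f s - step_fun (m k) (u k) (c k) s)) \<longlonglongrightarrow> 0 \<and>
        (\<lambda>k. \<integral>\<^sup>+\<omega>. ennreal ((J \<omega> - step_integral B (m k) (u k) (c k) \<omega>)\<^sup>2) \<partial>M) \<longlonglongrightarrow> 0)"

text \<open>The Young integral \<open>\<integral>\<^sub>a\<^sup>b f dg\<close> is the limit of the Riemann-Stieltjes sums with arbitrary tags as
  the mesh tends to \<open>0\<close>. It exists whenever \<open>f\<close> and \<open>g\<close> are Hoelder continuous with exponents of
  sum greater than \<open>1\<close>. The gauge is a ball of constant radius, so \<^const>\<open>fine\<close> bounds the mesh
  uniformly (as for the Riemann, not the Henstock-Kurzweil integral).\<close>

definition has_young_integral ::
    "(real \<Rightarrow> real) \<Rightarrow> (real \<Rightarrow> real) \<Rightarrow> real \<Rightarrow> real \<Rightarrow> real \<Rightarrow> bool" where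
  "has_young_integral f g a b J \<longleftrightarrow>
     (\<forall>\<epsilon>>0. \<exists>\<delta>>0. \<forall>D. D tagged_division_of {a..b} \<and> (\<lambda>x. ball x \<delta>) fine D \<longrightarrow>
        \<bar>(\<Sum>(x, K)\<in>D. f x * (g (Sup K) - g (Inf K))) - J\<bar> < \<epsilon>)"

definition young_integral :: "(real \<Rightarrow> real) \<Rightarrow> (real \<Rightarrow> real) \<Rightarrow> real \<Rightarrow> real \<Rightarrow> real" where
  "young_integral f g a b = (THE J. has_young_integral f g a b J)"

definition seasonal_mean :: "('p::finite \<Rightarrow> real) \<Rightarrow> ('p \<Rightarrow> real \<Rightarrow> real) \<Rightarrow> real \<Rightarrow> real" where
  "seasonal_mean \<mu> \<phi> s = (\<Sum>i\<in>UNIV. \<mu> i * \<phi> i s)"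

definition is_continuous_solution ::
    "'a measure \<Rightarrow> (real \<Rightarrow> 'a \<Rightarrow> real) \<Rightarrow> real \<Rightarrow> (real \<Rightarrow> real) \<Rightarrow> real \<Rightarrow> real \<Rightarrow>
     (real \<Rightarrow> 'a \<Rightarrow> real) \<Rightarrow> bool" where
  "is_continuous_solution M B x0 L \<alpha> \<sigma> X \<longleftrightarrow>
     (\<forall>t\<ge>0. X t \<in> borel_measurable M) \<and>
     (AE \<omega> in M. continuous_on {0..} (\<lambda>t. X t \<omega>) \<and>
        (\<forall>t\<ge>0. X t \<omega> = x0 + (LINT s:{0..t}|lborel. L s + \<alpha> * X s \<omega>) + \<sigma> * B t \<omega>))"

text \<open>The remaining definitions are pathwise: \<open>x\<close> and \<open>b\<close> are paths of \<open>X\<close> and \<open>B\<close>, and \<open>w i\<close> is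
  the value of \<open>\<integral>\<^sub>0\<^sup>n \<phi>\<^sub>i dB\<close>. In \<open>dX_integral\<close>, \<open>J\<close> is the value of \<open>\<integral>\<^sub>0\<^sup>n g dB\<close>.\<close>

definition dX_integral ::
    "(real \<Rightarrow> real) \<Rightarrow> real \<Rightarrow> real \<Rightarrow> (real \<Rightarrow> real) \<Rightarrow> nat \<Rightarrow> (real \<Rightarrow> real) \<Rightarrow> real \<Rightarrow> real" where
  "dX_integral L \<alpha> \<sigma> x n g J = (LINT t:{0..real n}|lborel. g t * (L t + \<alpha> * x t)) + \<sigma> * J"

text \<open>The \<open>p + 1\<close> coordinates are indexed by \<open>'p option\<close>: \<^term>\<open>Some i\<close> belongs to \<open>\<mu>\<^sub>i\<close>, and
  \<^const>\<open>None\<close> is the last coordinate, belonging to \<open>\<alpha>\<close>.\<close>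

definition P_vec ::
    "('p::finite \<Rightarrow> real \<Rightarrow> real) \<Rightarrow> (real \<Rightarrow> real) \<Rightarrow> real \<Rightarrow> real \<Rightarrow>
     (real \<Rightarrow> real) \<Rightarrow> (real \<Rightarrow> real) \<Rightarrow> ('p \<Rightarrow> real) \<Rightarrow> nat \<Rightarrow> real ^ 'p option" where
  "P_vec \<phi> L \<alpha> \<sigma> x b w n = (\<chi> k. case k of
       Some i \<Rightarrow> dX_integral L \<alpha> \<sigma> x n (\<phi> i) (w i)
     | None \<Rightarrow> dX_integral L \<alpha> \<sigma> x n x (young_integral x b 0 (real n)))"

definition Q_mat ::
    "('p::finite \<Rightarrow> real \<Rightarrow> real) \<Rightarrow> (real \<Rightarrow> real) \<Rightarrow> nat \<Rightarrow> real ^ 'p option ^ 'p option" where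
  "Q_mat \<phi> x n = (\<chi> k l. case (k, l) of
       (Some i, Some j) \<Rightarrow> (if i = j then real n else 0)
     | (Some i, None) \<Rightarrow> (LINT t:{0..real n}|lborel. \<phi> i t * x t)
     | (None, Some j) \<Rightarrow> (LINT t:{0..real n}|lborel. \<phi> j t * x t)
     | (None, None) \<Rightarrow> (LINT t:{0..real n}|lborel. (x t)\<^sup>2))"

definition theta_hat ::
    "('p::finite \<Rightarrow> real \<Rightarrow> real) \<Rightarrow> (real \<Rightarrow> real) \<Rightarrow> real \<Rightarrow> real \<Rightarrow>
     (real \<Rightarrow> real) \<Rightarrow> (real \<Rightarrow> real) \<Rightarrow> ('p \<Rightarrow> real) \<Rightarrow> nat \<Rightarrow> real ^ 'p option" where
  "theta_hat \<phi> L \<alpha> \<sigma> x b w n = matrix_inv (Q_mat \<phi> x n) *v P_vec \<phi> L \<alpha> \<sigma> x b w n"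

definition Lam :: "('p::finite \<Rightarrow> real \<Rightarrow> real) \<Rightarrow> (real \<Rightarrow> real) \<Rightarrow> nat \<Rightarrow> 'p \<Rightarrow> real" where
  "Lam \<phi> x n i = 1 / real n * (LINT t:{0..real n}|lborel. \<phi> i t * x t)"

definition Dn :: "('p::finite \<Rightarrow> real \<Rightarrow> real) \<Rightarrow> (real \<Rightarrow> real) \<Rightarrow> nat \<Rightarrow> real" where
  "Dn \<phi> x n = 1 / real n * (LINT t:{0..real n}|lborel. (x t)\<^sup>2) - (\<Sum>i\<in>UNIV. (Lam \<phi> x n i)\<^sup>2)"

end

theory Submission
  imports Defs "HOL-Real_Asymp.Real_Asymp"
begin

text \<open>
The noise enters the estimation error only through \<open>W\<^sub>i = \<integral>\<^sub>0\<^sup>n \<phi>\<^sub>i dB\<close> and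
\<open>Z = \<integral>\<^sub>0\<^sup>n X dB\<close>, and the proof compares them with the exponential growth of \<open>X\<close>.

\<^item> The Gaussian variable \<open>W\<^sub>i\<close> has variance at most \<open>C n\<^bsup>2H\<^esup>\<close>. Chebyshev's inequality for high
moments and Borel-Cantelli give \<open>W\<^sub>i = O(n\<^sup>\<gamma>)\<close> almost surely, for any \<open>\<gamma> > H\<close>; choose
\<open>\<gamma> < 1\<close>. The same argument for dyadic increments of \<open>B\<close> yields local Hoelder continuity of order
\<open>\<beta> > 1/2\<close> and \<open>B\<^sub>t = O(t\<^sup>\<gamma>)\<close>.

\<^item> Pathwise, \<open>X\<^sub>t e\<^bsup>-\<alpha>t\<^esup>\<close> converges to \<open>\<xi> = x\<^sub>0 + \<alpha> \<integral>\<^sub>0\<^sup>\<infinity> e\<^bsup>-\<alpha>s\<^esup> (\<integral>\<^sub>0\<^sup>s L + \<sigma> B\<^sub>s) ds\<close>. Since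
the covariances of \<open>B\<close> are nonnegative, the variances of Riemann sums of this Gaussian integral are
bounded below, so \<open>\<xi> \<noteq> 0\<close> almost surely. Hence \<open>n D\<^sub>n\<close> is at least of order \<open>e\<^bsup>2\<alpha>n\<^esup>\<close>, whereas
\<open>\<Lambda>\<^bsub>n,i\<^esub> = O(e\<^bsup>\<alpha>n\<^esup> / n)\<close> and, by integration by parts, \<open>Z = O(n\<^sup>\<gamma> e\<^bsup>\<alpha>n\<^esup>)\<close>; all error terms are
\<open>O(n\<^bsup>\<gamma>-1\<^esup>)\<close>.

\<^item> The error formula needs \<open>D\<^sub>n \<noteq> 0\<close> for every \<open>n \<ge> 1\<close>. If \<open>D\<^sub>n = 0\<close>, then on \<open>[0, 1]\<close> the path of
\<open>X\<close> lies in the span of the \<open>\<phi>\<^sub>i\<close> and that of \<open>B\<close> in a fixed space of dimension at most \<open>p + 1\<close>. So a fixed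
nontrivial linear combination of the values of \<open>B\<close> at \<open>p + 2\<close> times vanishes, an event of
probability zero.
\<close>

subsection \<open>Centred Gaussian variables\<close>

text \<open>The Wiener integral is given only as an \<open>L2\<close> limit of step integrals along
  an unspecified sequence. Its tail is therefore estimated on the Gaussian approximants, and the
  work lies in bounding their variances asymptotically by those of a constant integrand. The
  covariance kernel is nonnegative because H > 1/2, so norms and variances can be compared term by
  term.

  The Young integral needs only one explicit computation: X - \<sigma> B is locally Lipschitz, which
  makes a primitive of X dB available in closed form, and its local error is summable because 2
  \<beta> > 1.

  The law of \<xi> is never identified. Small-ball estimates that are uniform along Gaussian Riemann
  sums pass to their pointwise limit.

  In the case D_n = 0 the coefficients of the \<phi>_i depend on the path and range over an
  uncountable set, so a null set for each choice of coefficients would not suffice. A linear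
  relation that does not depend on them yields a single null event, which serves all coefficients
  and all n at once.\<close>

definition gaussian_moment :: "nat \<Rightarrow> real" where
  "gaussian_moment m = fact (2 * m) / (2 ^ m * fact m)"

lemma gaussian_moment_pos: "0 < gaussian_moment m"
  by (simp add: gaussian_moment_def)

context prob_space
begin

lemma centred_gaussian_cases:
  assumes "gaussian_rv M Y" "expectation Y = 0"
  obtains (degenerate) "AE \<omega> in M. Y \<omega> = 0"
  | (density) s where "0 < s" "distributed M lborel Y (\<lambda>y. ennreal (normal_density 0 s y))"
proof -
  have [measurable]: "Y \<in> borel_measurable M"
    using assms(1) by (simp add: gaussian_rv_def)
  consider m where "AE \<omega> in M. Y \<omega> = m"
    | m s where "0 < s" "distributed M lborel Y (\<lambda>y. ennreal (normal_density m s y))"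
    using assms(1) by (auto simp: gaussian_rv_def)
  then show thesis
  proof cases
    case 1
    have "expectation Y = expectation (\<lambda>_. m)"
      using 1 by (intro integral_cong_AE) auto
    then have "m = 0"
      using assms(2) by (simp add: prob_space)
    with 1 show ?thesis using degenerate by simp
  next
    case 2
    have "(\<integral>x. normal_density m s x * x \<partial>lborel) = expectation Y"
      using distributed_integral[OF 2(2), of "\<lambda>x. x"] by simp
    then have "m = 0"
      using integral_normal_moment_nz_1[OF 2(1), of m] assms(2) by simp
    with 2 show ?thesis using density by simp
  qed
qed

lemma centred_gaussian_integrable_power:
  assumes "gaussian_rv M Y" "expectation Y = 0"
  shows "integrable M (\<lambda>\<omega>. Y \<omega> ^ k)"
  using assms
proof (cases rule: centred_gaussian_cases)
  case degenerate
  have [measurable]: "Y \<in> borel_measurable M"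
    using assms(1) by (simp add: gaussian_rv_def)
  have "integrable M (\<lambda>\<omega>. Y \<omega> ^ k) \<longleftrightarrow> integrable M (\<lambda>\<omega>. 0 ^ k :: real)"
    using degenerate by (intro integrable_cong_AE) auto
  then show ?thesis by simp
next
  case (density s)
  show ?thesis
    using distributed_integrable[OF density(2), of "\<lambda>x. x ^ k"]
      integrable_normal_moment[OF density(1), of 0 k] by simp
qed

text \<open>\<open>gaussian_moment m\<close> is the double factorial (2m-1)!!, the moment of order
  2m of the standard normal law. For a Dirac law both sides are \<open>0 ^ m\<close>, with the value
  1 at m = 0.\<close>

lemma centred_gaussian_even_moment:
  assumes "gaussian_rv M Y" "expectation Y = 0"
  shows "expectation (\<lambda>\<omega>. Y \<omega> ^ (2 * m)) = gaussian_moment m * expectation (\<lambda>\<omega>. (Y \<omega>)\<^sup>2) ^ m"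
  using assms
proof (cases rule: centred_gaussian_cases)
  case degenerate
  have [measurable]: "Y \<in> borel_measurable M"
    using assms(1) by (simp add: gaussian_rv_def)
  have *: "expectation (\<lambda>\<omega>. Y \<omega> ^ k) = 0 ^ k" for k
  proof -
    have "expectation (\<lambda>\<omega>. Y \<omega> ^ k) = expectation (\<lambda>\<omega>. 0 ^ k)"
      using degenerate by (intro integral_cong_AE) auto
    then show ?thesis by (simp add: prob_space)
  qed
  show ?thesis
    unfolding * by (cases "m = 0") (simp_all add: gaussian_moment_def zero_power prob_space)
next
  case (density s)
  have *: "expectation (\<lambda>\<omega>. Y \<omega> ^ (2 * k)) = fact (2 * k) / ((2 / s\<^sup>2) ^ k * fact k)" for k
    using distributed_integral[OF density(2), of "\<lambda>x. x ^ (2 * k)"]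
      integral_normal_moment_even[OF density(1), of 0 k] by simp
  show ?thesis
    using *[of m] *[of 1] by (simp add: gaussian_moment_def power_divide fact_numeral)
qed

text \<open>Markov's inequality for \<open>Y ^ (2 * m)\<close>. The order m stays free, because the
  Borel-Cantelli arguments have to choose it large when the exponents are close to H.\<close>

lemma centred_gaussian_tail:
  assumes "gaussian_rv M Y" "expectation Y = 0" "0 < x"
  shows "prob {\<omega>\<in>space M. x \<le> \<bar>Y \<omega>\<bar>} \<le> gaussian_moment m * expectation (\<lambda>\<omega>. (Y \<omega>)\<^sup>2) ^ m / x ^ (2 * m)"
proof -
  have [measurable]: "Y \<in> borel_measurable M"
    using assms(1) by (simp add: gaussian_rv_def)
  have "prob {\<omega>\<in>space M. x \<le> \<bar>Y \<omega>\<bar>} \<le> prob {\<omega>\<in>space M. x ^ (2 * m) \<le> Y \<omega> ^ (2 * m)}"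
  proof (rule finite_measure_mono)
    have "x ^ (2 * m) \<le> y ^ (2 * m)" if "x \<le> \<bar>y\<bar>" for y :: real
      using power_mono[OF that, of "2 * m"] assms(3) by (simp add: power_even_abs)
    then show "{\<omega>\<in>space M. x \<le> \<bar>Y \<omega>\<bar>} \<subseteq> {\<omega>\<in>space M. x ^ (2 * m) \<le> Y \<omega> ^ (2 * m)}"
      by auto
  qed measurable
  also have "\<dots> \<le> expectation (\<lambda>\<omega>. Y \<omega> ^ (2 * m)) / x ^ (2 * m)"
    using centred_gaussian_integrable_power[OF assms(1,2), of "2 * m"] assms(3)
    by (intro integral_Markov_inequality_measure[where A="space M"]) auto
  finally show ?thesis
    using centred_gaussian_even_moment[OF assms(1,2)] by simp
qed

text \<open>The density is at most \<open>1 / sqrt v\<close> since 2 pi > 1, and the window has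
  length 2 \<epsilon>; the Dirac case contradicts 0 < v. The bound depends neither on the centre a
  nor on Y beyond v, which makes it usable along a whole sequence.\<close>

lemma centred_gaussian_anticoncentration:
  assumes "gaussian_rv M Y" "expectation Y = 0"
    and "0 < v" "v \<le> expectation (\<lambda>\<omega>. (Y \<omega>)\<^sup>2)" "0 < \<epsilon>"
  shows "prob {\<omega>\<in>space M. \<bar>Y \<omega> - a\<bar> \<le> \<epsilon>} \<le> 2 * \<epsilon> / sqrt v"
  using assms(1,2)
proof (cases rule: centred_gaussian_cases)
  case degenerate
  have [measurable]: "Y \<in> borel_measurable M"
    using assms(1) by (simp add: gaussian_rv_def)
  have "expectation (\<lambda>\<omega>. (Y \<omega>)\<^sup>2) = expectation (\<lambda>\<omega>. 0)"
    using degenerate by (intro integral_cong_AE) auto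
  then show ?thesis using assms by simp
next
  case (density s)
  have [measurable]: "Y \<in> borel_measurable M"
    using assms(1) by (simp add: gaussian_rv_def)
  have "expectation (\<lambda>\<omega>. (Y \<omega>)\<^sup>2) = s\<^sup>2"
    using distributed_integral[OF density(2), of "\<lambda>x. x ^ (2 * 1)"]
      integral_normal_moment_even[OF density(1), of 0 1] by (simp add: fact_numeral)
  then have vs: "sqrt v \<le> s"
    using assms(4) density(1) real_le_lsqrt[of s v] by simp
  have bnd: "normal_density 0 s y \<le> 1 / sqrt v" for y
  proof -
    have "sqrt v \<le> sqrt (2 * pi * s\<^sup>2)"
    proof -
      have "v \<le> 1 * s\<^sup>2" using \<open>expectation (\<lambda>\<omega>. (Y \<omega>)\<^sup>2) = s\<^sup>2\<close> assms(4) by simp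
      also have "\<dots> \<le> 2 * pi * s\<^sup>2"
        using pi_gt3 by (intro mult_right_mono) auto
      finally show ?thesis by simp
    qed
    then have "1 / sqrt (2 * pi * s\<^sup>2) \<le> 1 / sqrt v"
      using assms(3) by (intro divide_left_mono mult_pos_pos) auto
    moreover have "exp (- y\<^sup>2 / (2 * s\<^sup>2)) \<le> 1"
      by simp
    ultimately show ?thesis
      unfolding normal_density_def using mult_mono[of "1 / sqrt (2 * pi * s\<^sup>2)" "1 / sqrt v"] assms(3)
      by fastforce
  qed
  have "emeasure M {\<omega>\<in>space M. \<bar>Y \<omega> - a\<bar> \<le> \<epsilon>} = emeasure M (Y -` {a-\<epsilon>..a+\<epsilon>} \<inter> space M)"
    by (intro arg_cong[where f="emeasure M"]) (auto simp: abs_le_iff)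
  also have "\<dots> = (\<integral>\<^sup>+ y. ennreal (normal_density 0 s y) * indicator {a-\<epsilon>..a+\<epsilon>} y \<partial>lborel)"
    by (rule distributed_emeasure[OF density(2)]) simp
  also have "\<dots> \<le> (\<integral>\<^sup>+ y. ennreal (1 / sqrt v) * indicator {a-\<epsilon>..a+\<epsilon>} y \<partial>lborel)"
    by (intro nn_integral_mono mult_right_mono ennreal_leI bnd) simp
  also have "\<dots> = ennreal (2 * \<epsilon> / sqrt v)"
    using assms by (simp add: nn_integral_cmult_indicator ennreal_mult'[symmetric] mult.commute)
  finally show ?thesis
    using assms by (simp add: emeasure_eq_measure)
qed

text \<open>Where the limit equals a, the path lies in every \<open>A (1 / Suc j)\<close>, the event
  of being eventually within that distance of a. Continuity from below gives
  \<open>A \<epsilon>\<close> probability at most K \<epsilon>, so the intersection is null. Only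
  the measurable events \<open>A \<epsilon>\<close> enter, and Z may be any pointwise limit.\<close>

lemma AE_limit_neq_of_anticoncentration:
  fixes Y :: "nat \<Rightarrow> 'a \<Rightarrow> real"
  assumes [measurable]: "\<And>k. Y k \<in> borel_measurable M"
    and "\<And>k \<epsilon>. k \<ge> k0 \<Longrightarrow> 0 < \<epsilon> \<Longrightarrow> prob {\<omega>\<in>space M. \<bar>Y k \<omega> - a\<bar> \<le> \<epsilon>} \<le> K * \<epsilon>"
    and "AE \<omega> in M. (\<lambda>k. Y k \<omega>) \<longlonglongrightarrow> Z \<omega>"
  shows "AE \<omega> in M. Z \<omega> \<noteq> a"
proof -
  define A where "A \<epsilon> = (\<Union>N. \<Inter>k\<in>{N..}. {\<omega>\<in>space M. \<bar>Y k \<omega> - a\<bar> \<le> \<epsilon>})" for \<epsilon>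
  have [measurable]: "A \<epsilon> \<in> sets M" for \<epsilon>
    unfolding A_def by measurable
  have A: "prob (A \<epsilon>) \<le> K * \<epsilon>" if "0 < \<epsilon>" for \<epsilon>
  proof -
    have "(\<Inter>k\<in>{N..}. {\<omega>\<in>space M. \<bar>Y k \<omega> - a\<bar> \<le> \<epsilon>}) \<in> sets M" for N
      by measurable
    then have "(\<lambda>N. prob (\<Inter>k\<in>{N..}. {\<omega>\<in>space M. \<bar>Y k \<omega> - a\<bar> \<le> \<epsilon>})) \<longlonglongrightarrow> prob (A \<epsilon>)"
      unfolding A_def by (intro finite_Lim_measure_incseq) (auto simp: incseq_def)
    moreover have "prob (\<Inter>k\<in>{N..}. {\<omega>\<in>space M. \<bar>Y k \<omega> - a\<bar> \<le> \<epsilon>}) \<le> K * \<epsilon>" if "N \<ge> k0" for N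
    proof -
      have "prob (\<Inter>k\<in>{N..}. {\<omega>\<in>space M. \<bar>Y k \<omega> - a\<bar> \<le> \<epsilon>}) \<le> prob {\<omega>\<in>space M. \<bar>Y N \<omega> - a\<bar> \<le> \<epsilon>}"
        by (intro finite_measure_mono) auto
      then show ?thesis using assms(2)[OF that \<open>0 < \<epsilon>\<close>] by simp
    qed
    ultimately show ?thesis
      by (intro LIMSEQ_le_const2) blast+
  qed
  have "prob (\<Inter>j. A (1 / Suc j)) \<le> 0"
  proof (rule LIMSEQ_le_const)
    show "(\<lambda>j. K * (1 / Suc j)) \<longlonglongrightarrow> 0"
      by real_asymp
    have "prob (\<Inter>j. A (1 / Suc j)) \<le> K * (1 / Suc j)" for j
    proof -
      have "prob (\<Inter>j. A (1 / Suc j)) \<le> prob (A (1 / Suc j))"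
        by (intro finite_measure_mono) auto
      also have "\<dots> \<le> K * (1 / Suc j)" by (intro A) simp
      finally show ?thesis .
    qed
    then show "\<exists>N. \<forall>n\<ge>N. prob (\<Inter>j. A (1 / Suc j)) \<le> K * (1 / Suc n)" by blast
  qed
  then have "prob (\<Inter>j. A (1 / Suc j)) = 0"
    using measure_nonneg[of M "\<Inter>j. A (1 / Suc j)"] by linarith
  then have "AE \<omega> in M. \<omega> \<notin> (\<Inter>j. A (1 / Suc j))"
    by (intro AE_not_in) (auto simp: null_sets_def emeasure_eq_measure)
  with assms(3) AE_space show ?thesis
  proof (eventually_elim, intro notI)
    fix \<omega> assume \<omega>: "(\<lambda>k. Y k \<omega>) \<longlonglongrightarrow> Z \<omega>" "\<omega> \<in> space M" "\<omega> \<notin> (\<Inter>j. A (1 / Suc j))" "Z \<omega> = a"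
    then obtain j where j: "\<omega> \<notin> A (1 / Suc j)" by auto
    have "eventually (\<lambda>k. dist (Y k \<omega>) a < 1 / Suc j) sequentially"
      using tendstoD[OF \<omega>(1), of "1 / Suc j"] \<omega>(4) by simp
    then obtain N where "\<And>k. k \<ge> N \<Longrightarrow> \<bar>Y k \<omega> - a\<bar> < 1 / Suc j"
      by (auto simp: eventually_sequentially dist_real_def)
    then have "\<omega> \<in> A (1 / Suc j)"
      using \<omega>(2) unfolding A_def by (fastforce intro: less_imp_le)
    with j show False by blast
  qed
qed

end

subsection \<open>Fractional Brownian motion\<close>

definition fbm_cov :: "real \<Rightarrow> real \<Rightarrow> real \<Rightarrow> real" where
  "fbm_cov H t s = (t powr (2 * H) + s powr (2 * H) - \<bar>t - s\<bar> powr (2 * H)) / 2"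

text \<open>The covariance of \<open>B b - B a\<close> and \<open>B d - B c\<close>. The powers of
  the single times cancel, which expresses the stationarity of the increments.\<close>

definition increment_cov :: "real \<Rightarrow> real \<Rightarrow> real \<Rightarrow> real \<Rightarrow> real \<Rightarrow> real" where
  "increment_cov H a b c d = (\<bar>b - c\<bar> powr (2 * H) + \<bar>a - d\<bar> powr (2 * H)
    - \<bar>b - d\<bar> powr (2 * H) - \<bar>a - c\<bar> powr (2 * H)) / 2"

text \<open>The distance \<open>\<bar>t - s\<bar>\<close> is at most the larger time, whose power is
  one of the two summands. Nonnegativity later allows terms to be dropped from variances of
  combinations with nonnegative weights.\<close>

lemma fbm_cov_nonneg:
  assumes "0 \<le> t" "0 \<le> s" "0 < H"
  shows "0 \<le> fbm_cov H t s"
proof -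
  have "\<bar>t - s\<bar> powr (2 * H) \<le> max t s powr (2 * H)"
    using assms by (intro powr_mono2) auto
  also have "\<dots> \<le> t powr (2 * H) + s powr (2 * H)"
    by (auto simp: max_def)
  finally show ?thesis by (simp add: fbm_cov_def)
qed

locale fbm =
  fixes M :: "'a measure" and H :: real and B :: "real \<Rightarrow> 'a \<Rightarrow> real"
  assumes fbm: "fractional_brownian_motion M H B"
    and H_gt: "1 / 2 < H" and H_less: "H < 1"
begin

sublocale prob_space M
  using fbm by (simp add: fractional_brownian_motion_def)

lemma B_measurable [measurable]: "0 \<le> t \<Longrightarrow> B t \<in> borel_measurable M"
  using fbm by (simp add: fractional_brownian_motion_def gaussian_process_def)

lemma B_mean: "0 \<le> t \<Longrightarrow> expectation (B t) = 0"
  using fbm by (simp add: fractional_brownian_motion_def)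

lemma B_cov: "0 \<le> t \<Longrightarrow> 0 \<le> s \<Longrightarrow> expectation (\<lambda>\<omega>. B t \<omega> * B s \<omega>) = fbm_cov H t s"
  using fbm by (simp add: fractional_brownian_motion_def fbm_cov_def)

lemma AE_B_continuous: "AE \<omega> in M. continuous_on {0..} (\<lambda>t. B t \<omega>)"
  using fbm by (simp add: fractional_brownian_motion_def)

text \<open>A Gaussian process is tested on finite sets of times with one coefficient per time. For
  a family \<open>t\<close> with repetitions, the coefficients are summed over each fibre of
  \<open>t\<close>.\<close>

lemma gaussian_lincomb:
  assumes "finite J" "\<And>j. j \<in> J \<Longrightarrow> 0 \<le> t j"
  shows "gaussian_rv M (\<lambda>\<omega>. \<Sum>j\<in>J. c j * B (t j) \<omega>)"
proof -
  have "(\<Sum>j\<in>J. c j * B (t j) \<omega>) = (\<Sum>s\<in>t ` J. (\<Sum>j\<in>{j\<in>J. t j = s}. c j) * B s \<omega>)" for \<omega>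
    by (subst sum.image_gen[OF assms(1), of _ t], intro sum.cong) (auto simp: sum_distrib_right)
  moreover have "gaussian_rv M (\<lambda>\<omega>. \<Sum>s\<in>t ` J. (\<Sum>j\<in>{j\<in>J. t j = s}. c j) * B s \<omega>)"
  proof -
    have gp: "gaussian_process M B"
      using fbm by (simp add: fractional_brownian_motion_def)
    show ?thesis
      by (rule gp[unfolded gaussian_process_def, THEN conjunct2, rule_format]) (use assms in auto)
  qed
  ultimately show ?thesis by simp
qed

lemma gaussian_B: "0 \<le> t \<Longrightarrow> gaussian_rv M (B t)"
  using gaussian_lincomb[of "{()}" "\<lambda>_. t" "\<lambda>_. 1"] by simp

lemma integrable_B: "0 \<le> t \<Longrightarrow> integrable M (B t)"
  using centred_gaussian_integrable_power[OF gaussian_B B_mean, of t 1] by simp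

lemma integrable_B_mult:
  assumes "0 \<le> t" "0 \<le> s"
  shows "integrable M (\<lambda>\<omega>. B t \<omega> * B s \<omega>)"
proof (rule Bochner_Integration.integrable_bound)
  show "integrable M (\<lambda>\<omega>. (B t \<omega>)\<^sup>2 + (B s \<omega>)\<^sup>2)"
    using assms centred_gaussian_integrable_power[OF gaussian_B B_mean, of _ 2] by auto
  show "AE \<omega> in M. norm (B t \<omega> * B s \<omega>) \<le> norm ((B t \<omega>)\<^sup>2 + (B s \<omega>)\<^sup>2)"
  proof (rule AE_I2)
    fix \<omega>
    have "2 * (\<bar>B t \<omega>\<bar> * \<bar>B s \<omega>\<bar>) \<le> \<bar>B t \<omega>\<bar>\<^sup>2 + \<bar>B s \<omega>\<bar>\<^sup>2"
      using sum_squares_bound[of "\<bar>B t \<omega>\<bar>" "\<bar>B s \<omega>\<bar>"] by (simp add: mult.assoc)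
    moreover have "0 \<le> \<bar>B t \<omega>\<bar> * \<bar>B s \<omega>\<bar>" by simp
    ultimately show "norm (B t \<omega> * B s \<omega>) \<le> norm ((B t \<omega>)\<^sup>2 + (B s \<omega>)\<^sup>2)"
      using abs_ge_self[of "(B t \<omega>)\<^sup>2 + (B s \<omega>)\<^sup>2"]
      unfolding real_norm_def abs_mult power2_abs by linarith
  qed
qed (intro borel_measurable_times B_measurable assms)

lemma mean_lincomb:
  assumes "finite J" "\<And>j. j \<in> J \<Longrightarrow> 0 \<le> t j"
  shows "expectation (\<lambda>\<omega>. \<Sum>j\<in>J. c j * B (t j) \<omega>) = 0"
  using assms by (simp add: Bochner_Integration.integral_sum integrable_B B_mean)

lemma variance_lincomb:
  assumes "finite J" "\<And>j. j \<in> J \<Longrightarrow> 0 \<le> t j"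
  shows "expectation (\<lambda>\<omega>. (\<Sum>j\<in>J. c j * B (t j) \<omega>)\<^sup>2)
    = (\<Sum>i\<in>J. \<Sum>j\<in>J. c i * c j * fbm_cov H (t i) (t j))"
proof -
  have "expectation (\<lambda>\<omega>. (\<Sum>j\<in>J. c j * B (t j) \<omega>)\<^sup>2)
    = expectation (\<lambda>\<omega>. \<Sum>i\<in>J. \<Sum>j\<in>J. c i * c j * (B (t i) \<omega> * B (t j) \<omega>))"
    by (simp add: power2_eq_square sum_product mult_ac)
  also have "\<dots> = (\<Sum>i\<in>J. \<Sum>j\<in>J. c i * c j * fbm_cov H (t i) (t j))"
    using assms by (simp add: Bochner_Integration.integral_sum integrable_B_mult B_cov)
  finally show ?thesis .
qed

lemma lincomb_increments:
  fixes c s r :: "'i \<Rightarrow> real"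
  assumes "finite J"
  shows "(\<Sum>j\<in>J. c j * (B (s j) \<omega> - B (r j) \<omega>))
    = (\<Sum>k\<in>J <+> J. (case k of Inl j \<Rightarrow> c j | Inr j \<Rightarrow> - c j)
        * B (case k of Inl j \<Rightarrow> s j | Inr j \<Rightarrow> r j) \<omega>)"
  unfolding sum.Plus[OF assms assms] by (simp add: right_diff_distrib sum_subtractf sum_negf)

lemma
  fixes c s r :: "'i \<Rightarrow> real"
  assumes "finite J" "\<And>j. j \<in> J \<Longrightarrow> 0 \<le> s j" "\<And>j. j \<in> J \<Longrightarrow> 0 \<le> r j"
  shows gaussian_increments: "gaussian_rv M (\<lambda>\<omega>. \<Sum>j\<in>J. c j * (B (s j) \<omega> - B (r j) \<omega>))"
    and mean_increments: "expectation (\<lambda>\<omega>. \<Sum>j\<in>J. c j * (B (s j) \<omega> - B (r j) \<omega>)) = 0"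
    and variance_increments: "expectation (\<lambda>\<omega>. (\<Sum>j\<in>J. c j * (B (s j) \<omega> - B (r j) \<omega>))\<^sup>2)
      = (\<Sum>i\<in>J. \<Sum>j\<in>J. c i * c j * increment_cov H (r i) (s i) (r j) (s j))"
proof -
  have fin: "finite (J <+> J)" using assms(1) by simp
  have nn: "k \<in> J <+> J \<Longrightarrow> 0 \<le> (case k of Inl j \<Rightarrow> s j | Inr j \<Rightarrow> r j)" for k
    using assms by auto
  show "gaussian_rv M (\<lambda>\<omega>. \<Sum>j\<in>J. c j * (B (s j) \<omega> - B (r j) \<omega>))"
    unfolding lincomb_increments[OF assms(1)] by (intro gaussian_lincomb fin nn)
  show "expectation (\<lambda>\<omega>. \<Sum>j\<in>J. c j * (B (s j) \<omega> - B (r j) \<omega>)) = 0"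
    unfolding lincomb_increments[OF assms(1)] by (intro mean_lincomb fin nn)
  show "expectation (\<lambda>\<omega>. (\<Sum>j\<in>J. c j * (B (s j) \<omega> - B (r j) \<omega>))\<^sup>2)
      = (\<Sum>i\<in>J. \<Sum>j\<in>J. c i * c j * increment_cov H (r i) (s i) (r j) (s j))"
  proof -
    let ?D = "\<lambda>j \<omega>. B (s j) \<omega> - B (r j) \<omega>"
    have eq: "?D i \<omega> * ?D j \<omega> = B (s i) \<omega> * B (s j) \<omega> - B (s i) \<omega> * B (r j) \<omega>
        - (B (r i) \<omega> * B (s j) \<omega> - B (r i) \<omega> * B (r j) \<omega>)" for i j \<omega>
      by (simp add: algebra_simps)
    have int: "integrable M (\<lambda>\<omega>. ?D i \<omega> * ?D j \<omega>)" if "i \<in> J" "j \<in> J" for i j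
      unfolding eq using assms that
      by (intro Bochner_Integration.integrable_diff integrable_B_mult) auto
    have cov: "expectation (\<lambda>\<omega>. ?D i \<omega> * ?D j \<omega>) = increment_cov H (r i) (s i) (r j) (s j)" if "i \<in> J" "j \<in> J" for i j
    proof -
      have "expectation (\<lambda>\<omega>. ?D i \<omega> * ?D j \<omega>) = fbm_cov H (s i) (s j) - fbm_cov H (s i) (r j)
          - (fbm_cov H (r i) (s j) - fbm_cov H (r i) (r j))"
        unfolding eq using assms that by (simp add: integrable_B_mult B_cov)
      also have "\<dots> = increment_cov H (r i) (s i) (r j) (s j)"
        unfolding fbm_cov_def increment_cov_def by (simp add: diff_divide_distrib add_divide_distrib)
      finally show ?thesis .
    qed
    have "expectation (\<lambda>\<omega>. (\<Sum>j\<in>J. c j * ?D j \<omega>)\<^sup>2)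
      = expectation (\<lambda>\<omega>. \<Sum>i\<in>J. \<Sum>j\<in>J. c i * c j * (?D i \<omega> * ?D j \<omega>))"
      unfolding power2_eq_square sum_product
      by (intro Bochner_Integration.integral_cong sum.cong refl) (simp only: mult_ac)
    also have "\<dots> = (\<Sum>i\<in>J. \<Sum>j\<in>J. c i * c j * expectation (\<lambda>\<omega>. ?D i \<omega> * ?D j \<omega>))"
      using int by (simp add: Bochner_Integration.integral_sum)
    finally show ?thesis
      using cov by simp
  qed
qed

lemma gaussian_increment:
  assumes "0 \<le> s" "0 \<le> r"
  shows "gaussian_rv M (\<lambda>\<omega>. B s \<omega> - B r \<omega>)" "expectation (\<lambda>\<omega>. B s \<omega> - B r \<omega>) = 0"
    "expectation (\<lambda>\<omega>. (B s \<omega> - B r \<omega>)\<^sup>2) = \<bar>s - r\<bar> powr (2 * H)"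
proof -
  show "gaussian_rv M (\<lambda>\<omega>. B s \<omega> - B r \<omega>)"
    using gaussian_increments[of "{()}" "\<lambda>_. s" "\<lambda>_. r" "\<lambda>_. 1"] assms by simp
  show "expectation (\<lambda>\<omega>. B s \<omega> - B r \<omega>) = 0"
    using assms by (simp add: integrable_B B_mean)
  show "expectation (\<lambda>\<omega>. (B s \<omega> - B r \<omega>)\<^sup>2) = \<bar>s - r\<bar> powr (2 * H)"
    using variance_increments[of "{()}" "\<lambda>_. s" "\<lambda>_. r" "\<lambda>_. 1"] assms
    by (simp add: increment_cov_def abs_minus_commute[of r s])
qed

end

subsection \<open>The kernel of the fractional Wiener integral\<close>

text \<open>The odd function sgn(x) |x|^p. It lies halfway between |x|^(p-1) and |x|^(p+1):
  integrating the kernel once gives this function, integrating twice gives the powers in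
  \<open>increment_cov\<close>. Writing it with \<open>max\<close> makes it visibly continuous at 0
  for p > 0.\<close>

definition signed_powr :: "real \<Rightarrow> real \<Rightarrow> real" where
  "signed_powr p x = max 0 x powr p - max 0 (- x) powr p"

lemma continuous_on_signed_powr [continuous_intros]:
  assumes "0 < p" "continuous_on S f"
  shows "continuous_on S (\<lambda>x. signed_powr p (f x))"
  unfolding signed_powr_def using assms
  by (intro continuous_intros continuous_on_powr') auto

lemma signed_powr_mono:
  assumes "0 < p" "x \<le> y"
  shows "signed_powr p x \<le> signed_powr p y"
  unfolding signed_powr_def using assms by (intro diff_mono powr_mono2) auto

lemma signed_powr_deriv:
  assumes "x \<noteq> 0"
  shows "(signed_powr p has_real_derivative p * \<bar>x\<bar> powr (p - 1)) (at x)"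
proof (cases "0 < x")
  case True
  have "((\<lambda>x. x powr p) has_real_derivative p * \<bar>x\<bar> powr (p - 1)) (at x)"
    using has_real_derivative_powr[OF True, of p] True by simp
  then show ?thesis
    by (rule has_field_derivative_transform_within_open[of _ _ _ "{0<..}"])
      (use True in \<open>auto simp: signed_powr_def max_def\<close>)
next
  case False
  with assms have x: "0 < - x" by simp
  have "((\<lambda>x. - ((- x) powr p)) has_real_derivative p * \<bar>x\<bar> powr (p - 1)) (at x)"
    using DERIV_chain2[OF has_real_derivative_powr[OF x, of p] DERIV_minus[OF DERIV_ident]] x
    by (auto intro!: derivative_eq_intros)
  then show ?thesis
    by (rule has_field_derivative_transform_within_open[of _ _ _ "{..<0}"])
      (use x in \<open>auto simp: signed_powr_def max_def\<close>)
qed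

lemma abs_powr_deriv:
  assumes "x \<noteq> 0" "0 < p"
  shows "((\<lambda>x. \<bar>x\<bar> powr (p + 1) / (p + 1)) has_real_derivative signed_powr p x) (at x)"
proof (cases "0 < x")
  case True
  have "((\<lambda>x. x powr (p + 1) / (p + 1)) has_real_derivative signed_powr p x) (at x)"
    using DERIV_cdivide[OF has_real_derivative_powr[OF True, of "p + 1"], of "p + 1"] True assms(2)
    by (simp add: signed_powr_def max_def)
  then show ?thesis
    by (rule has_field_derivative_transform_within_open[of _ _ _ "{0<..}"]) (use True in auto)
next
  case False
  with assms have x: "0 < - x" by simp
  have "((\<lambda>x. (- x) powr (p + 1) / (p + 1)) has_real_derivative signed_powr p x) (at x)"
    using DERIV_cdivide[OF DERIV_chain2[OF has_real_derivative_powr[OF x, of "p + 1"]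
        DERIV_minus[OF DERIV_ident]], of "p + 1"] x assms(2)
    by (simp add: signed_powr_def max_def)
  then show ?thesis
    by (rule has_field_derivative_transform_within_open[of _ _ _ "{..<0}"]) (use x in auto)
qed

text \<open>Off the diagonal this is the mixed second derivative of \<open>fbm_cov H\<close> in s
  and t.\<close>

definition wiener_kernel :: "real \<Rightarrow> real \<Rightarrow> real \<Rightarrow> real" where
  "wiener_kernel H s t = H * (2 * H - 1) * \<bar>s - t\<bar> powr (2 * H - 2)"

lemma wiener_kernel_nonneg: "1 / 2 < H \<Longrightarrow> 0 \<le> wiener_kernel H s t"
  by (simp add: wiener_kernel_def)

lemma wiener_kernel_measurable [measurable]:
  assumes [measurable]: "f \<in> borel_measurable N" "g \<in> borel_measurable N"
  shows "(\<lambda>x. wiener_kernel H (f x) (g x)) \<in> borel_measurable N"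
  unfolding wiener_kernel_def by measurable

lemma nn_integral_half_open_interval:
  "(\<integral>\<^sup>+x\<in>{a<..b}. f x \<partial>lborel) = (\<integral>\<^sup>+x\<in>{a..b::real}. f x \<partial>lborel)"
  using AE_lborel_singleton[of a] by (intro nn_integral_cong_AE) (auto simp: indicator_def)

text \<open>The kernel is unbounded near t = s, but its primitive is continuous there since 2 H - 1
  > 0. The fundamental theorem of calculus with the single exceptional point s therefore covers the
  improper integral.\<close>

lemma wiener_kernel_integral:
  assumes "1 / 2 < H" "c \<le> d"
  shows "(\<integral>\<^sup>+t\<in>{c..d}. ennreal (wiener_kernel H s t) \<partial>lborel)
    = ennreal (H * (signed_powr (2 * H - 1) (s - c) - signed_powr (2 * H - 1) (s - d)))"
proof (rule nn_integral_has_integral_lebesgue'[OF wiener_kernel_nonneg[OF assms(1)]])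
  let ?F = "\<lambda>t. - H * signed_powr (2 * H - 1) (s - t)"
  have "(wiener_kernel H s has_integral ?F d - ?F c) {c..d}"
  proof (rule fundamental_theorem_of_calculus_interior_strong[of "{s}"])
    fix t assume "t \<in> {c<..<d} - {s}"
    then have "s - t \<noteq> 0" by auto
    moreover have "((\<lambda>t. s - t) has_real_derivative - 1) (at t)"
      by (auto intro!: derivative_eq_intros)
    ultimately have "((\<lambda>t. signed_powr (2 * H - 1) (s - t)) has_real_derivative
        (2 * H - 1) * \<bar>s - t\<bar> powr (2 * H - 1 - 1) * - 1) (at t)"
      by (intro DERIV_chain2[where g="\<lambda>t. s - t"] signed_powr_deriv)
    then show "(?F has_vector_derivative wiener_kernel H s t) (at t)"
      unfolding has_real_derivative_iff_has_vector_derivative[symmetric]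
      by (auto intro!: derivative_eq_intros simp: wiener_kernel_def)
  next
    show "continuous_on {c..d} ?F"
      using assms by (intro continuous_intros) auto
  qed (use assms in auto)
  then show "(wiener_kernel H s has_integral
      H * (signed_powr (2 * H - 1) (s - c) - signed_powr (2 * H - 1) (s - d))) {c..d}"
    by (simp add: algebra_simps)
qed

lemma wiener_kernel_rectangle_has_integral:
  assumes "1 / 2 < H" "a \<le> b"
  shows "((\<lambda>s. H * (signed_powr (2 * H - 1) (s - c) - signed_powr (2 * H - 1) (s - d))) has_integral increment_cov H a b c d) {a..b}"
proof -
  let ?P = "signed_powr (2 * H - 1)"
  let ?F = "\<lambda>s. \<bar>s - c\<bar> powr (2 * H) / 2 - \<bar>s - d\<bar> powr (2 * H) / 2"
  have "((\<lambda>s. H * (?P (s - c) - ?P (s - d))) has_integral ?F b - ?F a) {a..b}"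
  proof (rule fundamental_theorem_of_calculus_interior_strong[of "{c, d}"])
    fix s assume s: "s \<in> {a<..<b} - {c, d}"
    have *: "((\<lambda>s. \<bar>s - x\<bar> powr (2 * H) / (2 * H)) has_real_derivative ?P (s - x)) (at s)"
      if "s \<noteq> x" for x
    proof -
      have "((\<lambda>s. s - x) has_real_derivative 1) (at s)"
        by (auto intro!: derivative_eq_intros)
      from DERIV_chain2[where f="\<lambda>y. \<bar>y\<bar> powr (2 * H - 1 + 1) / (2 * H - 1 + 1)", OF abs_powr_deriv this]
      show ?thesis using assms that by simp
    qed
    have "((\<lambda>s. H * (\<bar>s - c\<bar> powr (2 * H) / (2 * H) - \<bar>s - d\<bar> powr (2 * H) / (2 * H)))
        has_real_derivative H * (?P (s - c) - ?P (s - d))) (at s)"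
      using s by (intro DERIV_cmult DERIV_diff *) auto
    then show "(?F has_vector_derivative H * (?P (s - c) - ?P (s - d))) (at s)"
      unfolding has_real_derivative_iff_has_vector_derivative[symmetric]
      using assms by (simp add: diff_divide_distrib[symmetric])
  next
    show "continuous_on {a..b} ?F"
      using assms by (intro continuous_intros continuous_on_powr') auto
  qed (use assms in auto)
  moreover have "?F b - ?F a = increment_cov H a b c d"
    by (simp add: increment_cov_def field_simps)
  ultimately show ?thesis by simp
qed

lemma wiener_kernel_section_nonneg:
  assumes "1 / 2 < H" "c \<le> d"
  shows "0 \<le> H * (signed_powr (2 * H - 1) (s - c) - signed_powr (2 * H - 1) (s - d))"
  using assms signed_powr_mono[of "2 * H - 1" "s - d" "s - c"] by simp

lemma wiener_kernel_rectangle: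
  assumes "1 / 2 < H" "a \<le> b" "c \<le> d"
  shows "(\<integral>\<^sup>+s\<in>{a..b}. (\<integral>\<^sup>+t\<in>{c..d}. ennreal (wiener_kernel H s t) \<partial>lborel) \<partial>lborel)
    = ennreal (increment_cov H a b c d)"
  unfolding wiener_kernel_integral[OF assms(1,3)]
  by (intro nn_integral_has_integral_lebesgue' wiener_kernel_rectangle_has_integral
      wiener_kernel_section_nonneg assms)

text \<open>Increments of B are positively correlated for H > 1/2: their covariance is the integral
  of nonnegative sections of the kernel.\<close>

lemma increment_cov_nonneg:
  fixes a b c d H :: real
  assumes "1 / 2 < H" "a \<le> b" "c \<le> d"
  shows "0 \<le> increment_cov H a b c d"
  using has_integral_nonneg[OF wiener_kernel_rectangle_has_integral[OF assms(1,2)]]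
    wiener_kernel_section_nonneg[OF assms(1,3)] by blast

section \<open>Step functions: their norm and the variance of their integrals\<close>

lemma partition_mono:
  fixes u :: "nat \<Rightarrow> real"
  assumes "\<And>j. j < m \<Longrightarrow> u j \<le> u (Suc j)" "i \<le> j" "j \<le> m"
  shows "u i \<le> u j"
  using assms(2,3)
proof (induction j rule: dec_induct)
  case (step n)
  then show ?case using assms(1)[of n] by simp
qed simp

text \<open>The half-open intervals of a monotone partition are disjoint, so at most one summand is
  nonzero at s.\<close>

lemma abs_step_fun:
  assumes "\<And>j. j < m \<Longrightarrow> u j \<le> u (Suc j)"
  shows "\<bar>step_fun m u c s\<bar> = (\<Sum>j<m. \<bar>c j\<bar> * indicator {u j<..u (Suc j)} s)"
  using assms
proof (induction m)
  case (Suc m)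
  show ?case
  proof (cases "s \<in> {u m<..u (Suc m)}")
    case True
    have "s \<notin> {u j<..u (Suc j)}" if "j < m" for j
      using partition_mono[of m u "Suc j" m] Suc.prems True that by fastforce
    then show ?thesis
      by (simp add: step_fun_def abs_mult)
  next
    case False
    then show ?thesis
      using Suc.IH Suc.prems by (simp add: step_fun_def)
  qed
qed (simp add: step_fun_def)

lemma step_fun_measurable [measurable]: "step_fun m u c \<in> borel_measurable borel"
  unfolding step_fun_def[abs_def] by measurable

lemma wiener_norm_sq_kernel:
  assumes "1 / 2 < H"
  shows "wiener_norm_sq H T g = (\<integral>\<^sup>+s\<in>{0..T}. (\<integral>\<^sup>+t\<in>{0..T}.
    ennreal (wiener_kernel H s t) * (ennreal \<bar>g s\<bar> * ennreal \<bar>g t\<bar>) \<partial>lborel) \<partial>lborel)"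
  unfolding wiener_norm_sq_def
  using assms by (simp add: wiener_kernel_def ennreal_mult[symmetric] mult_ac)

lemma signed_powr_nonneg: "0 \<le> x \<Longrightarrow> signed_powr p x = x powr p"
  by (cases "x = 0") (auto simp: signed_powr_def max_def)

lemma signed_powr_nonpos: "x \<le> 0 \<Longrightarrow> signed_powr p x = - ((- x) powr p)"
  by (cases "x = 0") (auto simp: signed_powr_def max_def)

lemma ennreal_abs_step_fun:
  assumes "\<And>j. j < m \<Longrightarrow> u j \<le> u (Suc j)"
  shows "ennreal \<bar>step_fun m u c s\<bar> = (\<Sum>j<m. ennreal \<bar>c j\<bar> * indicator {u j<..u (Suc j)} s)"
proof -
  have "\<bar>step_fun m u c s\<bar> = (\<Sum>j<m. \<bar>c j\<bar> * indicator {u j<..u (Suc j)} s)"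
    by (rule abs_step_fun) (rule assms)
  then have "ennreal \<bar>step_fun m u c s\<bar> = (\<Sum>j<m. ennreal (\<bar>c j\<bar> * indicator {u j<..u (Suc j)} s))"
    by (simp add: indicator_def)
  then show ?thesis
    by (simp add: ennreal_mult ennreal_indicator)
qed

text \<open>Bilinear expansion into rectangles. The intervals lie in [0, T], so the restriction to
  that range disappears, and the kernel integrates to \<open>increment_cov\<close> on every
  rectangle.\<close>

lemma wiener_norm_sq_step_fun:
  assumes H: "1 / 2 < H"
    and u: "0 \<le> u 0" "\<And>j. j < m \<Longrightarrow> u j \<le> u (Suc j)" "u m \<le> T"
  shows "wiener_norm_sq H T (step_fun m u c) = (\<Sum>i<m. \<Sum>j<m. ennreal (\<bar>c i\<bar> * \<bar>c j\<bar>) *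
    ennreal (increment_cov H (u i) (u (Suc i)) (u j) (u (Suc j))))"
proof -
  define I where "I j = {u j<..u (Suc j)}" for j
  define k where "k s t = ennreal (wiener_kernel H s t)" for s t
  define G where "G s = (\<Sum>j<m. ennreal \<bar>c j\<bar> * indicator (I j) s)" for s
  have [measurable]: "I j \<in> sets borel" for j by (simp add: I_def)
  have [measurable]: "(\<lambda>x. k (f x) (g x)) \<in> borel_measurable N"
    if [measurable]: "f \<in> borel_measurable N" "g \<in> borel_measurable N" for f g and N :: "'z measure"
    unfolding k_def by measurable
  have sub: "I j \<subseteq> {0..T}" if "j < m" for j
  proof -
    have "u 0 \<le> u j" "u (Suc j) \<le> u m"
      using partition_mono[of m u 0 j] partition_mono[of m u "Suc j" m] u(2) that by auto
    then show ?thesis using u(1,3) by (auto simp: I_def)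
  qed
  have ind: "indicator (I j) s * indicator {0..T} s = (indicator (I j) s :: ennreal)" if "j < m" for j s
    using sub[OF that] by (auto simp: indicator_def)
  have G_ind: "G s * indicator {0..T} s = G s" for s
    unfolding G_def sum_distrib_right mult.assoc
    by (intro sum.cong refl arg_cong2[where f="(*)"] ind) simp
  have G_step: "ennreal \<bar>step_fun m u c s\<bar> = G s" for s
    unfolding G_def I_def by (rule ennreal_abs_step_fun) (rule u(2))
  have inner: "(\<integral>\<^sup>+t\<in>{0..T}. k s t * (G s * G t) \<partial>lborel)
      = (\<Sum>j<m. G s * ennreal \<bar>c j\<bar> * (\<integral>\<^sup>+t\<in>I j. k s t \<partial>lborel))" for s
  proof -
    have "(\<integral>\<^sup>+t\<in>{0..T}. k s t * (G s * G t) \<partial>lborel)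
      = (\<integral>\<^sup>+t. (\<Sum>j<m. G s * ennreal \<bar>c j\<bar> * (k s t * indicator (I j) t)) \<partial>lborel)"
    proof (intro nn_integral_cong)
      fix t
      have "k s t * (G s * G t) * indicator {0..T} t = k s t * (G s * (G t * indicator {0..T} t))"
        by (simp only: mult.assoc)
      also have "\<dots> = k s t * (G s * (\<Sum>j<m. ennreal \<bar>c j\<bar> * indicator (I j) t))"
        unfolding G_ind by (simp add: G_def)
      also have "\<dots> = (\<Sum>j<m. G s * ennreal \<bar>c j\<bar> * (k s t * indicator (I j) t))"
        by (simp only: sum_distrib_left mult_ac)
      finally show "k s t * (G s * G t) * indicator {0..T} t
        = (\<Sum>j<m. G s * ennreal \<bar>c j\<bar> * (k s t * indicator (I j) t))" .
    qed
    also have "\<dots> = (\<Sum>j<m. G s * ennreal \<bar>c j\<bar> * (\<integral>\<^sup>+t\<in>I j. k s t \<partial>lborel))"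
      by (subst nn_integral_sum) (auto intro!: sum.cong nn_integral_cmult)
    finally show ?thesis .
  qed
  have "wiener_norm_sq H T (step_fun m u c)
      = (\<integral>\<^sup>+s\<in>{0..T}. (\<integral>\<^sup>+t\<in>{0..T}. k s t * (G s * G t) \<partial>lborel) \<partial>lborel)"
    unfolding wiener_norm_sq_kernel[OF H] G_step k_def ..
  also have "\<dots> = (\<integral>\<^sup>+s. (\<Sum>i<m. \<Sum>j<m. ennreal \<bar>c i\<bar> * ennreal \<bar>c j\<bar> *
      ((\<integral>\<^sup>+t\<in>I j. k s t \<partial>lborel) * indicator (I i) s)) \<partial>lborel)"
  proof (intro nn_integral_cong)
    fix s
    have "(\<integral>\<^sup>+t\<in>{0..T}. k s t * (G s * G t) \<partial>lborel) * indicator {0..T} s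
      = (G s * indicator {0..T} s) * (\<Sum>j<m. ennreal \<bar>c j\<bar> * (\<integral>\<^sup>+t\<in>I j. k s t \<partial>lborel))"
      unfolding inner by (simp add: sum_distrib_left sum_distrib_right mult_ac)
    also have "\<dots> = (\<Sum>i<m. \<Sum>j<m. ennreal \<bar>c i\<bar> * ennreal \<bar>c j\<bar> *
      ((\<integral>\<^sup>+t\<in>I j. k s t \<partial>lborel) * indicator (I i) s))"
      unfolding G_ind unfolding G_def sum_product by (simp only: mult_ac)
    finally show "(\<integral>\<^sup>+t\<in>{0..T}. k s t * (G s * G t) \<partial>lborel) * indicator {0..T} s = \<dots>" .
  qed
  also have "\<dots> = (\<Sum>i<m. \<Sum>j<m. ennreal \<bar>c i\<bar> * ennreal \<bar>c j\<bar> *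
      (\<integral>\<^sup>+s\<in>I i. (\<integral>\<^sup>+t\<in>I j. k s t \<partial>lborel) \<partial>lborel))"
    by (simp add: nn_integral_sum nn_integral_cmult)
  also have "\<dots> = (\<Sum>i<m. \<Sum>j<m. ennreal (\<bar>c i\<bar> * \<bar>c j\<bar>) *
    ennreal (increment_cov H (u i) (u (Suc i)) (u j) (u (Suc j))))"
    unfolding I_def k_def nn_integral_half_open_interval
    using u(2) by (intro sum.cong refl) (simp add: wiener_kernel_rectangle[OF H] ennreal_mult)
  finally show ?thesis .
qed

text \<open>The variance is the same double sum with \<open>c i * c j\<close> in place of the
  absolute values. Since the increment covariances are nonnegative, the comparison holds term by
  term.\<close>

lemma (in fbm) step_integral_variance:
  assumes u: "0 \<le> u 0" "\<And>j. j < m \<Longrightarrow> u j \<le> u (Suc j)" "u m \<le> T"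
  shows "ennreal (expectation (\<lambda>\<omega>. (step_integral B m u c \<omega>)\<^sup>2)) \<le> wiener_norm_sq H T (step_fun m u c)"
proof -
  have u0: "0 \<le> u j" if "j \<le> m" for j
    using partition_mono[of m u 0 j] u(1,2) that by auto
  define \<rho> where "\<rho> i j = increment_cov H (u i) (u (Suc i)) (u j) (u (Suc j))" for i j
  have \<rho>: "0 \<le> \<rho> i j" if "i < m" "j < m" for i j
    unfolding \<rho>_def by (intro increment_cov_nonneg H_gt u(2) that)
  have "expectation (\<lambda>\<omega>. (step_integral B m u c \<omega>)\<^sup>2) = (\<Sum>i<m. \<Sum>j<m. c i * c j * \<rho> i j)"
    unfolding step_integral_def \<rho>_def
    by (subst variance_increments) (auto intro!: u0)
  also have "\<dots> \<le> (\<Sum>i<m. \<Sum>j<m. \<bar>c i\<bar> * \<bar>c j\<bar> * \<rho> i j)"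
    by (intro sum_mono mult_right_mono \<rho>) (auto simp: abs_mult[symmetric])
  finally have "ennreal (expectation (\<lambda>\<omega>. (step_integral B m u c \<omega>)\<^sup>2))
      \<le> ennreal (\<Sum>i<m. \<Sum>j<m. \<bar>c i\<bar> * \<bar>c j\<bar> * \<rho> i j)"
    by (rule ennreal_leI)
  also have "\<dots> = (\<Sum>i<m. \<Sum>j<m. ennreal (\<bar>c i\<bar> * \<bar>c j\<bar>) * ennreal (\<rho> i j))"
  proof -
    have "ennreal (\<bar>c i\<bar> * \<bar>c j\<bar>) * ennreal (\<rho> i j) = ennreal (\<bar>c i\<bar> * \<bar>c j\<bar> * \<rho> i j)"
      if "i < m" "j < m" for i j
      using that by (intro ennreal_mult[symmetric] \<rho>) auto
    then have "(\<Sum>i<m. \<Sum>j<m. ennreal (\<bar>c i\<bar> * \<bar>c j\<bar>) * ennreal (\<rho> i j))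
      = (\<Sum>i<m. \<Sum>j<m. ennreal (\<bar>c i\<bar> * \<bar>c j\<bar> * \<rho> i j))"
      by simp
    also have "\<dots> = (\<Sum>i<m. ennreal (\<Sum>j<m. \<bar>c i\<bar> * \<bar>c j\<bar> * \<rho> i j))"
      by (intro sum.cong refl sum_ennreal) (simp add: \<rho>)
    also have "\<dots> = ennreal (\<Sum>i<m. \<Sum>j<m. \<bar>c i\<bar> * \<bar>c j\<bar> * \<rho> i j)"
      by (intro sum_ennreal sum_nonneg) (simp add: \<rho>)
    finally show ?thesis ..
  qed
  also have "\<dots> = wiener_norm_sq H T (step_fun m u c)"
    using wiener_norm_sq_step_fun[OF H_gt, of u m T] u unfolding \<rho>_def by simp
  finally show ?thesis .
qed


section \<open>Stability of the norm under approximation\<close>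

lemma wiener_kernel_square:
  assumes "1 / 2 < H" "0 \<le> T"
  shows "(\<integral>\<^sup>+s\<in>{0..T}. (\<integral>\<^sup>+t\<in>{0..T}. ennreal (K\<^sup>2) * ennreal (wiener_kernel H s t) \<partial>lborel) \<partial>lborel)
    = ennreal (K\<^sup>2 * T powr (2 * H))"
proof -
  have "(\<integral>\<^sup>+s\<in>{0..T}. (\<integral>\<^sup>+t\<in>{0..T}. ennreal (K\<^sup>2) * ennreal (wiener_kernel H s t) \<partial>lborel) \<partial>lborel)
    = ennreal (K\<^sup>2) * (\<integral>\<^sup>+s\<in>{0..T}. (\<integral>\<^sup>+t\<in>{0..T}. ennreal (wiener_kernel H s t) \<partial>lborel) \<partial>lborel)"
    by (simp add: nn_integral_cmult mult.assoc)
  then show ?thesis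
    using assms by (simp add: wiener_kernel_rectangle increment_cov_def ennreal_mult[symmetric])
qed

text \<open>With e = |f - g|, the pointwise bound |g| \<le> K + e is inserted in both variables and
  multiplied out. The constant part is the variance \<open>T powr (2 * H)\<close> times K squared,
  the part with e twice is the norm of f - g. In the cross terms one variable is free, and the
  integral of the kernel over it is at most \<open>2 * H * T powr (2 * H - 1)\<close>, which leaves
  the L1 norm of e.\<close>

lemma wiener_norm_sq_perturb:
  fixes f g :: "real \<Rightarrow> real"
  assumes H: "1 / 2 < H" "H < 1" and T: "0 \<le> T" and K: "\<And>s. \<bar>f s\<bar> \<le> K"
    and [measurable]: "f \<in> borel_measurable borel" "g \<in> borel_measurable borel"
  shows "wiener_norm_sq H T g \<le> ennreal (K\<^sup>2 * T powr (2 * H)) + wiener_norm_sq H T (\<lambda>s. f s - g s)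
    + 2 * (ennreal (K * (2 * H * T powr (2 * H - 1))) * (\<integral>\<^sup>+s\<in>{0..T}. ennreal \<bar>f s - g s\<bar> \<partial>lborel))"
proof -
  define dbl where "dbl h = (\<integral>\<^sup>+s\<in>{0..T}. (\<integral>\<^sup>+t\<in>{0..T}. h s t \<partial>lborel) \<partial>lborel)"
    for h :: "real \<Rightarrow> real \<Rightarrow> ennreal"
  define k where "k s t = ennreal (wiener_kernel H s t)" for s t
  define e where "e s = ennreal \<bar>f s - g s\<bar>" for s
  have [measurable]: "(\<lambda>x. k (p x) (q x)) \<in> borel_measurable N"
    if [measurable]: "p \<in> borel_measurable N" "q \<in> borel_measurable N" for p q and N :: "'z measure"
    unfolding k_def by measurable
  have [measurable]: "e \<in> borel_measurable borel"
    unfolding e_def by measurable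
  have K0: "0 \<le> K" using K[of 0] by simp
  have add: "dbl (\<lambda>s t. h s t + h' s t) = dbl h + dbl h'"
    if [measurable]: "case_prod h \<in> borel_measurable (lborel \<Otimes>\<^sub>M lborel)"
      "case_prod h' \<in> borel_measurable (lborel \<Otimes>\<^sub>M lborel)" for h h'
    unfolding dbl_def by (simp add: distrib_right nn_integral_add)
  have cross: "dbl (\<lambda>s t. k s t * (ennreal K * e s))
      \<le> ennreal (K * (2 * H * T powr (2 * H - 1))) * (\<integral>\<^sup>+s\<in>{0..T}. e s \<partial>lborel)"
  proof -
    have in_le: "(\<integral>\<^sup>+t\<in>{0..T}. k s t \<partial>lborel) \<le> ennreal (2 * H * T powr (2 * H - 1))" if "s \<in> {0..T}" for s
    proof -
      have "H * (signed_powr (2 * H - 1) (s - 0) - signed_powr (2 * H - 1) (s - T))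
          = H * (s powr (2 * H - 1) + (T - s) powr (2 * H - 1))"
        using that by (simp add: signed_powr_nonneg signed_powr_nonpos)
      also have "\<dots> \<le> H * (T powr (2 * H - 1) + T powr (2 * H - 1))"
        using that H by (intro mult_left_mono add_mono powr_mono2) auto
      finally show ?thesis
        unfolding k_def wiener_kernel_integral[OF H(1) T] by (intro ennreal_leI) simp
    qed
    have "dbl (\<lambda>s t. k s t * (ennreal K * e s))
      = (\<integral>\<^sup>+s. ennreal K * ((e s * indicator {0..T} s) * (\<integral>\<^sup>+t\<in>{0..T}. k s t \<partial>lborel)) \<partial>lborel)"
    proof -
      have "(\<integral>\<^sup>+t\<in>{0..T}. k s t * (ennreal K * e s) \<partial>lborel)
        = ennreal K * e s * (\<integral>\<^sup>+t\<in>{0..T}. k s t \<partial>lborel)" for s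
        by (subst nn_integral_cmult[symmetric]) (auto intro!: nn_integral_cong simp: mult_ac)
      then show ?thesis
        unfolding dbl_def by (simp add: mult_ac)
    qed
    also have "\<dots> \<le> (\<integral>\<^sup>+s. ennreal K * ((e s * indicator {0..T} s) * ennreal (2 * H * T powr (2 * H - 1))) \<partial>lborel)"
    proof (intro nn_integral_mono mult_left_mono[of _ _ "ennreal K"])
      fix s
      show "(e s * indicator {0..T} s) * (\<integral>\<^sup>+t\<in>{0..T}. k s t \<partial>lborel)
        \<le> (e s * indicator {0..T} s) * ennreal (2 * H * T powr (2 * H - 1))"
      proof (cases "s \<in> {0..T}")
        case True
        then show ?thesis by (intro mult_left_mono in_le) auto
      qed simp
    qed simp
    also have "\<dots> = ennreal (K * (2 * H * T powr (2 * H - 1))) * (\<integral>\<^sup>+s\<in>{0..T}. e s \<partial>lborel)"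
    proof -
      have "ennreal K * ((e s * indicator {0..T} s) * ennreal (2 * H * T powr (2 * H - 1)))
        = ennreal (K * (2 * H * T powr (2 * H - 1))) * (e s * indicator {0..T} s)" for s
        using K0 H by (simp add: ennreal_mult mult_ac)
      then show ?thesis by (simp add: nn_integral_cmult)
    qed
    finally show ?thesis .
  qed
  have swap: "dbl (\<lambda>s t. k s t * (ennreal K * e t)) = dbl (\<lambda>s t. k s t * (ennreal K * e s))"
  proof -
    have "dbl (\<lambda>s t. k s t * (ennreal K * e t))
      = (\<integral>\<^sup>+s. (\<integral>\<^sup>+t. k s t * (ennreal K * e t) * indicator {0..T} t * indicator {0..T} s \<partial>lborel) \<partial>lborel)"
      unfolding dbl_def by (simp add: nn_integral_multc)
    also have "\<dots> = (\<integral>\<^sup>+t. (\<integral>\<^sup>+s. k s t * (ennreal K * e t) * indicator {0..T} t * indicator {0..T} s \<partial>lborel) \<partial>lborel)"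
      by (rule lborel_pair.Fubini'[symmetric]) measurable
    also have "\<dots> = (\<integral>\<^sup>+t. (\<integral>\<^sup>+s. k t s * (ennreal K * e t) * indicator {0..T} s * indicator {0..T} t \<partial>lborel) \<partial>lborel)"
      by (simp add: k_def wiener_kernel_def abs_minus_commute mult_ac)
    also have "\<dots> = dbl (\<lambda>s t. k s t * (ennreal K * e s))"
      unfolding dbl_def by (simp add: nn_integral_multc)
    finally show ?thesis .
  qed
  have "wiener_norm_sq H T g = dbl (\<lambda>s t. k s t * (ennreal \<bar>g s\<bar> * ennreal \<bar>g t\<bar>))"
    unfolding wiener_norm_sq_kernel[OF H(1)] dbl_def k_def ..
  also have "\<dots> \<le> dbl (\<lambda>s t. ennreal (K\<^sup>2) * k s t + (k s t * (e s * e t)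
      + (k s t * (ennreal K * e s) + k s t * (ennreal K * e t))))"
    unfolding dbl_def
  proof (intro nn_integral_mono mult_right_mono)
    fix s t
    have *: "ennreal \<bar>g r\<bar> \<le> ennreal K + e r" for r
    proof -
      have "\<bar>g r\<bar> \<le> K + \<bar>f r - g r\<bar>" using K[of r] by linarith
      then show ?thesis
        unfolding e_def using K0 by (simp add: ennreal_plus[symmetric] ennreal_leI del: ennreal_plus)
    qed
    have "k s t * (ennreal \<bar>g s\<bar> * ennreal \<bar>g t\<bar>) \<le> k s t * ((ennreal K + e s) * (ennreal K + e t))"
      by (intro mult_left_mono mult_mono *) auto
    also have "\<dots> = ennreal (K\<^sup>2) * k s t + (k s t * (e s * e t)
      + (k s t * (ennreal K * e s) + k s t * (ennreal K * e t)))"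
      using K0 by (simp add: power2_eq_square ennreal_mult algebra_simps)
    finally show "k s t * (ennreal \<bar>g s\<bar> * ennreal \<bar>g t\<bar>) \<le> ennreal (K\<^sup>2) * k s t + (k s t * (e s * e t)
      + (k s t * (ennreal K * e s) + k s t * (ennreal K * e t)))" .
  qed auto
  also have "\<dots> = dbl (\<lambda>s t. ennreal (K\<^sup>2) * k s t) + (dbl (\<lambda>s t. k s t * (e s * e t))
      + (dbl (\<lambda>s t. k s t * (ennreal K * e s)) + dbl (\<lambda>s t. k s t * (ennreal K * e t))))"
    by (simp add: add)
  also have "dbl (\<lambda>s t. ennreal (K\<^sup>2) * k s t) = ennreal (K\<^sup>2 * T powr (2 * H))"
    unfolding dbl_def k_def by (rule wiener_kernel_square[OF H(1) T])
  also have "dbl (\<lambda>s t. k s t * (e s * e t)) = wiener_norm_sq H T (\<lambda>s. f s - g s)"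
    unfolding wiener_norm_sq_kernel[OF H(1)] dbl_def k_def e_def ..
  finally have "wiener_norm_sq H T g \<le> ennreal (K\<^sup>2 * T powr (2 * H)) + (wiener_norm_sq H T (\<lambda>s. f s - g s)
      + (dbl (\<lambda>s t. k s t * (ennreal K * e s)) + dbl (\<lambda>s t. k s t * (ennreal K * e s))))"
    unfolding swap .
  also have "\<dots> \<le> ennreal (K\<^sup>2 * T powr (2 * H)) + (wiener_norm_sq H T (\<lambda>s. f s - g s)
      + (ennreal (K * (2 * H * T powr (2 * H - 1))) * (\<integral>\<^sup>+s\<in>{0..T}. e s \<partial>lborel)
        + ennreal (K * (2 * H * T powr (2 * H - 1))) * (\<integral>\<^sup>+s\<in>{0..T}. e s \<partial>lborel)))"
    by (rule add_left_mono, rule add_left_mono, rule add_mono) (rule cross)+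
  finally show ?thesis
    unfolding e_def mult_2 add.assoc .
qed

text \<open>On [0, T] distances are at most T and the exponent 2 H - 2 is negative, so off the
  diagonal the kernel is bounded below by its value at distance T. This controls the cross terms of
  the perturbation estimate.\<close>

lemma wiener_norm_sq_L1:
  assumes H: "1 / 2 < H" "H < 1" and T: "0 < T" and [measurable]: "g \<in> borel_measurable borel"
  shows "ennreal (H * (2 * H - 1) * T powr (2 * H - 2)) * ((\<integral>\<^sup>+s\<in>{0..T}. ennreal \<bar>g s\<bar> \<partial>lborel) *
      (\<integral>\<^sup>+s\<in>{0..T}. ennreal \<bar>g s\<bar> \<partial>lborel)) \<le> wiener_norm_sq H T g"
proof -
  define e where "e s = ennreal \<bar>g s\<bar>" for s
  have [measurable]: "e \<in> borel_measurable borel"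
    unfolding e_def by measurable
  let ?\<kappa> = "ennreal (H * (2 * H - 1) * T powr (2 * H - 2))"
  let ?A = "\<integral>\<^sup>+s\<in>{0..T}. e s \<partial>lborel"
  have "?\<kappa> * (?A * ?A) = (\<integral>\<^sup>+s\<in>{0..T}. (\<integral>\<^sup>+t\<in>{0..T}. ?\<kappa> * (e s * e t) \<partial>lborel) \<partial>lborel)"
  proof -
    have "(\<integral>\<^sup>+t\<in>{0..T}. ?\<kappa> * (e s * e t) \<partial>lborel) = (?\<kappa> * e s) * ?A" for s
      by (subst nn_integral_cmult[symmetric]) (auto simp: mult_ac)
    moreover have "(\<integral>\<^sup>+s\<in>{0..T}. (?\<kappa> * e s) * ?A \<partial>lborel) = (?\<kappa> * ?A) * ?A"
      by (subst nn_integral_cmult[symmetric]) (auto intro!: nn_integral_cong simp: mult_ac)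
    ultimately show ?thesis by (simp add: mult_ac)
  qed
  also have "\<dots> \<le> wiener_norm_sq H T g"
    unfolding wiener_norm_sq_kernel[OF H(1)] e_def[symmetric]
  proof (intro nn_integral_mono)
    fix s
    show "(\<integral>\<^sup>+t\<in>{0..T}. ?\<kappa> * (e s * e t) \<partial>lborel) * indicator {0..T} s
      \<le> (\<integral>\<^sup>+t\<in>{0..T}. ennreal (wiener_kernel H s t) * (e s * e t) \<partial>lborel) * indicator {0..T} s"
    proof (cases "s \<in> {0..T}")
      case True
      have "(\<integral>\<^sup>+t\<in>{0..T}. ?\<kappa> * (e s * e t) \<partial>lborel)
        \<le> (\<integral>\<^sup>+t\<in>{0..T}. ennreal (wiener_kernel H s t) * (e s * e t) \<partial>lborel)"
      proof (intro nn_integral_mono_AE, use AE_lborel_singleton[of s] in eventually_elim)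
        \<comment> \<open>The diagonal has to be excluded: \<open>0 powr (2 * H - 2)\<close> is 0,
          which lies below the lower bound.\<close>
        fix t assume "t \<noteq> s"
        have "?\<kappa> \<le> ennreal (wiener_kernel H s t)" if "t \<in> {0..T}"
          unfolding wiener_kernel_def using H True that \<open>t \<noteq> s\<close>
          by (intro ennreal_leI mult_left_mono powr_mono2') auto
        then show "?\<kappa> * (e s * e t) * indicator {0..T} t
          \<le> ennreal (wiener_kernel H s t) * (e s * e t) * indicator {0..T} t"
          by (auto simp: indicator_def intro: mult_right_mono)
      qed
      then show ?thesis by (simp add: mult_right_mono)
    qed simp
  qed
  finally show ?thesis unfolding e_def .
qed


text \<open>Approximants of a function bounded by K asymptotically have at most the norm of the
  constant K, whatever their own coefficients are.\<close>

lemma wiener_norm_sq_limit: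
  fixes f :: "real \<Rightarrow> real"
  assumes H: "1 / 2 < H" "H < 1" and T: "0 < T" and K: "\<And>s. \<bar>f s\<bar> \<le> K"
    and f [measurable]: "f \<in> borel_measurable borel"
    and g [measurable]: "\<And>k. g k \<in> borel_measurable borel"
    and lim: "(\<lambda>k. wiener_norm_sq H T (\<lambda>s. f s - g k s)) \<longlonglongrightarrow> 0"
    and \<delta>: "0 < \<delta>"
  shows "eventually (\<lambda>k. wiener_norm_sq H T (g k) < ennreal (K\<^sup>2 * T powr (2 * H) + \<delta>)) sequentially"
proof -
  define N where "N k = wiener_norm_sq H T (\<lambda>s. f s - g k s)" for k
  define A where "A k = (\<integral>\<^sup>+s\<in>{0..T}. ennreal \<bar>f s - g k s\<bar> \<partial>lborel)" for k
  define \<kappa> where "\<kappa> = H * (2 * H - 1) * T powr (2 * H - 2)"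
  define c where "c = K * (2 * H * T powr (2 * H - 1))"
  have \<kappa>: "0 < \<kappa>" using H T by (simp add: \<kappa>_def)
  have "0 \<le> K" using K[of 0] by simp
  then have c: "0 \<le> c" using H by (simp add: c_def)
  \<comment> \<open>Makes the limiting cross term \<open>2 * (c * \<eta>)\<close> smaller than
    \<delta>; the summand 1 covers the case c = 0.\<close>
  define \<eta> where "\<eta> = \<delta> / (2 * (2 * c + 1))"
  have \<eta>: "0 < \<eta>" using \<delta> c by (simp add: \<eta>_def)
  \<comment> \<open>Either \<open>A k\<close> is at most \<eta>, or it is at most
    \<open>A k * A k / \<eta>\<close>, which \<open>wiener_norm_sq_L1\<close> bounds by the norm.
    This linear bound replaces the square root of the norm, which would be awkward in
    \<open>ennreal\<close>.\<close>
  have A: "A k \<le> ennreal \<eta> + ennreal (1 / (\<eta> * \<kappa>)) * N k" for k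
  proof (cases "A k \<le> ennreal \<eta>")
    case False
    have "A k = ennreal (1 / \<eta>) * (ennreal \<eta> * A k)"
      using \<eta> by (simp add: mult.assoc[symmetric] ennreal_mult[symmetric])
    also have "\<dots> \<le> ennreal (1 / \<eta>) * (A k * A k)"
      using False by (intro mult_left_mono mult_right_mono) auto
    also have "\<dots> = ennreal (1 / (\<eta> * \<kappa>)) * (ennreal \<kappa> * (A k * A k))"
    proof -
      have "ennreal (1 / (\<eta> * \<kappa>)) * ennreal \<kappa> = ennreal (1 / \<eta>)"
        using \<eta> \<kappa> by (simp add: ennreal_mult[symmetric])
      then show ?thesis by (simp add: mult.assoc[symmetric])
    qed
    also have "\<dots> \<le> ennreal (1 / (\<eta> * \<kappa>)) * N k"
      unfolding \<kappa>_def A_def N_def by (intro mult_left_mono wiener_norm_sq_L1 H T) auto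
    finally show ?thesis
      by (rule order_trans) simp
  qed (simp add: add_increasing2)
  let ?R = "\<lambda>k. ennreal (K\<^sup>2 * T powr (2 * H)) + N k
      + 2 * (ennreal c * (ennreal \<eta> + ennreal (1 / (\<eta> * \<kappa>)) * N k))"
  have "N \<longlonglongrightarrow> 0" using lim unfolding N_def .
  then have R: "?R \<longlonglongrightarrow> ennreal (K\<^sup>2 * T powr (2 * H)) + 0
      + 2 * (ennreal c * (ennreal \<eta> + ennreal (1 / (\<eta> * \<kappa>)) * 0))"
    by (intro tendsto_add tendsto_const ennreal_tendsto_cmult) auto
  have R_eq: "ennreal (K\<^sup>2 * T powr (2 * H)) + 0
      + 2 * (ennreal c * (ennreal \<eta> + ennreal (1 / (\<eta> * \<kappa>)) * 0)) = ennreal (K\<^sup>2 * T powr (2 * H) + 2 * (c * \<eta>))"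
    using c \<eta> by (simp add: ennreal_mult ennreal_plus[symmetric] del: ennreal_plus) (simp add: ennreal_mult[symmetric] ennreal_plus[symmetric] numeral_mult_ennreal del: ennreal_plus)
  have "2 * (c * \<eta>) < \<delta>"
  proof -
    have "\<eta> * (2 * (2 * c + 1)) = \<delta>" using c by (simp add: \<eta>_def)
    then have "\<delta> = 4 * (c * \<eta>) + 2 * \<eta>" by (simp add: algebra_simps)
    moreover have "0 \<le> c * \<eta>" using c \<eta> by simp
    ultimately show ?thesis using \<eta> by linarith
  qed
  then have R_less: "ennreal (K\<^sup>2 * T powr (2 * H) + 2 * (c * \<eta>)) < ennreal (K\<^sup>2 * T powr (2 * H) + \<delta>)"
    by (intro ennreal_lessI add_nonneg_pos \<delta>) auto
  have "eventually (\<lambda>k. ?R k < ennreal (K\<^sup>2 * T powr (2 * H) + \<delta>)) sequentially"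
    by (rule order_tendstoD(2)[OF R R_less[folded R_eq]])
  then show ?thesis
  proof eventually_elim
    case (elim k)
    have "wiener_norm_sq H T (g k) \<le> ennreal (K\<^sup>2 * T powr (2 * H)) + N k + 2 * (ennreal c * A k)"
      unfolding N_def A_def c_def by (rule wiener_norm_sq_perturb[OF H less_imp_le[OF T] K f g])
    also have "\<dots> \<le> ?R k"
      by (rule add_left_mono, rule mult_left_mono, rule mult_left_mono[OF A]) simp_all
    finally show ?case using elim by (rule le_less_trans)
  qed
qed

section \<open>Tails of Wiener integrals\<close>

context fbm
begin

text \<open>If |J| \<ge> 2x, then an approximating step integral has modulus at least x or differs
  from J by at least x; this is the source of the factor 2. The first event has a Gaussian tail with
  variance at most v + \<delta>, the second has probability at most \<delta> by Chebyshev, and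
  \<delta> tends to 0.\<close>

lemma wiener_integral_tail:
  assumes T: "0 < T" and K: "\<And>s. \<bar>f s\<bar> \<le> K" and f [measurable]: "f \<in> borel_measurable borel"
    and J: "is_wiener_integral M H B T f J" and x: "0 < x"
  shows "prob {\<omega>\<in>space M. 2 * x \<le> \<bar>J \<omega>\<bar>} \<le> gaussian_moment m * (K\<^sup>2 * T powr (2 * H)) ^ m / x ^ (2 * m)"
proof -
  obtain n u c where [measurable]: "J \<in> borel_measurable M"
    and u: "\<And>k. 0 \<le> u k 0" "\<And>k j. j < n k \<Longrightarrow> u k j \<le> u k (Suc j)" "\<And>k. u k (n k) \<le> T"
    and lim: "(\<lambda>k. wiener_norm_sq H T (\<lambda>s. f s - step_fun (n k) (u k) (c k) s)) \<longlonglongrightarrow> 0"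
    and L2: "(\<lambda>k. \<integral>\<^sup>+\<omega>. ennreal ((J \<omega> - step_integral B (n k) (u k) (c k) \<omega>)\<^sup>2) \<partial>M) \<longlonglongrightarrow> 0"
    using J unfolding is_wiener_integral_def by blast
  define Y where "Y k = step_integral B (n k) (u k) (c k)" for k
  define v where "v = K\<^sup>2 * T powr (2 * H)"
  have u0: "0 \<le> u k j" if "j \<le> n k" for k j
    using partition_mono[of "n k" "u k" 0 j] u(1)[of k] u(2)[of _ k] that by auto
  have gauss: "gaussian_rv M (Y k)" and mean: "expectation (Y k) = 0" for k
    unfolding Y_def step_integral_def[abs_def]
    by (intro gaussian_increments mean_increments; use u0 in auto)+
  have [measurable]: "Y k \<in> borel_measurable M" for k
    using gauss[of k] by (simp add: gaussian_rv_def)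
  have var: "eventually (\<lambda>k. expectation (\<lambda>\<omega>. (Y k \<omega>)\<^sup>2) \<le> v + \<delta>) sequentially" if "0 < \<delta>" for \<delta>
    using wiener_norm_sq_limit[OF H_gt H_less T K f step_fun_measurable lim that]
  proof eventually_elim
    case (elim k)
    have "ennreal (expectation (\<lambda>\<omega>. (Y k \<omega>)\<^sup>2)) < ennreal (v + \<delta>)"
      using step_integral_variance[of "u k" "n k" T "c k"] u elim unfolding Y_def v_def by (meson le_less_trans)
    then show ?case
      by (simp add: ennreal_less_iff)
  qed
  have bound: "prob {\<omega>\<in>space M. 2 * x \<le> \<bar>J \<omega>\<bar>} \<le> gaussian_moment m * (v + \<delta>) ^ m / x ^ (2 * m) + \<delta>"
    if \<delta>: "0 < \<delta>" for \<delta>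
  proof -
    \<comment> \<open>The threshold is chosen so that Chebyshev's inequality at level x returns
      exactly \<delta>.\<close>
    have "eventually (\<lambda>k. (\<integral>\<^sup>+\<omega>. ennreal ((J \<omega> - Y k \<omega>)\<^sup>2) \<partial>M) < ennreal (\<delta> * x\<^sup>2)) sequentially"
      using L2 \<delta> x unfolding Y_def by (intro order_tendstoD) auto
    with var[OF \<delta>] have "eventually (\<lambda>k. expectation (\<lambda>\<omega>. (Y k \<omega>)\<^sup>2) \<le> v + \<delta> \<and>
        (\<integral>\<^sup>+\<omega>. ennreal ((J \<omega> - Y k \<omega>)\<^sup>2) \<partial>M) < ennreal (\<delta> * x\<^sup>2)) sequentially"
      by (rule eventually_conj)
    then obtain k where k: "expectation (\<lambda>\<omega>. (Y k \<omega>)\<^sup>2) \<le> v + \<delta>"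
        "(\<integral>\<^sup>+\<omega>. ennreal ((J \<omega> - Y k \<omega>)\<^sup>2) \<partial>M) < ennreal (\<delta> * x\<^sup>2)"
      using eventually_happens'[OF sequentially_bot] by blast
    have "prob {\<omega>\<in>space M. x \<le> \<bar>Y k \<omega>\<bar>}
        \<le> gaussian_moment m * expectation (\<lambda>\<omega>. (Y k \<omega>)\<^sup>2) ^ m / x ^ (2 * m)"
      by (rule centred_gaussian_tail[OF gauss mean x])
    also have "\<dots> \<le> gaussian_moment m * (v + \<delta>) ^ m / x ^ (2 * m)"
      using k(1) x gaussian_moment_pos[of m]
      by (intro divide_right_mono mult_left_mono power_mono) auto
    finally have 1: "prob {\<omega>\<in>space M. x \<le> \<bar>Y k \<omega>\<bar>} \<le> gaussian_moment m * (v + \<delta>) ^ m / x ^ (2 * m)" .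
    have "emeasure M {\<omega>\<in>space M. x \<le> \<bar>J \<omega> - Y k \<omega>\<bar>}
        \<le> emeasure M {\<omega>\<in>space M. 1 \<le> ennreal (1 / x\<^sup>2) * ennreal ((J \<omega> - Y k \<omega>)\<^sup>2)}"
    proof (rule emeasure_mono)
      have "1 \<le> ennreal (1 / x\<^sup>2) * ennreal (y\<^sup>2)" if "x \<le> \<bar>y\<bar>" for y
      proof -
        have "x\<^sup>2 \<le> y\<^sup>2" using power_mono[OF that, of 2] x by simp
        then show ?thesis using x by (simp add: ennreal_mult[symmetric])
      qed
      then show "{\<omega>\<in>space M. x \<le> \<bar>J \<omega> - Y k \<omega>\<bar>}
        \<subseteq> {\<omega>\<in>space M. 1 \<le> ennreal (1 / x\<^sup>2) * ennreal ((J \<omega> - Y k \<omega>)\<^sup>2)}" by auto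
    qed measurable
    also have "\<dots> \<le> ennreal (1 / x\<^sup>2) * (\<integral>\<^sup>+\<omega>\<in>space M. ennreal ((J \<omega> - Y k \<omega>)\<^sup>2) \<partial>M)"
      by (rule nn_integral_Markov_inequality) auto
    also have "(\<integral>\<^sup>+\<omega>\<in>space M. ennreal ((J \<omega> - Y k \<omega>)\<^sup>2) \<partial>M) = (\<integral>\<^sup>+\<omega>. ennreal ((J \<omega> - Y k \<omega>)\<^sup>2) \<partial>M)"
      by (intro nn_integral_cong) simp
    also have "ennreal (1 / x\<^sup>2) * \<dots> \<le> ennreal (1 / x\<^sup>2) * ennreal (\<delta> * x\<^sup>2)"
      using k(2) by (intro mult_left_mono) auto
    also have "\<dots> = ennreal \<delta>"
      using x \<delta> by (simp add: ennreal_mult[symmetric])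
    finally have 2: "prob {\<omega>\<in>space M. x \<le> \<bar>J \<omega> - Y k \<omega>\<bar>} \<le> \<delta>"
      using \<delta> by (simp add: emeasure_eq_measure)
    have "prob {\<omega>\<in>space M. 2 * x \<le> \<bar>J \<omega>\<bar>}
        \<le> prob ({\<omega>\<in>space M. x \<le> \<bar>Y k \<omega>\<bar>} \<union> {\<omega>\<in>space M. x \<le> \<bar>J \<omega> - Y k \<omega>\<bar>})"
      by (intro finite_measure_mono) auto
    also have "\<dots> \<le> prob {\<omega>\<in>space M. x \<le> \<bar>Y k \<omega>\<bar>} + prob {\<omega>\<in>space M. x \<le> \<bar>J \<omega> - Y k \<omega>\<bar>}"
      by (intro measure_Un_le) auto
    finally show ?thesis using 1 2 by simp
  qed
  have "((\<lambda>\<delta>. gaussian_moment m * (v + \<delta>) ^ m / x ^ (2 * m) + \<delta>) \<longlongrightarrow>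
      gaussian_moment m * (v + 0) ^ m / x ^ (2 * m) + 0) (at_right 0)"
    using x by (intro tendsto_intros) auto
  then have "prob {\<omega>\<in>space M. 2 * x \<le> \<bar>J \<omega>\<bar>} \<le> gaussian_moment m * (v + 0) ^ m / x ^ (2 * m) + 0"
    by (rule tendsto_lowerbound) (auto simp: eventually_at_right_less bound intro!: eventually_at_rightI[of 0 1])
  then show ?thesis by (simp add: v_def)
qed

end

subsection \<open>Almost sure growth and dyadic increments\<close>

text \<open>At x = n^\<gamma> the tail is a constant times n^(2m(H - \<gamma>)). The choice of m
  with m(\<gamma> - H) \<ge> 1 makes this O(n^(-2)), so Borel-Cantelli applies.\<close>

lemma (in prob_space) AE_powr_growth:
  fixes Y :: "nat \<Rightarrow> 'a \<Rightarrow> real"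
  assumes [measurable]: "\<And>n. Y n \<in> borel_measurable M"
    and tail: "\<And>n m x. 1 \<le> n \<Longrightarrow> 0 < x \<Longrightarrow>
      prob {\<omega>\<in>space M. 2 * x \<le> \<bar>Y n \<omega>\<bar>} \<le> gaussian_moment m * (C * real n powr (2 * H)) ^ m / x ^ (2 * m)"
    and "0 \<le> C" "H < \<gamma>"
  shows "AE \<omega> in M. eventually (\<lambda>n. \<bar>Y n \<omega>\<bar> \<le> 2 * real n powr \<gamma>) sequentially"
proof -
  obtain m :: nat where m: "1 / (\<gamma> - H) \<le> real m"
    using real_arch_simple by blast
  define A where "A n = {\<omega>\<in>space M. 2 * real n powr \<gamma> \<le> \<bar>Y n \<omega>\<bar>}" for n
  have [measurable]: "A n \<in> sets M" for n
    unfolding A_def by measurable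
  have "summable (\<lambda>n. measure M (A n))"
  proof (rule summable_comparison_test')
    show "summable (\<lambda>n. gaussian_moment m * C ^ m * real n powr (- 2))"
      by (intro summable_mult) (simp add: summable_real_powr_iff)
    fix n :: nat assume n: "1 \<le> n"
    have "measure M (A n) \<le> gaussian_moment m * (C * real n powr (2 * H)) ^ m / (real n powr \<gamma>) ^ (2 * m)"
      unfolding A_def using n by (intro tail) auto
    also have "\<dots> = gaussian_moment m * C ^ m * real n powr (2 * H * m - \<gamma> * (2 * m))"
    proof -
      have "(real n powr (2 * H)) ^ m = real n powr (2 * H * m)"
        "(real n powr \<gamma>) ^ (2 * m) = real n powr (\<gamma> * (2 * m))"
        using n by (simp_all add: powr_realpow[symmetric] powr_powr)
      then show ?thesis
        by (simp add: power_mult_distrib powr_diff)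
    qed
    also have "\<dots> \<le> gaussian_moment m * C ^ m * real n powr (- 2)"
    proof (intro mult_left_mono powr_mono)
      have "1 \<le> real m * (\<gamma> - H)"
        using m assms(4) by (simp add: field_simps)
      then show "2 * H * m - \<gamma> * (2 * m) \<le> - 2"
        by (simp add: algebra_simps)
    qed (use n assms(3) gaussian_moment_pos[of m] in auto)
    finally show "norm (measure M (A n)) \<le> gaussian_moment m * C ^ m * real n powr (- 2)"
      by simp
  qed
  then have "AE \<omega> in M. eventually (\<lambda>n. \<omega> \<in> space M - A n) sequentially"
    by (intro borel_cantelli_AE1) (auto simp: emeasure_eq_measure)
  then show ?thesis
  proof eventually_elim
    case (elim \<omega>)
    then show ?case by eventually_elim (auto simp: A_def)
  qed
qed

context fbm
begin

lemma AE_wiener_integral_growth: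
  assumes K: "\<And>s. \<bar>f s\<bar> \<le> K" and f: "f \<in> borel_measurable borel"
    and J: "\<And>n. is_wiener_integral M H B (real n) f (W n)" and \<gamma>: "H < \<gamma>"
  shows "AE \<omega> in M. eventually (\<lambda>n. \<bar>W n \<omega>\<bar> \<le> 2 * real n powr \<gamma>) sequentially"
proof (rule AE_powr_growth[OF _ _ _ \<gamma>, where C="K\<^sup>2"])
  show "W n \<in> borel_measurable M" for n
    using J[of n] by (simp add: is_wiener_integral_def)
  show "prob {\<omega>\<in>space M. 2 * x \<le> \<bar>W n \<omega>\<bar>} \<le> gaussian_moment m * (K\<^sup>2 * real n powr (2 * H)) ^ m / x ^ (2 * m)"
    if "1 \<le> n" "0 < x" for n m x
    by (rule wiener_integral_tail[OF _ K f J]) (use that in auto)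
qed auto

lemma AE_B_nat_growth:
  assumes \<gamma>: "H < \<gamma>"
  shows "AE \<omega> in M. eventually (\<lambda>n. \<bar>B (real n) \<omega>\<bar> \<le> 2 * real n powr \<gamma>) sequentially"
proof (rule AE_powr_growth[OF _ _ _ \<gamma>, where C=1])
  show "prob {\<omega>\<in>space M. 2 * x \<le> \<bar>B (real n) \<omega>\<bar>} \<le> gaussian_moment m * (1 * real n powr (2 * H)) ^ m / x ^ (2 * m)"
    if "1 \<le> n" "0 < x" for n m x
  proof -
    have "prob {\<omega>\<in>space M. 2 * x \<le> \<bar>B (real n) \<omega>\<bar>} \<le> prob {\<omega>\<in>space M. x \<le> \<bar>B (real n) \<omega>\<bar>}"
      using that by (intro finite_measure_mono) auto
    also have "\<dots> \<le> gaussian_moment m * expectation (\<lambda>\<omega>. (B (real n) \<omega>)\<^sup>2) ^ m / x ^ (2 * m)"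
      using that by (intro centred_gaussian_tail gaussian_B B_mean) auto
    also have "expectation (\<lambda>\<omega>. (B (real n) \<omega>)\<^sup>2) = real n powr (2 * H)"
      using B_cov[of "real n" "real n"] H_gt by (simp add: power2_eq_square fbm_cov_def)
    finally show ?thesis by simp
  qed
qed auto

text \<open>A single increment of level k exceeds 2^(-\<beta>k) with probability at most a constant
  times 2^(-2mk(H - \<beta>)). The choice of m with 2m(H - \<beta>) \<ge> 3 turns this into 8^(-k),
  which after summation over the 4^k increments leaves the summable 2^(-k).\<close>

lemma AE_dyadic_increments:
  assumes \<beta>: "\<beta> < H"
  shows "AE \<omega> in M. eventually (\<lambda>k. \<forall>j<4 ^ k.
    \<bar>B (real (Suc j) / 2 ^ k) \<omega> - B (real j / 2 ^ k) \<omega>\<bar> \<le> (2 powr - \<beta>) ^ k) sequentially"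
proof -
  obtain m :: nat where m: "3 / (2 * (H - \<beta>)) \<le> real m"
    using real_arch_simple by blast
  define D where "D k j = {\<omega>\<in>space M. (2 powr - \<beta>) ^ k \<le> \<bar>B (real (Suc j) / 2 ^ k) \<omega> - B (real j / 2 ^ k) \<omega>\<bar>}" for k j
  define A where "A k = (\<Union>j\<in>{..<4 ^ k}. D k j)" for k
  have [measurable]: "D k j \<in> sets M" for k j
    unfolding D_def by measurable
  have [measurable]: "A k \<in> sets M" for k
    unfolding A_def by measurable
  have D: "prob (D k j) \<le> gaussian_moment m * (1 / 8) ^ k" for k j
  proof -
    have eq: "real (Suc j) / 2 ^ k - real j / 2 ^ k = 1 / 2 ^ k"
      by (simp add: field_simps)
    have "prob (D k j) \<le> gaussian_moment m * ((1 / 2 ^ k) powr (2 * H)) ^ m / ((2 powr - \<beta>) ^ k) ^ (2 * m)"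
      unfolding D_def
      using centred_gaussian_tail[OF gaussian_increment(1,2)[of "real (Suc j) / 2 ^ k" "real j / 2 ^ k"],
          of "(2 powr - \<beta>) ^ k" m, unfolded gaussian_increment(3)[of "real (Suc j) / 2 ^ k" "real j / 2 ^ k"]]
      by (simp add: gaussian_increment(3) eq del: of_nat_Suc)
    also have "\<dots> = gaussian_moment m * 2 powr (- real k * (2 * real m * (H - \<beta>)))"
    proof -
      have "(1 / 2 ^ k :: real) = 2 powr (- real k)"
        by (simp add: powr_minus powr_realpow divide_inverse)
      then have "((1 / 2 ^ k :: real) powr (2 * H)) ^ m = 2 powr (- real k * (2 * H) * m)"
        by (simp add: powr_powr powr_realpow[symmetric] powr_gt_zero)
      moreover have "((2 powr - \<beta> :: real) ^ k) ^ (2 * m) = 2 powr (- \<beta> * k * (2 * m))"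
        by (simp add: powr_powr powr_realpow[symmetric])
      ultimately show ?thesis
        by (simp add: times_divide_eq_right[symmetric] powr_diff[symmetric] algebra_simps
            del: times_divide_eq_right)
    qed
    also have "\<dots> \<le> gaussian_moment m * 2 powr (- real k * 3)"
    proof -
      have "3 \<le> 2 * real m * (H - \<beta>)"
        using m \<beta> by (simp add: field_simps)
      then have "- real k * (2 * real m * (H - \<beta>)) \<le> - real k * 3"
        by (intro mult_left_mono_neg) auto
      then have "2 powr (- real k * (2 * real m * (H - \<beta>))) \<le> (2 powr (- real k * 3) :: real)"
        by (rule powr_mono) simp
      then show ?thesis
        using gaussian_moment_pos[of m] by (intro mult_left_mono) auto
    qed
    also have "2 powr (- real k * 3) = (1 / 8 :: real) ^ k"
    proof -
      have "2 powr (- real k * 3) = (2 powr (- 3)) powr real k"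
        by (simp add: powr_powr mult.commute)
      also have "(2 :: real) powr (- 3) = 1 / 8"
        by (simp add: powr_minus)
      finally show ?thesis by (simp add: powr_realpow)
    qed
    finally show ?thesis .
  qed
  have "summable (\<lambda>k. measure M (A k))"
  proof (rule summable_comparison_test')
    show "summable (\<lambda>k. gaussian_moment m * (1 / 2) ^ k)"
      by (intro summable_mult summable_geometric) simp
    fix k :: nat
    have "measure M (A k) \<le> (\<Sum>j<4 ^ k. prob (D k j))"
      unfolding A_def by (intro finite_measure_subadditive_finite) auto
    also have "\<dots> \<le> (\<Sum>j<(4::nat) ^ k. gaussian_moment m * (1 / 8) ^ k)"
      by (intro sum_mono D)
    also have "\<dots> = gaussian_moment m * (1 / 2) ^ k"
      by (simp add: power_mult_distrib[symmetric])
    finally show "norm (measure M (A k)) \<le> gaussian_moment m * (1 / 2) ^ k"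
      by simp
  qed
  then have "AE \<omega> in M. eventually (\<lambda>n. \<omega> \<in> space M - A n) sequentially"
    by (intro borel_cantelli_AE1) (auto simp: emeasure_eq_measure)
  then show ?thesis
  proof eventually_elim
    case (elim \<omega>)
    then show ?case by eventually_elim (auto simp: A_def D_def not_le intro: less_imp_le)
  qed
qed

end

text \<open>The range \<open>j < 4\<^sup>k\<close> covers \<open>[0, 2\<^sup>k]\<close>, so one condition controls both the local regularity
  of \<open>b\<close> on every bounded interval and its growth at infinity.\<close>

definition dyadic_bound :: "(real \<Rightarrow> real) \<Rightarrow> real \<Rightarrow> nat \<Rightarrow> bool" where
  "dyadic_bound b r k0 \<longleftrightarrow> (\<forall>k\<ge>k0. \<forall>j<4 ^ k. \<bar>b (real (Suc j) / 2 ^ k) - b (real j / 2 ^ k)\<bar> \<le> r ^ k)"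

section \<open>From dyadic increments to Hoelder continuity and growth\<close>

lemma dyadic_floor_Suc:
  fixes t :: real
  assumes "0 \<le> t"
  shows "nat \<lfloor>t * 2 ^ Suc n\<rfloor> = 2 * nat \<lfloor>t * 2 ^ n\<rfloor> \<or> nat \<lfloor>t * 2 ^ Suc n\<rfloor> = Suc (2 * nat \<lfloor>t * 2 ^ n\<rfloor>)"
proof -
  have "2 * \<lfloor>t * 2 ^ n\<rfloor> \<le> \<lfloor>t * 2 ^ Suc n\<rfloor>" "\<lfloor>t * 2 ^ Suc n\<rfloor> \<le> 2 * \<lfloor>t * 2 ^ n\<rfloor> + 1"
    by (auto simp: le_floor_iff floor_le_iff) linarith+
  moreover have "0 \<le> \<lfloor>t * 2 ^ n\<rfloor>" using assms by simp
  ultimately show ?thesis by linarith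
qed

text \<open>The binary truncations of t increase to t, and each new digit moves the point by nothing
  or by one increment of the next level. The moves are summed as a geometric series, and continuity
  of b passes to t.\<close>

lemma dyadic_approximation:
  assumes b: "continuous_on {0..} b" "dyadic_bound b r k0" and r: "0 < r" "r < 1"
    and k: "k0 \<le> k" and t: "0 \<le> t" "t < 2 ^ k"
  shows "\<bar>b t - b (real (nat \<lfloor>t * 2 ^ k\<rfloor>) / 2 ^ k)\<bar> \<le> r ^ k / (1 - r)"
proof -
  define J where "J n = nat \<lfloor>t * 2 ^ n\<rfloor>" for n
  define d where "d n = real (J n) / 2 ^ n" for n
  have J: "real (J n) \<le> t * 2 ^ n" "t * 2 ^ n < real (J n) + 1" for n
    using t by (simp_all add: J_def)
  have step: "\<bar>b (d (Suc n)) - b (d n)\<bar> \<le> r ^ Suc n" if n: "k \<le> n" for n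
  proof (cases "J (Suc n) = 2 * J n")
    case True
    then have "d (Suc n) = d n" by (simp add: d_def)
    then show ?thesis using r by simp
  next
    case False
    then have Suc: "J (Suc n) = Suc (2 * J n)"
      using dyadic_floor_Suc[OF t(1), of n] by (simp add: J_def)
    \<comment> \<open>Keeps the index inside the range of \<open>dyadic_bound\<close>: from t < 2^n
      follows J n < 4^n, hence 2 J n < 4^(n+1).\<close>
    have "t < 2 ^ n" using t(2) power_increasing[OF n, of "2::real"] by linarith
    then have "real (J n) < 2 ^ n * 2 ^ n"
      using J(1)[of n] by (intro order.strict_trans1[OF J(1)] mult_strict_right_mono) auto
    then have "real (J n) < real (4 ^ n)"
      by (simp add: power_mult_distrib[symmetric])
    then have "2 * J n < 4 ^ Suc n"
      unfolding of_nat_less_iff by simp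
    then have "\<bar>b (real (Suc (2 * J n)) / 2 ^ Suc n) - b (real (2 * J n) / 2 ^ Suc n)\<bar> \<le> r ^ Suc n"
      by (intro b(2)[unfolded dyadic_bound_def, rule_format]) (use n k in auto)
    moreover have "real (2 * J n) / 2 ^ Suc n = d n" by (simp add: d_def)
    ultimately show ?thesis by (simp add: d_def Suc del: power_Suc)
  qed
  have chain: "\<bar>b (d (k + i)) - b (d k)\<bar> \<le> r ^ k * (1 - r ^ i) / (1 - r)" for i
  proof (induction i)
    case (Suc i)
    have "\<bar>b (d (Suc (k + i))) - b (d (k + i))\<bar> \<le> r ^ (k + i)"
      using r by (intro order_trans[OF step power_decreasing]) auto
    also have "\<dots> = (r ^ k * (1 - r ^ Suc i) / (1 - r)) - (r ^ k * (1 - r ^ i) / (1 - r))"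
    proof -
      have "r ^ k * (1 - r ^ Suc i) - r ^ k * (1 - r ^ i) = r ^ (k + i) * (1 - r)"
        by (simp add: algebra_simps power_add)
      then show ?thesis
        using r by (simp add: diff_divide_distrib[symmetric])
    qed
    finally show ?case using Suc by simp
  qed simp
  have "(\<lambda>n. d n) \<longlonglongrightarrow> t"
  proof (rule tendsto_sandwich[of "\<lambda>n. t - 1 / 2 ^ n" _ _ "\<lambda>n. t"])
    have "t - 1 / 2 ^ n \<le> d n" for n
    proof -
      have "(t * 2 ^ n - 1) / 2 ^ n \<le> d n"
        unfolding d_def using J(2)[of n] by (intro divide_right_mono) auto
      then show ?thesis by (simp add: diff_divide_distrib)
    qed
    moreover have "d n \<le> t" for n
      using J(1)[of n] by (simp add: d_def divide_le_eq)
    ultimately show "eventually (\<lambda>n. t - 1 / 2 ^ n \<le> d n) sequentially" "eventually (\<lambda>n. d n \<le> t) sequentially"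
      by auto
    have "(\<lambda>n. t - 1 / 2 ^ n) \<longlonglongrightarrow> t - 0"
      by (intro tendsto_diff tendsto_const LIMSEQ_divide_realpow_zero) auto
    then show "(\<lambda>n. t - 1 / 2 ^ n) \<longlonglongrightarrow> t" by simp
  qed auto
  then have "(\<lambda>i. d (k + i)) \<longlonglongrightarrow> t"
    using LIMSEQ_ignore_initial_segment[of d t k] by (simp add: add.commute)
  then have "(\<lambda>i. b (d (k + i))) \<longlonglongrightarrow> b t"
    by (rule continuous_on_tendsto_compose[OF b(1)]) (use t in \<open>auto simp: d_def\<close>)
  then have "(\<lambda>i. \<bar>b (d (k + i)) - b (d k)\<bar>) \<longlonglongrightarrow> \<bar>b t - b (d k)\<bar>"
    by (intro tendsto_intros)
  then have "\<bar>b t - b (d k)\<bar> \<le> r ^ k / (1 - r)"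
  proof (rule LIMSEQ_le_const2)
    have "r ^ k * (1 - r ^ i) / (1 - r) \<le> r ^ k / (1 - r)" for i
      using r by (intro divide_right_mono) (auto simp: mult_left_le)
    then show "\<exists>N. \<forall>i\<ge>N. \<bar>b (d (k + i)) - b (d k)\<bar> \<le> r ^ k / (1 - r)"
      using chain order_trans by blast
  qed
  then show ?thesis by (simp add: d_def J_def)
qed

text \<open>Points at distance at most 2^(-k) have equal or adjacent truncations at level k, so two
  approximation errors and at most one increment separate their values.\<close>

lemma dyadic_close:
  assumes b: "continuous_on {0..} b" "dyadic_bound b r k0" and r: "0 < r" "r < 1"
    and k: "k0 \<le> k" and st: "0 \<le> s" "s \<le> t" "t < 2 ^ k" "t - s \<le> 1 / 2 ^ k"
  shows "\<bar>b t - b s\<bar> \<le> (2 / (1 - r) + 1) * r ^ k"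
proof -
  define i where "i = nat \<lfloor>s * 2 ^ k\<rfloor>"
  define j where "j = nat \<lfloor>t * 2 ^ k\<rfloor>"
  have ij: "i \<le> j" "j \<le> Suc i"
  proof -
    have "t * 2 ^ k \<le> s * 2 ^ k + 1" using st(4) by (simp add: field_simps)
    then have "\<lfloor>t * 2 ^ k\<rfloor> \<le> \<lfloor>s * 2 ^ k\<rfloor> + 1" by linarith
    then show "j \<le> Suc i" unfolding i_def j_def by linarith
    show "i \<le> j" unfolding i_def j_def using st by (intro nat_mono floor_mono mult_right_mono) auto
  qed
  have "real j < 4 ^ k"
  proof -
    have "real j \<le> t * 2 ^ k" using st by (simp add: j_def)
    also have "\<dots> < 2 ^ k * 2 ^ k" using st by simp
    finally show ?thesis by (simp add: power_mult_distrib[symmetric])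
  qed
  then have "real i < real (4 ^ k)" using ij by simp
  then have "i < 4 ^ k" by (simp only: of_nat_less_iff)
  then have "\<bar>b (real (Suc i) / 2 ^ k) - b (real i / 2 ^ k)\<bar> \<le> r ^ k"
    using b(2) k by (auto simp: dyadic_bound_def)
  then have "\<bar>b (real j / 2 ^ k) - b (real i / 2 ^ k)\<bar> \<le> r ^ k"
    using ij r by (cases "j = i") (auto simp: le_Suc_eq)
  moreover have "\<bar>b t - b (real j / 2 ^ k)\<bar> \<le> r ^ k / (1 - r)" "\<bar>b s - b (real i / 2 ^ k)\<bar> \<le> r ^ k / (1 - r)"
    unfolding i_def j_def using st by (intro dyadic_approximation[OF b r k]; simp)+
  ultimately have "\<bar>b t - b s\<bar> \<le> r ^ k / (1 - r) + r ^ k / (1 - r) + r ^ k" by linarith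
  also have "\<dots> = (2 / (1 - r) + 1) * r ^ k" by (simp add: distrib_right)
  finally show ?thesis .
qed

text \<open>The level k is chosen with 2^(-k-1) < t - s \<le> 2^(-k), so that the geometric bound of
  level k is (2^(-k))^\<beta> \<le> (2(t - s))^\<beta>. The radius 2^(-K) forces k \<ge> K, which
  puts k beyond k0 and T below 2^k.\<close>

lemma dyadic_local_hoelder:
  assumes b: "continuous_on {0..} b" "dyadic_bound b (2 powr - \<beta>) k0" and \<beta>: "0 < \<beta>" "\<beta> < 1"
  obtains C \<delta> where "0 < \<delta>" "0 \<le> C"
    "\<And>s t. 0 \<le> s \<Longrightarrow> s \<le> t \<Longrightarrow> t \<le> T \<Longrightarrow> t - s \<le> \<delta> \<Longrightarrow> \<bar>b t - b s\<bar> \<le> C * (t - s) powr \<beta>"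
proof -
  let ?r = "2 powr - \<beta> :: real"
  have r: "0 < ?r" "?r < 1" using \<beta> powr_less_mono[of "- \<beta>" 0 "2::real"] by simp_all
  obtain K1 :: nat where "T < 2 ^ K1" using real_arch_pow[of 2 T] by auto
  define K where "K = max k0 K1"
  have K: "k0 \<le> K" "T < 2 ^ K"
    using \<open>T < 2 ^ K1\<close> less_le_trans[OF _ power_increasing[of K1 K "2::real"]] by (auto simp: K_def)
  define C where "C = (2 / (1 - ?r) + 1) * 2 powr \<beta>"
  have C0: "0 \<le> 2 / (1 - ?r) + 1" using r by simp
  show thesis
  proof (rule that[of "1 / 2 ^ K" C])
    show "0 \<le> C" using C0 by (simp add: C_def)
    fix s t :: real assume st: "0 \<le> s" "s \<le> t" "t \<le> T" "t - s \<le> 1 / 2 ^ K"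
    show "\<bar>b t - b s\<bar> \<le> C * (t - s) powr \<beta>"
    proof (cases "s = t")
      case False
      then have "0 < t - s" using st by simp
      have "\<exists>k\<ge>K. t - s \<le> 1 / 2 ^ k \<and> 1 / 2 ^ Suc k < t - s"
      proof -
        define P where "P n \<longleftrightarrow> 1 / 2 ^ n < t - s" for n :: nat
        obtain n where "(1 / 2) ^ n < t - s"
          using real_arch_pow_inv[OF \<open>0 < t - s\<close>, of "1 / 2"] by auto
        then have "P n" by (simp add: P_def power_one_over)
        define n0 where "n0 = (LEAST n. P n)"
        have n0: "P n0" "\<And>n. n < n0 \<Longrightarrow> \<not> P n"
          unfolding n0_def by (rule LeastI, fact) (rule not_less_Least)
        have "K < n0"
        proof (rule ccontr)
          assume "\<not> K < n0"
          then have "(2::real) ^ n0 \<le> 2 ^ K" by (intro power_increasing) auto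
          then have "1 / 2 ^ K \<le> (1 / 2 ^ n0 :: real)" by (simp add: frac_le)
          then show False using n0(1) st(4) by (simp add: P_def)
        qed
        then obtain k where "n0 = Suc k" "K \<le> k" by (cases n0) auto
        with n0(1) n0(2)[of k] show ?thesis by (auto simp: P_def)
      qed
      then obtain k where k: "K \<le> k" "t - s \<le> 1 / 2 ^ k" "1 / 2 ^ Suc k < t - s" by blast
      have "T < 2 ^ k" using K(2) power_increasing[OF k(1), of "2::real"] by linarith
      then have "\<bar>b t - b s\<bar> \<le> (2 / (1 - ?r) + 1) * ?r ^ k"
        using st k K by (intro dyadic_close[OF b r]) auto
      also have "?r ^ k = (1 / 2 ^ k) powr \<beta>"
        by (simp add: powr_realpow[symmetric] powr_powr powr_divide powr_minus_divide mult.commute)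
      also have "(1 / 2 ^ k) powr \<beta> \<le> (2 * (t - s)) powr \<beta>"
        using k(3) \<beta> by (intro powr_mono2) (auto simp: field_simps)
      also have "\<dots> = 2 powr \<beta> * (t - s) powr \<beta>"
        by (rule powr_mult)
      finally show ?thesis
        using C0 by (simp add: C_def mult.assoc mult_left_mono)
    qed simp
  qed simp
qed


text \<open>Between the integer part of t and t there are at most 2^k steps of level k. Taking the
  least k with t + 1 < 2^k gives 2^k \<le> 2(t + 1), so the steps contribute at most 2^(k(1 -
  \<beta>)) = O((1 + t)^(1 - \<beta>)), which \<gamma> \<ge> 1 - \<beta> absorbs. The values at
  integers are bounded by assumption, and bounded times by compactness.\<close>

lemma dyadic_growth:
  assumes b: "continuous_on {0..} b" "dyadic_bound b (2 powr - \<beta>) k0" and \<beta>: "0 < \<beta>" "\<beta> < 1"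
    and \<gamma>: "1 - \<beta> \<le> \<gamma>"
    and nat_growth: "eventually (\<lambda>n. \<bar>b (real n)\<bar> \<le> 2 * real n powr \<gamma>) sequentially"
  shows "\<exists>C. 0 \<le> C \<and> (\<forall>t\<ge>0. \<bar>b t\<bar> \<le> C * (1 + t) powr \<gamma>)"
proof -
  let ?r = "2 powr - \<beta> :: real"
  have r: "0 < ?r" "?r < 1" using \<beta> powr_less_mono[of "- \<beta>" 0 "2::real"] by simp_all
  obtain n0 where n0: "\<And>n. n0 \<le> n \<Longrightarrow> \<bar>b (real n)\<bar> \<le> 2 * real n powr \<gamma>"
    using nat_growth by (auto simp: eventually_sequentially)
  \<comment> \<open>Beyond T the integer part of t is at least n0 and the level chosen for t is at
    least k0.\<close>
  define T where "T = max (real n0) (2 ^ k0)"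
  define c where "c = 1 / (1 - ?r)"
  have c: "0 \<le> c" using r by (simp add: c_def)
  have large: "\<bar>b t\<bar> \<le> (c + 4) * (1 + t) powr \<gamma>" if t: "T \<le> t" for t
  proof -
    have t0: "0 \<le> t" "2 ^ k0 \<le> t" "real n0 \<le> t"
      using t by (auto simp: T_def intro: order_trans[of _ "real n0"])
    define n where "n = nat \<lfloor>t\<rfloor>"
    have n: "real n \<le> t" "t < real n + 1" "n0 \<le> n"
      using t0 by (auto simp: n_def le_nat_floor)
    define P where "P k \<longleftrightarrow> t + 1 < 2 ^ k" for k :: nat
    obtain k1 where "P k1" using real_arch_pow[of 2 "t + 1"] by (auto simp: P_def)
    define k where "k = (LEAST k. P k)"
    have k: "P k" "\<And>i. i < k \<Longrightarrow> \<not> P i"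
      unfolding k_def by (rule LeastI, fact) (rule not_less_Least)
    have "k0 \<le> k"
    proof (rule ccontr)
      assume "\<not> k0 \<le> k"
      then have "(2::real) ^ k \<le> 2 ^ k0" by (intro power_increasing) auto
      then show False using k(1) t0(2) unfolding P_def by linarith
    qed
    have "k \<noteq> 0"
    proof
      assume "k = 0"
      then show False using k(1) t0(1) by (simp add: P_def)
    qed
    then have k_le: "2 ^ k \<le> 2 * (t + 1)"
      using k(2)[of "k - 1"] by (cases k) (auto simp: P_def)
    define J where "J = nat \<lfloor>t * 2 ^ k\<rfloor>"
    have J: "real J \<le> t * 2 ^ k" "n * 2 ^ k \<le> J"
      using t0 n by (auto simp: J_def le_nat_floor)
    have J4: "real (n * 2 ^ k + i) < 4 ^ k" if "n * 2 ^ k + i < J" for i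
    proof -
      have "real (n * 2 ^ k + i) < real J" using that by linarith
      also have "\<dots> \<le> t * 2 ^ k" by (rule J)
      also have "\<dots> \<le> 2 ^ k * 2 ^ k" using k(1) by (intro mult_right_mono) (auto simp: P_def)
      finally show ?thesis by (simp add: power_mult_distrib[symmetric])
    qed
    have chain: "\<bar>b (real (n * 2 ^ k + i) / 2 ^ k) - b (real n)\<bar> \<le> real i * ?r ^ k" if "n * 2 ^ k + i \<le> J" for i
      using that
    proof (induction i)
      case (Suc i)
      have "real (n * 2 ^ k + i) < real (4 ^ k)" using J4[of i] Suc.prems by simp
      then have "n * 2 ^ k + i < 4 ^ k" by (simp only: of_nat_less_iff)
      then have "\<bar>b (real (Suc (n * 2 ^ k + i)) / 2 ^ k) - b (real (n * 2 ^ k + i) / 2 ^ k)\<bar> \<le> ?r ^ k"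
        using b(2) \<open>k0 \<le> k\<close> unfolding dyadic_bound_def by blast
      with Suc show ?case by (simp add: distrib_right)
    qed simp
    define i where "i = J - n * 2 ^ k"
    have iJ: "n * 2 ^ k + i = J" using J(2) by (simp add: i_def)
    have "real J \<le> (real n + 1) * 2 ^ k"
      using J(1) n(2) by (elim order_trans) (intro mult_right_mono; simp)
    then have "real i \<le> 2 ^ k"
      using J(2) by (simp add: i_def of_nat_diff algebra_simps)
    then have "real i * ?r ^ k \<le> (2 * ?r) ^ k"
      unfolding power_mult_distrib by (intro mult_right_mono) auto
    also have "(2 * ?r) ^ k = (2 ^ k) powr (1 - \<beta>)"
    proof -
      have "2 * ?r = 2 powr (1 - \<beta>)" by (simp add: powr_diff powr_minus divide_inverse)
      then show ?thesis by (simp add: powr_realpow[symmetric] powr_powr mult.commute)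
    qed
    also have "\<dots> \<le> (2 * (t + 1)) powr (1 - \<beta>)"
      using k_le \<beta> by (intro powr_mono2) auto
    also have "\<dots> = 2 powr (1 - \<beta>) * (1 + t) powr (1 - \<beta>)"
      using powr_mult[of 2 "1 + t" "1 - \<beta>"] by (simp add: algebra_simps)
    also have "\<dots> \<le> 2 powr 1 * (1 + t) powr \<gamma>"
      using \<beta> \<gamma> t0 by (intro mult_mono powr_mono) auto
    finally have "real i * ?r ^ k \<le> 2 * (1 + t) powr \<gamma>" by simp
    then have 1: "\<bar>b (real J / 2 ^ k) - b (real n)\<bar> \<le> 2 * (1 + t) powr \<gamma>"
      using chain[of i] iJ by simp
    have 2: "\<bar>b t - b (real J / 2 ^ k)\<bar> \<le> c"
    proof -
      have "\<bar>b t - b (real J / 2 ^ k)\<bar> \<le> ?r ^ k / (1 - ?r)"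
        unfolding J_def using t0 k(1) by (intro dyadic_approximation[OF b r \<open>k0 \<le> k\<close>]) (auto simp: P_def)
      also have "\<dots> \<le> c"
        unfolding c_def using r by (intro divide_right_mono power_le_one) auto
      finally show ?thesis .
    qed
    have 3: "\<bar>b (real n)\<bar> \<le> 2 * (1 + t) powr \<gamma>"
      using n0[OF n(3)] n \<gamma> \<beta> powr_mono2[of \<gamma> "real n" "1 + t"] by simp
    have "1 \<le> (1 + t) powr \<gamma>"
      using t0 \<gamma> \<beta> by (intro ge_one_powr_ge_zero) auto
    then have "c \<le> c * (1 + t) powr \<gamma>"
      using c by (simp add: mult_le_cancel_left1)
    with 1 2 3 have "\<bar>b t\<bar> \<le> c * (1 + t) powr \<gamma> + 2 * (1 + t) powr \<gamma> + 2 * (1 + t) powr \<gamma>"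
      by linarith
    then show ?thesis by (simp add: algebra_simps)
  qed
  have "compact (b ` {0..T})"
    by (rule compact_continuous_image[OF continuous_on_subset[OF b(1)]]) auto
  then have "bounded (b ` {0..T})" by (rule compact_imp_bounded)
  then obtain S where "\<forall>y\<in>b ` {0..T}. norm y \<le> S"
    unfolding bounded_iff by blast
  then have S: "\<bar>b t\<bar> \<le> S" if "0 \<le> t" "t \<le> T" for t
    using that by simp
  show ?thesis
  proof (intro exI[of _ "max S (c + 4)"] conjI allI impI)
    show "0 \<le> max S (c + 4)" using c by simp
    fix t :: real assume t: "0 \<le> t"
    have one: "1 \<le> (1 + t) powr \<gamma>"
      using t \<gamma> \<beta> by (intro ge_one_powr_ge_zero) auto
    show "\<bar>b t\<bar> \<le> max S (c + 4) * (1 + t) powr \<gamma>"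
    proof (cases "t \<le> T")
      case True
      then have "\<bar>b t\<bar> \<le> max S (c + 4) * 1" using S[OF t True] by simp
      also have "\<dots> \<le> max S (c + 4) * (1 + t) powr \<gamma>"
        using one c by (intro mult_left_mono) auto
      finally show ?thesis .
    next
      case False
      then have "\<bar>b t\<bar> \<le> (c + 4) * (1 + t) powr \<gamma>" by (intro large) simp
      also have "\<dots> \<le> max S (c + 4) * (1 + t) powr \<gamma>"
        by (intro mult_right_mono) auto
      finally show ?thesis .
    qed
  qed
qed

subsection \<open>Young integrals against Hoelder paths\<close>

lemma has_young_integral_unique:
  assumes "has_young_integral f g a b J" "has_young_integral f g a b J'"
  shows "J = J'"
proof (rule ccontr)
  assume "J \<noteq> J'"
  define \<epsilon> where "\<epsilon> = \<bar>J - J'\<bar> / 2"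
  have \<epsilon>: "0 < \<epsilon>" using \<open>J \<noteq> J'\<close> by (simp add: \<epsilon>_def)
  let ?S = "\<lambda>D. \<Sum>(x, K)\<in>D. f x * (g (Sup K) - g (Inf K))"
  obtain d where d: "0 < d" "\<forall>D. D tagged_division_of {a..b} \<and> (\<lambda>x. ball x d) fine D \<longrightarrow> \<bar>?S D - J\<bar> < \<epsilon>"
    using assms(1)[unfolded has_young_integral_def, rule_format, OF \<epsilon>] by (elim exE conjE)
  obtain d' where d': "0 < d'" "\<forall>D. D tagged_division_of {a..b} \<and> (\<lambda>x. ball x d') fine D \<longrightarrow> \<bar>?S D - J'\<bar> < \<epsilon>"
    using assms(2)[unfolded has_young_integral_def, rule_format, OF \<epsilon>] by (elim exE conjE)
  have "gauge (\<lambda>x. ball x (min d d'))"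
    using d(1) d'(1) by (auto simp: gauge_def)
  then obtain D where D: "D tagged_division_of {a..b}" "(\<lambda>x. ball x (min d d')) fine D"
    by (rule fine_division_exists_real)
  have "(\<lambda>x. ball x d) fine D" "(\<lambda>x. ball x d') fine D"
    using D(2) by (simp_all add: ball_min_Int fine_Int)
  then have "\<bar>?S D - J\<bar> < \<epsilon>" "\<bar>?S D - J'\<bar> < \<epsilon>"
    using d(2)[THEN spec, of D] d'(2)[THEN spec, of D] D(1) by simp_all
  moreover have False if "\<bar>y - J\<bar> < \<epsilon>" "\<bar>y - J'\<bar> < \<epsilon>" for y
    using that unfolding \<epsilon>_def by (auto simp: abs_if split: if_splits)
  ultimately show False by blast
qed

lemma young_integral_eqI: "has_young_integral f g a b J \<Longrightarrow> young_integral f g a b = J"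
  unfolding young_integral_def using has_young_integral_unique by blast

text \<open>The increments of F telescope over a tagged division, so only local errors remain. They
  sum to at most C (b - a) times the mesh to the power \<theta> - 1, which vanishes with the mesh
  since \<theta> > 1.\<close>

lemma has_young_integral_sewing:
  fixes f g F :: "real \<Rightarrow> real"
  assumes ab: "a \<le> b" and \<theta>: "1 < \<theta>" and "0 \<le> C" "0 < \<delta>"
    and loc: "\<And>l x u. a \<le> l \<Longrightarrow> l \<le> x \<Longrightarrow> x \<le> u \<Longrightarrow> u \<le> b \<Longrightarrow> u - l \<le> \<delta> \<Longrightarrow>
      \<bar>f x * (g u - g l) - (F u - F l)\<bar> \<le> C * (u - l) powr \<theta>"
  shows "has_young_integral f g a b (F b - F a)"
  unfolding has_young_integral_def
proof (intro allI impI)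
  fix \<epsilon> :: real assume \<epsilon>: "0 < \<epsilon>"
  \<comment> \<open>The summand 1 keeps the denominator positive when \<open>C * (b - a)\<close>
    vanishes and makes the final inequality strict.\<close>
  define \<kappa> where "\<kappa> = \<epsilon> / (C * (b - a) + 1)"
  have den: "0 < C * (b - a) + 1"
    using assms by (intro add_nonneg_pos mult_nonneg_nonneg) auto
  then have \<kappa>: "0 < \<kappa>" using \<epsilon> by (simp add: \<kappa>_def)
  \<comment> \<open>An interval inside a ball of radius \<eta> around its tag has length up to 2
    \<eta>, hence the halves.\<close>
  define \<eta> where "\<eta> = min (\<delta> / 2) (\<kappa> powr (1 / (\<theta> - 1)) / 2)"
  have \<eta>: "0 < \<eta>" "2 * \<eta> \<le> \<delta>" "2 * \<eta> \<le> \<kappa> powr (1 / (\<theta> - 1))"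
    using \<open>0 < \<delta>\<close> \<kappa> by (auto simp: \<eta>_def)
  have \<eta>_powr: "(2 * \<eta>) powr (\<theta> - 1) \<le> \<kappa>"
  proof -
    have "(2 * \<eta>) powr (\<theta> - 1) \<le> (\<kappa> powr (1 / (\<theta> - 1))) powr (\<theta> - 1)"
      using \<eta> \<theta> by (intro powr_mono2) auto
    also have "\<dots> = \<kappa>" using \<kappa> \<theta> by (simp add: powr_powr)
    finally show ?thesis .
  qed
  show "\<exists>\<delta>>0. \<forall>D. D tagged_division_of {a..b} \<and> (\<lambda>x. ball x \<delta>) fine D \<longrightarrow>
      \<bar>(\<Sum>(x, K)\<in>D. f x * (g (Sup K) - g (Inf K))) - (F b - F a)\<bar> < \<epsilon>"
  proof (intro exI conjI allI impI)
    fix D assume "D tagged_division_of {a..b} \<and> (\<lambda>x. ball x \<eta>) fine D"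
    then have D: "D tagged_division_of {a..b}" "(\<lambda>x. ball x \<eta>) fine D" by auto
    have tm: "\<bar>f x * (g (Sup K) - g (Inf K)) - (F (Sup K) - F (Inf K))\<bar> \<le> C * \<kappa> * (Sup K - Inf K)"
      if xK: "(x, K) \<in> D" for x K
    proof -
      obtain l u where K: "K = {l..u}"
        using tagged_division_ofD(4)[OF D(1) xK] by auto
      have x: "x \<in> {l..u}" and sub: "{l..u} \<subseteq> {a..b}"
        using tagged_division_ofD(2,3)[OF D(1) xK] K by auto
      have lu: "l \<le> u" using x by auto
      have ball: "{l..u} \<subseteq> ball x \<eta>" using D(2) xK K by (auto simp: fine_def)
      have lub: "a \<le> l" "u \<le> b" using sub lu by auto
      have "l \<in> ball x \<eta>" "u \<in> ball x \<eta>"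
        using ball lu by auto
      then have ul: "u - l \<le> 2 * \<eta>" by (auto simp: dist_real_def)
      have "\<bar>f x * (g u - g l) - (F u - F l)\<bar> \<le> C * (u - l) powr \<theta>"
        using x lub ul \<eta> by (intro loc) auto
      also have "(u - l) powr \<theta> \<le> \<kappa> * (u - l)"
      proof (cases "u = l")
        case False
        then have "(u - l) powr \<theta> = (u - l) powr (\<theta> - 1) * (u - l)"
          using lu by (simp add: powr_diff)
        also have "(u - l) powr (\<theta> - 1) \<le> (2 * \<eta>) powr (\<theta> - 1)"
          using lu ul \<theta> by (intro powr_mono2) auto
        also have "\<dots> \<le> \<kappa>" by (rule \<eta>_powr)
        finally show ?thesis using lu by (simp add: mult_right_mono)
      qed simp
      finally show ?thesis
        using \<open>0 \<le> C\<close> lu by (simp add: K mult.assoc mult_left_mono)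
    qed
    have "\<bar>(\<Sum>(x, K)\<in>D. f x * (g (Sup K) - g (Inf K))) - (F b - F a)\<bar>
      = \<bar>\<Sum>(x, K)\<in>D. f x * (g (Sup K) - g (Inf K)) - (F (Sup K) - F (Inf K))\<bar>"
      using additive_tagged_division_1[OF ab D(1), of F]
      by (simp add: split_def sum_subtractf)
    also have "\<dots> \<le> (\<Sum>(x, K)\<in>D. \<bar>f x * (g (Sup K) - g (Inf K)) - (F (Sup K) - F (Inf K))\<bar>)"
      unfolding split_def by (rule sum_abs)
    also have "\<dots> \<le> (\<Sum>(x, K)\<in>D. C * \<kappa> * (Sup K - Inf K))"
      using tm by (intro sum_mono) auto
    also have "\<dots> = C * \<kappa> * (b - a)"
      using additive_tagged_division_1[OF ab D(1), of "\<lambda>x. x"]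
      by (simp add: split_def sum_distrib_left[symmetric])
    also have "\<dots> < (C * (b - a) + 1) * \<kappa>"
      using \<kappa> by (simp add: algebra_simps)
    also have "\<dots> = \<epsilon>" using den by (simp add: \<kappa>_def)
    finally show "\<bar>(\<Sum>(x, K)\<in>D. f x * (g (Sup K) - g (Inf K))) - (F b - F a)\<bar> < \<epsilon>" .
  qed (rule \<eta>)
qed

subsection \<open>Asymptotics of a single path\<close>

lemma set_integrable_bounded_continuous:
  fixes f g :: "real \<Rightarrow> real"
  assumes [measurable]: "f \<in> borel_measurable borel" and K: "\<And>s. \<bar>f s\<bar> \<le> K"
    and g: "continuous_on {a..b} g"
  shows "set_integrable lborel {a..b} (\<lambda>s. f s * g s)"
proof -
  have int: "integrable lborel (\<lambda>s. indicator {a..b} s * g s)"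
    using borel_integrable_atLeastAtMost'[OF g] by (simp add: set_integrable_def)
  then have [measurable]: "(\<lambda>s. indicator {a..b} s * g s) \<in> borel_measurable borel"
    by (simp add: borel_measurable_integrable)
  have "integrable lborel (\<lambda>s. f s * (indicator {a..b} s * g s))"
  proof (rule Bochner_Integration.integrable_bound)
    show "integrable lborel (\<lambda>s. K * (indicator {a..b} s * g s))"
      using int by (rule integrable_mult_right)
    have "\<bar>f s\<bar> \<le> \<bar>K\<bar>" for s using K[of s] by linarith
    then show "AE s in lborel. norm (f s * (indicator {a..b} s * g s)) \<le> norm (K * (indicator {a..b} s * g s))"
      by (auto simp: abs_mult intro!: mult_right_mono)
  qed measurable
  then show ?thesis
    by (simp add: set_integrable_def mult_ac)
qed

text \<open>Letting t tend to infinity in the Cauchy estimate keeps its rate, so the distance to the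
  limit obeys the same bound.\<close>

lemma exponentially_Cauchy_limit:
  fixes f :: "real \<Rightarrow> real"
  assumes c: "0 < c" and f: "\<And>s t. 0 \<le> s \<Longrightarrow> s \<le> t \<Longrightarrow> \<bar>f t - f s\<bar> \<le> A * exp (- c * s)"
  shows "\<exists>l. (\<forall>t\<ge>0. \<bar>f t - l\<bar> \<le> A * exp (- c * t)) \<and> (f \<longlongrightarrow> l) at_top"
proof -
  have lim0: "((\<lambda>t. A * exp (- c * t)) \<longlongrightarrow> 0) at_top"
    using c by real_asymp
  have "Cauchy (\<lambda>n. f (real n))"
  proof (rule metric_CauchyI)
    fix e :: real assume "0 < e"
    have "(\<lambda>n. A * exp (- c * real n)) \<longlonglongrightarrow> 0"
      using lim0 filterlim_real_sequentially by (rule filterlim_compose)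
    then obtain N where N: "\<And>n. n \<ge> N \<Longrightarrow> \<bar>A * exp (- c * real n)\<bar> < e"
      using \<open>0 < e\<close> by (auto simp: LIMSEQ_iff)
    have *: "dist (f (real m)) (f (real n)) < e" if "N \<le> m" "m \<le> n" for m n
      using f[of "real m" "real n"] N[of m] that by (simp add: dist_real_def abs_minus_commute)
    have "dist (f (real m)) (f (real n)) < e" if "N \<le> m" "N \<le> n" for m n
      using *[of m n] *[of n m] that by (cases "m \<le> n") (simp_all add: dist_commute)
    then show "\<exists>M. \<forall>m\<ge>M. \<forall>n\<ge>M. dist (f (real m)) (f (real n)) < e" by blast
  qed
  then obtain l where l: "(\<lambda>n. f (real n)) \<longlonglongrightarrow> l"
    using Cauchy_convergent_iff convergent_def by blast
  have bound: "\<bar>f t - l\<bar> \<le> A * exp (- c * t)" if t: "0 \<le> t" for t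
  proof (rule LIMSEQ_le_const2)
    show "(\<lambda>n. \<bar>f t - f (real n)\<bar>) \<longlonglongrightarrow> \<bar>f t - l\<bar>"
      by (intro tendsto_intros l)
    obtain N :: nat where "t \<le> real N" using real_arch_simple by blast
    then have "\<bar>f t - f (real n)\<bar> \<le> A * exp (- c * t)" if "N \<le> n" for n
      using f[of t "real n"] t that by (simp add: abs_minus_commute)
    then show "\<exists>N. \<forall>n\<ge>N. \<bar>f t - f (real n)\<bar> \<le> A * exp (- c * t)" by blast
  qed
  moreover have "((\<lambda>t. f t - l) \<longlongrightarrow> 0) at_top"
  proof (rule Lim_null_comparison[OF _ lim0])
    show "eventually (\<lambda>t. norm (f t - l) \<le> A * exp (- c * t)) at_top"
      using eventually_ge_at_top[of 0] by eventually_elim (metis bound real_norm_def)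
  qed
  then have "(f \<longlongrightarrow> l) at_top" by (simp add: LIM_zero_iff)
  ultimately show ?thesis by blast
qed

text \<open>One fixed path, with the equation as a deterministic identity. All randomness is settled
  before this locale is entered.\<close>

locale ou_path =
  fixes x b L :: "real \<Rightarrow> real" and \<alpha> \<sigma> x0 K :: real
  assumes x_cont: "continuous_on {0..} x" and b_cont: "continuous_on {0..} b"
    and L_measurable [measurable]: "L \<in> borel_measurable borel" and L_bound: "\<And>s. \<bar>L s\<bar> \<le> K"
    and \<alpha>: "0 < \<alpha>"
    and sol: "\<And>t. 0 \<le> t \<Longrightarrow> x t = x0 + (LINT s:{0..t}|lborel. L s + \<alpha> * x s) + \<sigma> * b t"
begin

lemma x_cont': "0 \<le> a \<Longrightarrow> continuous_on {a..c} x"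
  and b_cont': "0 \<le> a \<Longrightarrow> continuous_on {a..c} b"
  using continuous_on_subset[OF x_cont, of "{a..c}"] continuous_on_subset[OF b_cont, of "{a..c}"] by auto

lemma K_nonneg: "0 \<le> K"
  using L_bound[of 0] by linarith

definition drift :: "real \<Rightarrow> real" where
  "drift s = L s + \<alpha> * x s"

lemma set_integrable_drift:
  assumes "0 \<le> a" "continuous_on {a..c} g"
  shows "set_integrable lborel {a..c} (\<lambda>s. g s * drift s)"
proof -
  have "set_integrable lborel {a..c} (\<lambda>s. L s * g s)"
    using assms by (intro set_integrable_bounded_continuous[OF L_measurable L_bound])
  moreover have "set_integrable lborel {a..c} (\<lambda>s. g s * (\<alpha> * x s))"
    using assms by (intro borel_integrable_atLeastAtMost' continuous_intros x_cont')
  ultimately have "set_integrable lborel {a..c} (\<lambda>s. L s * g s + g s * (\<alpha> * x s))"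
    by (rule set_integral_add)
  then show ?thesis by (simp add: drift_def algebra_simps)
qed

lemmas integrable_drift = set_borel_integral_eq_integral(1)[OF set_integrable_drift]
lemmas integral_drift = set_borel_integral_eq_integral(2)[OF set_integrable_drift]

text \<open>The regular part of x: it is Lipschitz on bounded intervals because \<open>drift\<close>
  is bounded there, while \<open>\<sigma> * b\<close> carries all the roughness.\<close>

definition v :: "real \<Rightarrow> real" where
  "v t = x0 + integral {0..t} drift"

lemma x_eq: "0 \<le> t \<Longrightarrow> x t = v t + \<sigma> * b t"
  using sol[of t] integral_drift[of 0 t "\<lambda>_. 1"] by (simp add: v_def drift_def[abs_def])

lemma v_diff:
  assumes "0 \<le> s" "s \<le> t"
  shows "v t - v s = integral {s..t} drift"
  using Henstock_Kurzweil_Integration.integral_combine[OF assms, of drift] integrable_drift[of 0 t "\<lambda>_. 1"]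
  by (simp add: v_def)

text \<open>Since x = v + \<sigma> b, a primitive of x db is F = v b - \<integral> b dv + \<sigma>
  b^2 / 2, by parts for v and by the chain rule for b. Its local error has order 1 + \<beta> from v
  and 2 \<beta> from b; both are handled as order 2 \<beta> > 1, and sewing applies. Replacing v by
  x - \<sigma> b changes the sign of the quadratic term in the result.\<close>

lemma young_integral_path:
  assumes T: "0 \<le> T" and \<beta>: "1 / 2 < \<beta>" "\<beta> < 1"
    and \<delta>: "0 < \<delta>" and C: "0 \<le> C"
    and hoelder: "\<And>s t. 0 \<le> s \<Longrightarrow> s \<le> t \<Longrightarrow> t \<le> T \<Longrightarrow> t - s \<le> \<delta> \<Longrightarrow> \<bar>b t - b s\<bar> \<le> C * (t - s) powr \<beta>"
  shows "young_integral x b 0 T = x T * b T - x 0 * b 0 - integral {0..T} (\<lambda>s. b s * drift s)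
    - \<sigma> * ((b T)\<^sup>2 - (b 0)\<^sup>2) / 2"
proof -
  have "bounded (x ` {0..T})"
    by (intro compact_imp_bounded compact_continuous_image x_cont') auto
  then obtain X where "\<forall>y\<in>x ` {0..T}. norm y \<le> X"
    unfolding bounded_iff by blast
  then have X: "\<bar>x s\<bar> \<le> X" if "s \<in> {0..T}" for s
    using that by auto
  define W where "W = K + \<alpha> * X"
  have W: "\<bar>drift s\<bar> \<le> W" if "s \<in> {0..T}" for s
  proof -
    have "\<bar>drift s\<bar> \<le> \<bar>L s\<bar> + \<alpha> * \<bar>x s\<bar>"
      unfolding drift_def using \<alpha> by (intro order_trans[OF abs_triangle_ineq]) (simp add: abs_mult)
    also have "\<dots> \<le> W"
      unfolding W_def using L_bound[of s] X[OF that] \<alpha> by (intro add_mono mult_left_mono) auto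
    finally show ?thesis .
  qed
  have W0: "0 \<le> W" using W[of 0] T by auto
  define F where "F t = v t * b t - integral {0..t} (\<lambda>s. b s * drift s) + \<sigma> * (b t)\<^sup>2 / 2" for t
  let ?C = "2 * (W * C) + \<bar>\<sigma>\<bar> * C\<^sup>2"
  \<comment> \<open>Serves both subintervals, with b frozen at the outer end point r of [l, u].
    Limiting the length to 1 gives \<open>u - l\<close> \<le> \<open>(u - l) powr \<beta>\<close>,
    which lowers the order 1 + \<beta> to 2 \<beta>.\<close>
  have part: "\<bar>integral {p..q} drift * b r - integral {p..q} (\<lambda>s. b s * drift s)\<bar> \<le> W * C * (u - l) powr (2 * \<beta>)"
    if pq: "0 \<le> l" "l \<le> p" "p \<le> q" "q \<le> u" "u \<le> T" "r = l \<or> r = u" "u - l \<le> min \<delta> 1" for l p q u r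
  proof -
    have i1: "drift integrable_on {p..q}" "(\<lambda>s. b s * drift s) integrable_on {p..q}"
      using integrable_drift[of p q "\<lambda>_. 1"] integrable_drift[of p q b] b_cont'[of p q] pq by auto
    have "integral {p..q} drift * b r - integral {p..q} (\<lambda>s. b s * drift s)
        = integral {p..q} (\<lambda>s. drift s * b r - b s * drift s)"
      using i1 by (simp add: Henstock_Kurzweil_Integration.integral_diff integrable_on_mult_left)
    also have "norm \<dots> \<le> integral {p..q} (\<lambda>_. W * (C * (u - l) powr \<beta>))"
    proof (rule Henstock_Kurzweil_Integration.integral_norm_bound_integral)
      show "(\<lambda>s. drift s * b r - b s * drift s) integrable_on {p..q}"
        by (intro integrable_diff integrable_on_mult_left i1)
      fix s assume s: "s \<in> {p..q}"
      have "\<bar>b r - b s\<bar> \<le> C * (u - l) powr \<beta>"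
      proof -
        have "\<bar>b r - b s\<bar> \<le> C * \<bar>r - s\<bar> powr \<beta>"
          using pq s hoelder[of l s] hoelder[of s u] by (auto simp: abs_minus_commute)
        also have "\<dots> \<le> C * (u - l) powr \<beta>"
          using pq s C \<beta> by (intro mult_left_mono powr_mono2) auto
        finally show ?thesis .
      qed
      then have "\<bar>drift s\<bar> * \<bar>b r - b s\<bar> \<le> W * (C * (u - l) powr \<beta>)"
        using pq s W0 by (intro mult_mono W) auto
      then show "norm (drift s * b r - b s * drift s) \<le> W * (C * (u - l) powr \<beta>)"
        by (simp add: abs_mult[symmetric] algebra_simps)
    qed (rule integrable_const_ivl)
    also have "\<dots> = W * C * ((q - p) * (u - l) powr \<beta>)"
      using pq by (simp add: mult_ac)
    also have "(q - p) * (u - l) powr \<beta> \<le> (u - l) powr \<beta> * (u - l) powr \<beta>"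
    proof -
      have "u - l \<le> (u - l) powr \<beta>"
      proof (cases "u = l")
        case False
        then have "(u - l) powr 1 \<le> (u - l) powr \<beta>"
          using pq \<beta> by (intro powr_mono') auto
        then show ?thesis using pq by simp
      qed simp
      then show ?thesis using pq by (intro mult_right_mono) auto
    qed
    finally show ?thesis
      using W0 C by (simp add: powr_add[symmetric] mult_left_mono)
  qed
  have arith: "e \<le> (2 * (W * C) + S) * P"
    if "e \<le> p + q + r" "p \<le> S * P" "q \<le> W * C * P" "r \<le> W * C * P" for e p q r S P
  proof -
    have "(2 * (W * C) + S) * P = W * C * P + W * C * P + S * P" by (simp add: distrib_right)
    then show ?thesis using that by linarith
  qed
  have "has_young_integral x b 0 T (F T - F 0)"
  proof (rule has_young_integral_sewing[OF T, of "2 * \<beta>" ?C "min \<delta> 1"])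
    fix l s u assume ls: "0 \<le> l" "l \<le> s" "s \<le> u" "u \<le> T" "u - l \<le> min \<delta> 1"
    let ?E1 = "integral {s..u} drift * b u - integral {s..u} (\<lambda>s. b s * drift s)"
    let ?E2 = "integral {l..s} drift * b l - integral {l..s} (\<lambda>s. b s * drift s)"
    let ?E3 = "(b s - b l) * (b u - b l) - (b u - b l)\<^sup>2 / 2"
    have comb: "integral {0..u} (\<lambda>s. b s * drift s) = integral {0..l} (\<lambda>s. b s * drift s)
        + integral {l..s} (\<lambda>s. b s * drift s) + integral {s..u} (\<lambda>s. b s * drift s)"
    proof -
      have "(\<lambda>s. b s * drift s) integrable_on {0..u}" "(\<lambda>s. b s * drift s) integrable_on {l..u}"
        using ls by (intro integrable_drift b_cont'; simp)+
      then show ?thesis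
        using ls Henstock_Kurzweil_Integration.integral_combine[of 0 l u "\<lambda>s. b s * drift s"]
          Henstock_Kurzweil_Integration.integral_combine[of l s u "\<lambda>s. b s * drift s"] by simp
    qed
    have vu: "v u = v s + integral {s..u} drift" and vl: "v l = v s - integral {l..s} drift"
      using v_diff[of s u] v_diff[of l s] ls by auto
    have e1: "\<bar>?E1\<bar> \<le> W * C * (u - l) powr (2 * \<beta>)" and e2: "\<bar>?E2\<bar> \<le> W * C * (u - l) powr (2 * \<beta>)"
      by (rule part; use ls in simp)+
    have e3: "\<bar>\<sigma> * ?E3\<bar> \<le> \<bar>\<sigma>\<bar> * C\<^sup>2 * (u - l) powr (2 * \<beta>)"
    proof -
      have h: "\<bar>b s - b l\<bar> \<le> C * (u - l) powr \<beta>" "\<bar>b u - b s\<bar> \<le> C * (u - l) powr \<beta>" "\<bar>b u - b l\<bar> \<le> C * (u - l) powr \<beta>"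
      proof -
        have mono: "C * p powr \<beta> \<le> C * (u - l) powr \<beta>" if "0 \<le> p" "p \<le> u - l" for p
          using that C \<beta> by (intro mult_left_mono powr_mono2) auto
        show "\<bar>b s - b l\<bar> \<le> C * (u - l) powr \<beta>"
          by (rule order_trans[OF hoelder mono]) (use ls in auto)
        show "\<bar>b u - b s\<bar> \<le> C * (u - l) powr \<beta>"
          by (rule order_trans[OF hoelder mono]) (use ls in auto)
        show "\<bar>b u - b l\<bar> \<le> C * (u - l) powr \<beta>"
          by (rule order_trans[OF hoelder mono]) (use ls in auto)
      qed
      \<comment> \<open>Factored so that both factors are differences of increments inside [l, u]:
        comparing the tag value with the mean of the end point values leaves half the difference of
        the two partial increments.\<close>
      have "?E3 = ((b s - b l) - (b u - b s)) / 2 * (b u - b l)"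
        by (simp add: field_simps power2_eq_square)
      also have "\<bar>\<dots>\<bar> \<le> (C * (u - l) powr \<beta>) * (C * (u - l) powr \<beta>)"
        unfolding abs_mult using h by (intro mult_mono) auto
      also have "\<dots> = C\<^sup>2 * (u - l) powr (2 * \<beta>)"
        by (simp add: power2_eq_square powr_add[symmetric] mult_ac)
      finally show "\<bar>\<sigma> * ?E3\<bar> \<le> \<bar>\<sigma>\<bar> * C\<^sup>2 * (u - l) powr (2 * \<beta>)"
        unfolding abs_mult mult.assoc by (intro mult_left_mono) auto
    qed
    have eq: "x s * (b u - b l) - (F u - F l) = \<sigma> * ?E3 - ?E1 - ?E2"
      using ls unfolding F_def comb vu vl by (simp add: x_eq field_simps power2_eq_square)
    have split: "\<bar>x s * (b u - b l) - (F u - F l)\<bar> \<le> \<bar>\<sigma> * ?E3\<bar> + \<bar>?E1\<bar> + \<bar>?E2\<bar>"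
      unfolding eq by linarith
    show "\<bar>x s * (b u - b l) - (F u - F l)\<bar> \<le> ?C * (u - l) powr (2 * \<beta>)"
      by (rule arith[OF split e3 e1 e2])
  qed (use \<beta> \<delta> C W0 in auto)
  then have "young_integral x b 0 T = F T - F 0"
    by (rule young_integral_eqI)
  also have "\<dots> = x T * b T - x 0 * b 0 - integral {0..T} (\<lambda>s. b s * drift s)
    - \<sigma> * ((b T)\<^sup>2 - (b 0)\<^sup>2) / 2"
    using T unfolding F_def by (simp add: x_eq field_simps power2_eq_square)
  finally show ?thesis .
qed

end

lemma exp_has_integral:
  fixes c s t :: real
  assumes "c \<noteq> 0" "s \<le> t"
  shows "((\<lambda>u. exp (c * u)) has_integral (exp (c * t) - exp (c * s)) / c) {s..t}"
proof -
  have "((\<lambda>u. exp (c * u)) has_integral exp (c * t) / c - exp (c * s) / c) {s..t}"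
    using assms by (intro fundamental_theorem_of_calculus)
      (auto intro!: derivative_eq_intros simp: has_real_derivative_iff_has_vector_derivative[symmetric])
  then show ?thesis by (simp add: diff_divide_distrib)
qed

lemma one_plus_le_exp:
  fixes c s :: real
  assumes "0 < c" "0 \<le> s"
  shows "1 + s \<le> (1 + 1 / c) * exp (c * s)"
proof -
  have "s \<le> exp (c * s) / c"
  proof -
    have "c * s \<le> exp (c * s)" using exp_ge_add_one_self[of "c * s"] by linarith
    then show ?thesis using assms by (simp add: field_simps)
  qed
  moreover have "1 \<le> exp (c * s)" using assms by simp
  moreover have "(1 + 1 / c) * exp (c * s) = exp (c * s) + exp (c * s) / c"
    by (simp add: distrib_right)
  ultimately show ?thesis by linarith
qed

lemma integral_abs_le:
  fixes f g :: "real \<Rightarrow> real"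
  assumes "f integrable_on S" "(g has_integral I) S" "\<And>s. s \<in> S \<Longrightarrow> \<bar>f s\<bar> \<le> g s"
  shows "\<bar>integral S f\<bar> \<le> I"
  using Henstock_Kurzweil_Integration.integral_norm_bound_integral[of f S g] assms
  by (auto simp: integral_unique has_integral_integrable)

section \<open>Exponential growth of the path\<close>

locale ou_path_growth = ou_path +
  fixes G \<gamma> :: real
  assumes G: "0 \<le> G" and \<gamma>: "0 < \<gamma>" "\<gamma> < 1"
    and growth: "\<And>t. 0 \<le> t \<Longrightarrow> \<bar>b t\<bar> \<le> G * (1 + t) powr \<gamma>"
begin

lemma b_linear_growth: "0 \<le> t \<Longrightarrow> \<bar>b t\<bar> \<le> G * (1 + t)"
proof -
  assume t: "0 \<le> t"
  have "(1 + t) powr \<gamma> \<le> (1 + t) powr 1"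
    using t \<gamma> by (intro powr_mono) auto
  then have "G * (1 + t) powr \<gamma> \<le> G * (1 + t)"
    using t G by (intro mult_left_mono) auto
  then show ?thesis using growth[OF t] by linarith
qed

definition ell :: "real \<Rightarrow> real" where
  "ell t = integral {0..t} L"

lemma L_integrable: "L integrable_on {a..c}"
  using set_borel_integral_eq_integral(1)[OF set_integrable_bounded_continuous[OF L_measurable L_bound, of a c "\<lambda>_. 1"]]
  by simp

lemma ell_bound: "0 \<le> t \<Longrightarrow> \<bar>ell t\<bar> \<le> K * t"
  unfolding ell_def using has_integral_const_real[of K 0 t] L_bound
  by (intro integral_abs_le[OF L_integrable, of "\<lambda>_. K"]) (auto simp: mult.commute)

lemma ell_cont: "continuous_on {0..c} ell"
  unfolding ell_def[abs_def] by (intro indefinite_integral_continuous_1 L_integrable)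

definition forcing :: "real \<Rightarrow> real" where
  "forcing s = exp (- \<alpha> * s) * (ell s + \<sigma> * b s)"

lemma forcing_cont: "0 \<le> a \<Longrightarrow> continuous_on {a..c} forcing"
  unfolding forcing_def[abs_def]
  by (intro continuous_intros b_cont' continuous_on_subset[OF ell_cont[of c]]) auto

text \<open>Differs from the discounted path only by a multiple of \<open>forcing\<close>, which
  decays. The integral of the discount factor against b has been moved onto the exponential by
  parts, so only ordinary integrals of continuous functions occur.\<close>

definition discounted :: "real \<Rightarrow> real" where
  "discounted t = x0 + \<alpha> * integral {0..t} forcing"

text \<open>Although \<open>L\<close> may be discontinuous, \<open>x - \<sigma> b - \<integral>L\<close> is continuously differentiable with
  derivative \<open>\<alpha> x\<close>, so the fundamental theorem of calculus applies to its discounted version.\<close>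

lemma discounted_eq:
  assumes t: "0 \<le> t"
  shows "discounted t = exp (- \<alpha> * t) * (x t - \<sigma> * b t - ell t)"
proof -
  let ?z = "\<lambda>s. x0 + \<alpha> * integral {0..s} x"
  have z: "x s - \<sigma> * b s - ell s = ?z s" if "0 \<le> s" for s
  proof -
    have "integral {0..s} drift = ell s + \<alpha> * integral {0..s} x"
      unfolding drift_def[abs_def] ell_def
      using L_integrable integrable_continuous_real[OF x_cont'[of 0 s]] \<alpha>
      by (subst Henstock_Kurzweil_Integration.integral_add) (auto intro!: integrable_on_mult_right)
    then show ?thesis using x_eq[OF that] by (simp add: v_def)
  qed
  have "((\<lambda>s. \<alpha> * forcing s) has_integral exp (- \<alpha> * t) * ?z t - exp (- \<alpha> * 0) * ?z 0) {0..t}"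
  proof (rule fundamental_theorem_of_calculus[OF t])
    fix s assume s: "s \<in> {0..t}"
    have "((\<lambda>s. integral {0..s} x) has_real_derivative x s) (at s within {0..t})"
      using integral_has_real_derivative[OF x_cont' s] by simp
    then have "((\<lambda>s. exp (- \<alpha> * s) * ?z s) has_real_derivative
        exp (- \<alpha> * s) * (\<alpha> * x s) + exp (- \<alpha> * s) * - \<alpha> * ?z s) (at s within {0..t})"
      by (auto intro!: derivative_eq_intros)
    moreover have "exp (- \<alpha> * s) * (\<alpha> * x s) + exp (- \<alpha> * s) * - \<alpha> * ?z s = \<alpha> * forcing s"
      using z[of s] s by (simp add: forcing_def algebra_simps)
    ultimately show "((\<lambda>s. exp (- \<alpha> * s) * ?z s) has_vector_derivative \<alpha> * forcing s) (at s within {0..t})"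
      by (simp add: has_real_derivative_iff_has_vector_derivative)
  qed
  then have "integral {0..t} (\<lambda>s. \<alpha> * forcing s) = exp (- \<alpha> * t) * ?z t - exp (- \<alpha> * 0) * ?z 0"
    by (rule integral_unique)
  then show ?thesis using z[OF t] by (simp add: discounted_def)
qed

text \<open>The linear growth of \<open>ell\<close> and b costs half of the exponential rate, hence
  the \<alpha> / 2 in all later error terms.\<close>

lemma forcing_bound:
  obtains A where "0 \<le> A" "\<And>s. 0 \<le> s \<Longrightarrow> \<bar>forcing s\<bar> \<le> A * exp (- (\<alpha> / 2) * s)"
proof
  let ?A = "(K + \<bar>\<sigma>\<bar> * G) * (1 + 1 / (\<alpha> / 2))"
  show "0 \<le> ?A" using K_nonneg G \<alpha> by simp
  fix s :: real assume s: "0 \<le> s"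
  have "\<bar>ell s + \<sigma> * b s\<bar> \<le> \<bar>ell s\<bar> + \<bar>\<sigma>\<bar> * \<bar>b s\<bar>"
    by (intro order_trans[OF abs_triangle_ineq]) (simp add: abs_mult)
  also have "\<dots> \<le> K * (1 + s) + \<bar>\<sigma>\<bar> * (G * (1 + s))"
    using ell_bound[OF s] b_linear_growth[OF s] K_nonneg
    by (intro add_mono mult_left_mono) (auto simp: distrib_left)
  also have "\<dots> = (K + \<bar>\<sigma>\<bar> * G) * (1 + s)" by (simp add: algebra_simps)
  also have "\<dots> \<le> (K + \<bar>\<sigma>\<bar> * G) * ((1 + 1 / (\<alpha> / 2)) * exp (\<alpha> / 2 * s))"
    using K_nonneg G s \<alpha> by (intro mult_left_mono one_plus_le_exp) auto
  finally have "\<bar>forcing s\<bar> \<le> exp (- \<alpha> * s) * ((K + \<bar>\<sigma>\<bar> * G) * ((1 + 1 / (\<alpha> / 2)) * exp (\<alpha> / 2 * s)))"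
    unfolding forcing_def abs_mult by (intro mult_mono) auto
  also have "\<dots> = ?A * (exp (- \<alpha> * s) * exp (\<alpha> / 2 * s))" by (simp only: mult_ac)
  also have "exp (- \<alpha> * s) * exp (\<alpha> / 2 * s) = exp (- (\<alpha> / 2) * s)"
    by (simp add: exp_add[symmetric])
  finally show "\<bar>forcing s\<bar> \<le> ?A * exp (- (\<alpha> / 2) * s)" .
qed

text \<open>The tail of the integral of \<open>forcing\<close> from s on, times \<alpha>, is at most
  2 A exp(-\<alpha> s / 2). Adding \<open>forcing\<close> itself recovers the discounted x, so A
  enters three times; multiplying by exp(\<alpha> t) gives the deviation of x from its leading
  exponential.\<close>

lemma discounted_limit:
  "\<exists>\<xi> A. 0 \<le> A \<and> (discounted \<longlongrightarrow> \<xi>) at_top \<and>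
    (\<forall>t\<ge>0. \<bar>x t - \<xi> * exp (\<alpha> * t)\<bar> \<le> A * exp (\<alpha> / 2 * t))"
proof -
  obtain A where A: "0 \<le> A" "\<And>s. 0 \<le> s \<Longrightarrow> \<bar>forcing s\<bar> \<le> A * exp (- (\<alpha> / 2) * s)"
    using forcing_bound by blast
  have cauchy: "\<bar>discounted t - discounted s\<bar> \<le> 2 * A * exp (- (\<alpha> / 2) * s)" if st: "0 \<le> s" "s \<le> t" for s t
  proof -
    have int: "forcing integrable_on {s..t}" "forcing integrable_on {0..t}"
      using st by (auto intro!: integrable_continuous_real forcing_cont)
    have "((\<lambda>u. A * exp (- (\<alpha> / 2) * u)) has_integral
        A * ((exp (- (\<alpha> / 2) * t) - exp (- (\<alpha> / 2) * s)) / (- (\<alpha> / 2)))) {s..t}"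
      using st \<alpha> by (intro has_integral_mult_right exp_has_integral) auto
    then have "\<bar>integral {s..t} forcing\<bar> \<le> A * ((exp (- (\<alpha> / 2) * t) - exp (- (\<alpha> / 2) * s)) / (- (\<alpha> / 2)))"
    proof (rule integral_abs_le[OF int(1)])
      fix u assume "u \<in> {s..t}"
      then show "\<bar>forcing u\<bar> \<le> A * exp (- (\<alpha> / 2) * u)"
        using st by (intro A(2)) auto
    qed
    also have "\<dots> \<le> A * (exp (- (\<alpha> / 2) * s) / (\<alpha> / 2))"
      using A(1) \<alpha> by (intro mult_left_mono) (auto simp: field_simps)
    finally have "\<alpha> * \<bar>integral {s..t} forcing\<bar> \<le> \<alpha> * (A * (exp (- (\<alpha> / 2) * s) / (\<alpha> / 2)))"
      using \<alpha> by (intro mult_left_mono) auto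
    moreover have "discounted t - discounted s = \<alpha> * integral {s..t} forcing"
      unfolding discounted_def Henstock_Kurzweil_Integration.integral_combine[OF st int(2), symmetric]
      by (simp add: distrib_left)
    ultimately show ?thesis using \<alpha> by (simp add: abs_mult)
  qed
  obtain \<xi> where \<xi>: "\<And>t. 0 \<le> t \<Longrightarrow> \<bar>discounted t - \<xi>\<bar> \<le> 2 * A * exp (- (\<alpha> / 2) * t)"
      "(discounted \<longlongrightarrow> \<xi>) at_top"
    using exponentially_Cauchy_limit[OF half_gt_zero[OF \<alpha>] cauchy] by blast
  show ?thesis
  proof (rule exI[of _ \<xi>], rule exI[of _ "3 * A"], intro conjI allI impI)
    fix t :: real assume t: "0 \<le> t"
    have "exp (- \<alpha> * t) * x t = discounted t + forcing t"
      using discounted_eq[OF t] by (simp add: forcing_def algebra_simps)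
    then have "\<bar>exp (- \<alpha> * t) * x t - \<xi>\<bar> \<le> 3 * A * exp (- (\<alpha> / 2) * t)"
      using \<xi>(1)[OF t] A(2)[OF t] by linarith
    then have "exp (\<alpha> * t) * \<bar>exp (- \<alpha> * t) * x t - \<xi>\<bar> \<le> exp (\<alpha> * t) * (3 * A * exp (- (\<alpha> / 2) * t))"
      by (intro mult_left_mono) auto
    moreover have "exp (\<alpha> * t) * \<bar>exp (- \<alpha> * t) * x t - \<xi>\<bar> = \<bar>exp (\<alpha> * t) * (exp (- \<alpha> * t) * x t - \<xi>)\<bar>"
      by (simp add: abs_mult)
    moreover have "exp (\<alpha> * t) * (exp (- \<alpha> * t) * x t - \<xi>) = x t - \<xi> * exp (\<alpha> * t)"
      by (simp add: right_diff_distrib mult.assoc[symmetric] exp_add[symmetric])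
    moreover have "exp (\<alpha> * t) * (3 * A * exp (- (\<alpha> / 2) * t)) = 3 * A * exp (\<alpha> / 2 * t)"
    proof -
      have "exp (\<alpha> * t) * exp (- (\<alpha> / 2) * t) = exp (\<alpha> / 2 * t)"
        by (simp add: exp_add[symmetric])
      then show ?thesis by (metis mult.left_commute)
    qed
    ultimately show "\<bar>x t - \<xi> * exp (\<alpha> * t)\<bar> \<le> 3 * A * exp (\<alpha> / 2 * t)" by metis
  qed (use A \<xi> in auto)
qed

lemma x_exp_bound:
  obtains X where "0 \<le> X" "\<And>t. 0 \<le> t \<Longrightarrow> \<bar>x t\<bar> \<le> X * exp (\<alpha> * t)"
proof -
  obtain \<xi> A where A: "0 \<le> A" "\<And>t. 0 \<le> t \<Longrightarrow> \<bar>x t - \<xi> * exp (\<alpha> * t)\<bar> \<le> A * exp (\<alpha> / 2 * t)"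
    using discounted_limit by blast
  show thesis
  proof (rule that[of "\<bar>\<xi>\<bar> + A"])
    fix t :: real assume t: "0 \<le> t"
    have "\<bar>\<xi> * exp (\<alpha> * t)\<bar> = \<bar>\<xi>\<bar> * exp (\<alpha> * t)" by (simp add: abs_mult)
    moreover have "A * exp (\<alpha> / 2 * t) \<le> A * exp (\<alpha> * t)"
      using A(1) t \<alpha> by (intro mult_left_mono) auto
    ultimately show "\<bar>x t\<bar> \<le> (\<bar>\<xi>\<bar> + A) * exp (\<alpha> * t)"
      using A(2)[OF t] by (simp add: distrib_right)
  qed (use A in auto)
qed

lemma integral_bounded_times_x:
  assumes f: "f \<in> borel_measurable borel" "\<And>s. \<bar>f s\<bar> \<le> F"
  obtains C where "0 \<le> C" "\<And>n. \<bar>LINT t:{0..real n}|lborel. f t * x t\<bar> \<le> C * exp (\<alpha> * real n)"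
proof -
  obtain X where X: "0 \<le> X" "\<And>t. 0 \<le> t \<Longrightarrow> \<bar>x t\<bar> \<le> X * exp (\<alpha> * t)"
    using x_exp_bound by blast
  have F: "0 \<le> F" using f(2)[of 0] by linarith
  show thesis
  proof (rule that[of "F * X / \<alpha>"])
    fix n :: nat
    note int = set_borel_integral_eq_integral[OF set_integrable_bounded_continuous[OF f x_cont'[OF order_refl], of "real n"]]
    have "((\<lambda>s. F * X * exp (\<alpha> * s)) has_integral F * X * ((exp (\<alpha> * real n) - exp (\<alpha> * 0)) / \<alpha>)) {0..real n}"
      using \<alpha> by (intro has_integral_mult_right exp_has_integral) auto
    then have "\<bar>integral {0..real n} (\<lambda>t. f t * x t)\<bar> \<le> F * X * ((exp (\<alpha> * real n) - exp (\<alpha> * 0)) / \<alpha>)"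
    proof (rule integral_abs_le[OF int(1)])
      fix s assume s: "s \<in> {0..real n}"
      have "\<bar>f s\<bar> * \<bar>x s\<bar> \<le> F * (X * exp (\<alpha> * s))"
        using s F by (intro mult_mono f X) auto
      then show "\<bar>f s * x s\<bar> \<le> F * X * exp (\<alpha> * s)" by (simp add: abs_mult mult.assoc)
    qed
    also have "\<dots> \<le> F * X * (exp (\<alpha> * real n) / \<alpha>)"
      using F X(1) \<alpha> by (intro mult_left_mono divide_right_mono) auto
    finally show "\<bar>LINT t:{0..real n}|lborel. f t * x t\<bar> \<le> F * X / \<alpha> * exp (\<alpha> * real n)"
      by (simp add: int(2))
  qed (use F X \<alpha> in auto)
qed

text \<open>The last unit interval alone suffices: on [n - 1, n] with n large, |x t| is at least
  half of |\<xi>| exp(\<alpha> (n - 1)). The shift by 1 is the factor exp(-\<alpha>) in the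
  constant.\<close>

lemma integral_x_square_lower:
  assumes "(discounted \<longlongrightarrow> \<xi>) at_top" "\<xi> \<noteq> 0"
  obtains c where "0 < c" "eventually (\<lambda>n. c * (exp (\<alpha> * real n))\<^sup>2 \<le> (LINT t:{0..real n}|lborel. (x t)\<^sup>2)) sequentially"
proof -
  obtain \<xi>' A where A: "0 \<le> A" "(discounted \<longlongrightarrow> \<xi>') at_top"
      "\<And>t. 0 \<le> t \<Longrightarrow> \<bar>x t - \<xi>' * exp (\<alpha> * t)\<bar> \<le> A * exp (\<alpha> / 2 * t)"
    using discounted_limit by blast
  have "\<xi>' = \<xi>" using tendsto_unique[OF _ A(2) assms(1)] by simp
  note A = A[unfolded this]
  have "((\<lambda>t. A * exp (- (\<alpha> / 2) * t)) \<longlongrightarrow> 0) at_top"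
    using \<alpha> by real_asymp
  then have "eventually (\<lambda>t. A * exp (- (\<alpha> / 2) * t) < \<bar>\<xi>\<bar> / 2) at_top"
    using assms(2) by (intro order_tendstoD) auto
  then obtain t0 where t0: "\<And>t. t0 \<le> t \<Longrightarrow> A * exp (- (\<alpha> / 2) * t) < \<bar>\<xi>\<bar> / 2"
    by (auto simp: eventually_at_top_linorder)
  have low: "(\<xi> / 2 * exp (\<alpha> * t))\<^sup>2 \<le> (x t)\<^sup>2" if t: "max 0 t0 \<le> t" for t
  proof -
    have "A * exp (\<alpha> / 2 * t) = A * exp (- (\<alpha> / 2) * t) * exp (\<alpha> * t)"
      by (simp add: mult.assoc exp_add[symmetric])
    also have "\<dots> \<le> \<bar>\<xi>\<bar> / 2 * exp (\<alpha> * t)"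
      using t0[of t] t by (intro mult_right_mono) auto
    finally have "\<bar>\<xi> / 2 * exp (\<alpha> * t)\<bar> \<le> \<bar>x t\<bar>"
      using A(3)[of t] t abs_mult[of \<xi> "exp (\<alpha> * t)"] by (simp add: abs_mult)
    then show ?thesis by (simp only: abs_le_square_iff)
  qed
  obtain N :: nat where N: "max 0 t0 + 1 \<le> real N" using real_arch_simple by blast
  show thesis
  proof (rule that[of "(\<xi> / 2 * exp (- \<alpha>))\<^sup>2"])
    show "0 < (\<xi> / 2 * exp (- \<alpha>))\<^sup>2" using assms(2) by simp
    have "(\<xi> / 2 * exp (- \<alpha>))\<^sup>2 * (exp (\<alpha> * real n))\<^sup>2 \<le> (LINT t:{0..real n}|lborel. (x t)\<^sup>2)" if "N \<le> n" for n
    proof -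
      have n: "max 0 t0 + 1 \<le> real n" using N that by linarith
      have cont: "continuous_on {a..real n} (\<lambda>t. (x t)\<^sup>2)" if "0 \<le> a" for a
        using that by (intro continuous_intros x_cont')
      have "(\<xi> / 2 * exp (- \<alpha>))\<^sup>2 * (exp (\<alpha> * real n))\<^sup>2 = (\<xi> / 2 * exp (\<alpha> * (real n - 1)))\<^sup>2"
        by (simp add: power_mult_distrib[symmetric] mult.assoc exp_add[symmetric] right_diff_distrib)
      also have "\<dots> = integral {real n - 1..real n} (\<lambda>_. (\<xi> / 2 * exp (\<alpha> * (real n - 1)))\<^sup>2)"
        by simp
      also have "\<dots> \<le> integral {real n - 1..real n} (\<lambda>t. (x t)\<^sup>2)"
      proof (rule integral_le)
        show "(\<lambda>t. (x t)\<^sup>2) integrable_on {real n - 1..real n}"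
          using n by (intro integrable_continuous_real cont) auto
        fix t assume t: "t \<in> {real n - 1..real n}"
        have "\<bar>\<xi> / 2 * exp (\<alpha> * (real n - 1))\<bar> \<le> \<bar>\<xi> / 2 * exp (\<alpha> * t)\<bar>"
          unfolding abs_mult using t \<alpha> by (intro mult_left_mono) auto
        then have "(\<xi> / 2 * exp (\<alpha> * (real n - 1)))\<^sup>2 \<le> (\<xi> / 2 * exp (\<alpha> * t))\<^sup>2"
          by (simp only: abs_le_square_iff)
        also have "\<dots> \<le> (x t)\<^sup>2" using t n by (intro low) auto
        finally show "(\<xi> / 2 * exp (\<alpha> * (real n - 1)))\<^sup>2 \<le> (x t)\<^sup>2" .
      qed (rule integrable_const_ivl)
      also have "\<dots> \<le> integral {0..real n} (\<lambda>t. (x t)\<^sup>2)"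
        using n by (intro integral_subset_le integrable_continuous_real cont) auto
      also have "\<dots> = (LINT t:{0..real n}|lborel. (x t)\<^sup>2)"
        using set_borel_integral_eq_integral(2)[OF borel_integrable_atLeastAtMost'[OF cont[OF order_refl]]] by simp
      finally show ?thesis .
    qed
    then show "eventually (\<lambda>n. (\<xi> / 2 * exp (- \<alpha>))\<^sup>2 * (exp (\<alpha> * real n))\<^sup>2 \<le> (LINT t:{0..real n}|lborel. (x t)\<^sup>2)) sequentially"
      by (auto simp: eventually_sequentially)
  qed
qed

end


text \<open>The terms of the integration by parts formula are bounded separately. Their cancellation would
  save the factor \<open>(1 + n)\<^sup>\<gamma>\<close>, but this factor is harmless because \<open>\<gamma> < 1\<close>.\<close>

lemma (in ou_path_growth) young_integral_growth:
  assumes \<beta>: "1 / 2 < \<beta>" "\<beta> < 1"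
    and hoelder: "\<And>n::nat. \<exists>C \<delta>. 0 < \<delta> \<and> 0 \<le> C \<and> (\<forall>s t. 0 \<le> s \<longrightarrow> s \<le> t \<longrightarrow> t \<le> real n \<longrightarrow> t - s \<le> \<delta>
      \<longrightarrow> \<bar>b t - b s\<bar> \<le> C * (t - s) powr \<beta>)"
  obtains C where "0 \<le> C" "\<And>n. \<bar>young_integral x b 0 (real n)\<bar> \<le> C * (1 + real n) powr \<gamma> * exp (\<alpha> * real n)"
proof -
  obtain X where X: "0 \<le> X" "\<And>t. 0 \<le> t \<Longrightarrow> \<bar>x t\<bar> \<le> X * exp (\<alpha> * t)"
    using x_exp_bound by blast
  define c where "c = 1 + 1 / \<alpha>"
  define C where "C = X * G + \<bar>x 0 * b 0\<bar> + G * (K + \<alpha> * X) / \<alpha> + \<bar>\<sigma>\<bar> * (G\<^sup>2 * c) + \<bar>\<sigma>\<bar> * (b 0)\<^sup>2"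
  have c: "0 < c" using \<alpha> by (simp add: c_def add_pos_pos)
  show thesis
  proof (rule that[of C])
    show "0 \<le> C" using X G K_nonneg \<alpha> c by (simp add: C_def)
    fix n :: nat
    define e where "e = exp (\<alpha> * real n)"
    define p where "p = (1 + real n) powr \<gamma>"
    have e: "1 \<le> e" using \<alpha> by (simp add: e_def)
    have p: "1 \<le> p" using \<gamma> by (auto simp: p_def intro!: ge_one_powr_ge_zero)
    have pe: "1 \<le> p * e" using mult_mono[OF p e] p by linarith
    have p_le: "p \<le> c * e"
    proof -
      have "p \<le> (1 + real n) powr 1" unfolding p_def using \<gamma> by (intro powr_mono) auto
      also have "\<dots> \<le> c * e" using one_plus_le_exp[OF \<alpha>, of "real n"] by (simp add: c_def e_def)
      finally show ?thesis .
    qed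
    have xb: "\<bar>x (real n)\<bar> \<le> X * e" "\<bar>b (real n)\<bar> \<le> G * p"
      using X(2)[of "real n"] growth[of "real n"] by (auto simp: e_def p_def)
    have 1: "\<bar>x (real n) * b (real n)\<bar> \<le> X * G * (p * e)"
    proof -
      have "\<bar>x (real n)\<bar> * \<bar>b (real n)\<bar> \<le> (X * e) * (G * p)"
        using xb by (intro mult_mono) auto
      then show ?thesis by (simp add: abs_mult mult_ac)
    qed
    have 2: "\<bar>integral {0..real n} (\<lambda>s. b s * drift s)\<bar> \<le> G * (K + \<alpha> * X) / \<alpha> * (p * e)"
    proof -
      have "((\<lambda>s. G * p * (K + \<alpha> * X) * exp (\<alpha> * s)) has_integral
          G * p * (K + \<alpha> * X) * ((e - exp (\<alpha> * 0)) / \<alpha>)) {0..real n}"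
        unfolding e_def using \<alpha> by (intro has_integral_mult_right exp_has_integral) auto
      then have "\<bar>integral {0..real n} (\<lambda>s. b s * drift s)\<bar> \<le> G * p * (K + \<alpha> * X) * ((e - exp (\<alpha> * 0)) / \<alpha>)"
      proof (rule integral_abs_le[OF integrable_drift[OF order_refl b_cont'[OF order_refl]]])
        fix s assume s: "s \<in> {0..real n}"
        have "\<bar>b s\<bar> \<le> G * p"
          using growth[of s] s G \<gamma> powr_mono2[of \<gamma> "1 + s" "1 + real n"]
          unfolding p_def by (auto intro: order_trans mult_left_mono)
        moreover have "\<bar>drift s\<bar> \<le> (K + \<alpha> * X) * exp (\<alpha> * s)"
        proof -
          have "\<bar>drift s\<bar> \<le> \<bar>L s\<bar> + \<alpha> * \<bar>x s\<bar>"
            unfolding drift_def using \<alpha> by (intro order_trans[OF abs_triangle_ineq]) (simp add: abs_mult)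
          also have "\<dots> \<le> K * exp (\<alpha> * s) + \<alpha> * (X * exp (\<alpha> * s))"
          proof (intro add_mono mult_left_mono X)
            have "K * 1 \<le> K * exp (\<alpha> * s)" using K_nonneg s \<alpha> by (intro mult_left_mono) auto
            then show "\<bar>L s\<bar> \<le> K * exp (\<alpha> * s)" using L_bound[of s] by linarith
          qed (use s \<alpha> in auto)
          finally show ?thesis by (simp add: algebra_simps)
        qed
        ultimately have "\<bar>b s\<bar> * \<bar>drift s\<bar> \<le> (G * p) * ((K + \<alpha> * X) * exp (\<alpha> * s))"
          using G p by (intro mult_mono) auto
        then show "\<bar>b s * drift s\<bar> \<le> G * p * (K + \<alpha> * X) * exp (\<alpha> * s)"
          by (simp add: abs_mult mult.assoc)
      qed
      also have "\<dots> \<le> G * p * (K + \<alpha> * X) * (e / \<alpha>)"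
        using G p K_nonneg \<alpha> X(1) by (intro mult_left_mono divide_right_mono) auto
      also have "\<dots> = G * (K + \<alpha> * X) / \<alpha> * (p * e)" by simp
      finally show ?thesis .
    qed
    have 3: "(b (real n))\<^sup>2 \<le> G\<^sup>2 * c * (p * e)"
    proof -
      have "(b (real n))\<^sup>2 \<le> (G * p)\<^sup>2"
        using xb(2) by (metis abs_ge_zero power2_abs power_mono)
      also have "\<dots> = G\<^sup>2 * (p * p)" by (simp add: power_mult_distrib power2_eq_square)
      also have "\<dots> \<le> G\<^sup>2 * (p * (c * e))" using p p_le by (intro mult_left_mono) auto
      finally show ?thesis by (simp add: mult_ac)
    qed
    obtain C0 \<delta> where H: "0 < \<delta>" "0 \<le> C0" "\<And>s t. 0 \<le> s \<Longrightarrow> s \<le> t \<Longrightarrow> t \<le> real n \<Longrightarrow> t - s \<le> \<delta> \<Longrightarrow>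
        \<bar>b t - b s\<bar> \<le> C0 * (t - s) powr \<beta>"
      using hoelder[of n] by blast
    have eq: "young_integral x b 0 (real n) = x (real n) * b (real n) - x 0 * b 0
        - integral {0..real n} (\<lambda>s. b s * drift s) - \<sigma> * ((b (real n))\<^sup>2 - (b 0)\<^sup>2) / 2"
      by (rule young_integral_path[OF of_nat_0_le_iff \<beta> H])
    have 4: "\<bar>\<sigma> * ((b (real n))\<^sup>2 - (b 0)\<^sup>2) / 2\<bar> \<le> \<bar>\<sigma>\<bar> * (G\<^sup>2 * c * (p * e)) + \<bar>\<sigma>\<bar> * (b 0)\<^sup>2"
    proof -
      have "\<bar>((b (real n))\<^sup>2 - (b 0)\<^sup>2) / 2\<bar> \<le> (b (real n))\<^sup>2 + (b 0)\<^sup>2"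
      proof -
        have "\<bar>(p - q) / 2\<bar> \<le> p + q" if "0 \<le> p" "0 \<le> q" for p q :: real
          using that by (auto simp: abs_if field_simps)
        then show ?thesis by simp
      qed
      then have "\<bar>((b (real n))\<^sup>2 - (b 0)\<^sup>2) / 2\<bar> \<le> G\<^sup>2 * c * (p * e) + (b 0)\<^sup>2" using 3 by linarith
      then have "\<bar>\<sigma>\<bar> * \<bar>((b (real n))\<^sup>2 - (b 0)\<^sup>2) / 2\<bar> \<le> \<bar>\<sigma>\<bar> * (G\<^sup>2 * c * (p * e) + (b 0)\<^sup>2)"
        by (intro mult_left_mono) auto
      then show ?thesis by (simp add: abs_mult[symmetric] distrib_left)
    qed
    have 5: "\<bar>x 0 * b 0\<bar> \<le> \<bar>x 0 * b 0\<bar> * (p * e)" "\<bar>\<sigma>\<bar> * (b 0)\<^sup>2 \<le> \<bar>\<sigma>\<bar> * (b 0)\<^sup>2 * (p * e)"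
      using pe mult_left_mono[OF pe, of "\<bar>x 0 * b 0\<bar>"] mult_left_mono[OF pe, of "\<bar>\<sigma>\<bar> * (b 0)\<^sup>2"] by simp_all
    have "\<bar>young_integral x b 0 (real n)\<bar> \<le> \<bar>x (real n) * b (real n)\<bar> + \<bar>x 0 * b 0\<bar>
        + \<bar>integral {0..real n} (\<lambda>s. b s * drift s)\<bar> + \<bar>\<sigma> * ((b (real n))\<^sup>2 - (b 0)\<^sup>2) / 2\<bar>"
      unfolding eq by linarith
    also have "\<dots> \<le> X * G * (p * e) + \<bar>x 0 * b 0\<bar> * (p * e) + G * (K + \<alpha> * X) / \<alpha> * (p * e)
        + (\<bar>\<sigma>\<bar> * (G\<^sup>2 * c * (p * e)) + \<bar>\<sigma>\<bar> * (b 0)\<^sup>2 * (p * e))"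
      using 1 2 4 5 by linarith
    also have "\<dots> = C * p * e"
      unfolding C_def by (simp only: distrib_right mult.assoc add.assoc)
    finally show "\<bar>young_integral x b 0 (real n)\<bar> \<le> C * (1 + real n) powr \<gamma> * exp (\<alpha> * real n)"
      by (simp add: e_def p_def)
  qed
qed

section \<open>Size of the error terms\<close>

lemma powr_ratio_limit:
  fixes \<gamma> C :: real
  assumes "\<gamma> < 1"
  shows "(\<lambda>n. C * ((1 + real n) powr \<gamma> / real n)) \<longlonglongrightarrow> 0"
proof -
  have "(\<lambda>n. (1 + real n) powr (\<gamma> - 1) * ((1 + real n) / real n)) \<longlonglongrightarrow> 0 * 1"
    using assms by (intro tendsto_mult; real_asymp)
  moreover have "eventually (\<lambda>n. (1 + real n) powr (\<gamma> - 1) * ((1 + real n) / real n) = (1 + real n) powr \<gamma> / real n) sequentially"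
    using eventually_gt_at_top[of 0] by eventually_elim (simp add: powr_diff)
  ultimately have "(\<lambda>n. (1 + real n) powr \<gamma> / real n) \<longlonglongrightarrow> 0"
    using Lim_transform_eventually by fastforce
  from tendsto_mult_right_zero[OF this] show ?thesis .
qed

text \<open>With p = (1 + n)^\<gamma> and e = exp(\<alpha> n), the denominator n D is at least c
  e^2. Every numerator is shown to be at most a constant times (p / n) e^2, so each quotient is O(p
  / n). Except for the bare w / n, the terms have one or two exponential factors in the
  numerator.\<close>

lemma estimator_error_limits:
  fixes lam w :: "'p::finite \<Rightarrow> nat \<Rightarrow> real" and D Z :: "nat \<Rightarrow> real" and \<alpha> \<gamma> \<sigma> C c C' :: real
  assumes \<alpha>: "0 < \<alpha>" and \<gamma>: "0 < \<gamma>" "\<gamma> < 1" and c: "0 < c" and C: "0 \<le> C" "0 \<le> C'"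
    and lam: "\<And>i n. 1 \<le> n \<Longrightarrow> \<bar>lam i n\<bar> \<le> C * exp (\<alpha> * real n) / real n"
    and w: "\<And>i. eventually (\<lambda>n. \<bar>w i n\<bar> \<le> 2 * real n powr \<gamma>) sequentially"
    and Z: "\<And>n. \<bar>Z n\<bar> \<le> C' * (1 + real n) powr \<gamma> * exp (\<alpha> * real n)"
    and D: "eventually (\<lambda>n. c * (exp (\<alpha> * real n))\<^sup>2 \<le> real n * D n) sequentially"
  shows "(\<lambda>n. \<sigma> * (1 / real n) * (w i n + 1 / D n * (\<Sum>j\<in>UNIV. lam i n * lam j n * w j n) - 1 / D n * lam i n * Z n)) \<longlonglongrightarrow> 0"
    and "(\<lambda>n. - \<sigma> * (1 / (real n * D n)) * ((\<Sum>i\<in>UNIV. lam i n * w i n) - Z n)) \<longlonglongrightarrow> 0"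
proof -
  define p where "p n = (1 + real n) powr \<gamma>" for n :: nat
  define e where "e n = exp (\<alpha> * real n)" for n :: nat
  have e1: "1 \<le> e n" for n using \<alpha> by (simp add: e_def)
  then have e0: "0 < e n" for n using less_le_trans[OF zero_less_one] by blast
  have e_nonneg: "0 \<le> e n" for n using e0 by (rule less_imp_le)
  have en: "\<alpha> * real n \<le> e n" for n using exp_ge_add_one_self[of "\<alpha> * real n"] unfolding e_def by linarith
  have p0: "0 \<le> p n" for n by (simp add: p_def)
  have w': "eventually (\<lambda>n. 1 \<le> n \<and> \<bar>w i n\<bar> \<le> 2 * p n) sequentially" for i
    using w[of i] eventually_ge_at_top[of 1]
  proof eventually_elim
    case (elim n)
    have "real n powr \<gamma> \<le> p n" unfolding p_def using \<gamma> by (intro powr_mono2) auto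
    with elim show ?case by simp
  qed
  have lam': "\<bar>lam i n\<bar> \<le> C * e n / real n" if "1 \<le> n" for i n
    using lam[OF that] by (simp add: e_def)
  have Z': "\<bar>Z n\<bar> \<le> C' * p n * e n" for n
    using Z by (simp add: e_def p_def)
  have D': "eventually (\<lambda>n. c * (e n)\<^sup>2 \<le> real n * D n) sequentially"
    using D by (simp add: e_def)
  have lim: "f \<longlonglongrightarrow> 0" if "eventually (\<lambda>n. \<bar>f n\<bar> \<le> k * (p n / real n)) sequentially" for f :: "nat \<Rightarrow> real" and k
    using that by (intro Lim_null_comparison[OF _ powr_ratio_limit[OF \<gamma>(2), of k]]) (simp add: p_def)
  have quot: "\<bar>y / (real n * D n)\<bar> \<le> k * (p n / real n)"
    if "c * (e n)\<^sup>2 \<le> real n * D n" "\<bar>y\<bar> \<le> k * (p n / real n) * (c * (e n)\<^sup>2)" "0 \<le> k" for y n k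
  proof -
    have pos: "0 < c * (e n)\<^sup>2" using c e0[of n] by simp
    have "\<bar>y\<bar> \<le> k * (p n / real n) * (real n * D n)"
      by (rule order_trans[OF that(2)])
        (intro mult_left_mono that(1) mult_nonneg_nonneg divide_nonneg_nonneg that(3) p0 of_nat_0_le_iff)
    then show ?thesis
      using that(1) pos by (simp add: abs_divide pos_divide_le_eq)
  qed
  have t1: "(\<lambda>n. w i n / real n) \<longlonglongrightarrow> 0" for i
  proof (rule lim)
    show "eventually (\<lambda>n. \<bar>w i n / real n\<bar> \<le> 2 * (p n / real n)) sequentially"
      using w'[of i] by eventually_elim (simp add: abs_divide divide_right_mono)
  qed
  have t2: "(\<lambda>n. (lam i n * lam j n * w j n) / (real n * D n)) \<longlonglongrightarrow> 0" for i j
  proof (rule lim)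
    show "eventually (\<lambda>n. \<bar>(lam i n * lam j n * w j n) / (real n * D n)\<bar> \<le> (2 * C\<^sup>2 / c) * (p n / real n)) sequentially"
      using w'[of j] D'
    proof eventually_elim
      case (elim n)
      have n: "1 \<le> real n" using elim by simp
      have "\<bar>lam i n\<bar> * \<bar>lam j n\<bar> * \<bar>w j n\<bar> \<le> (C * e n / real n) * (C * e n / real n) * (2 * p n)"
        using elim C e_nonneg by (intro mult_mono lam') (auto intro!: mult_nonneg_nonneg divide_nonneg_nonneg)
      also have "\<dots> = (2 * C\<^sup>2 * (p n / real n) * (e n)\<^sup>2) * (1 / real n)"
        by (simp add: power2_eq_square)
      also have "\<dots> \<le> (2 * C\<^sup>2 * (p n / real n) * (e n)\<^sup>2) * 1"
        using n p0 C by (intro mult_left_mono) auto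
      finally show ?case
        using c C elim by (intro quot) (auto simp: abs_mult)
    qed
  qed
  have t3: "(\<lambda>n. (lam i n * Z n) / (real n * D n)) \<longlonglongrightarrow> 0" for i
  proof (rule lim)
    show "eventually (\<lambda>n. \<bar>(lam i n * Z n) / (real n * D n)\<bar> \<le> (C * C' / c) * (p n / real n)) sequentially"
      using D' eventually_ge_at_top[of 1]
    proof eventually_elim
      case (elim n)
      have "\<bar>lam i n\<bar> * \<bar>Z n\<bar> \<le> (C * e n / real n) * (C' * p n * e n)"
        using elim C e_nonneg by (intro mult_mono lam' Z') (auto intro!: mult_nonneg_nonneg divide_nonneg_nonneg)
      also have "\<dots> = C * C' * (p n / real n) * (e n)\<^sup>2"
        by (simp add: power2_eq_square)
      finally show ?case
        using c C elim by (intro quot) (auto simp: abs_mult)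
    qed
  qed
  have t4: "(\<lambda>n. (lam i n * w i n) / (real n * D n)) \<longlonglongrightarrow> 0" for i
  proof (rule lim)
    show "eventually (\<lambda>n. \<bar>(lam i n * w i n) / (real n * D n)\<bar> \<le> (2 * C / c) * (p n / real n)) sequentially"
      using w'[of i] D'
    proof eventually_elim
      case (elim n)
      have "\<bar>lam i n\<bar> * \<bar>w i n\<bar> \<le> (C * e n / real n) * (2 * p n)"
        using elim C e_nonneg by (intro mult_mono lam') (auto intro!: mult_nonneg_nonneg divide_nonneg_nonneg)
      also have "\<dots> = (2 * C * (p n / real n)) * e n" by simp
      also have "\<dots> \<le> (2 * C * (p n / real n)) * (e n)\<^sup>2"
        using e1[of n] C p0 by (intro mult_left_mono self_le_power) auto
      finally show ?case
        using c C elim by (intro quot) (auto simp: abs_mult)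
    qed
  qed
  have t5: "(\<lambda>n. Z n / (real n * D n)) \<longlonglongrightarrow> 0"
  proof (rule lim)
    show "eventually (\<lambda>n. \<bar>Z n / (real n * D n)\<bar> \<le> (C' / (\<alpha> * c)) * (p n / real n)) sequentially"
      using D' eventually_ge_at_top[of 1]
    proof eventually_elim
      case (elim n)
      have n: "0 < real n" using elim by simp
      \<comment> \<open>This term has no factor 1 / n of its own. It carries only one exponential,
        and the spare one supplies the factor through \<alpha> n \<le> e n.\<close>
      have "e n \<le> (e n)\<^sup>2 / (\<alpha> * real n)"
        using mult_right_mono[OF en[of n], of "e n"] e0[of n] \<alpha> n
        by (simp add: pos_le_divide_eq power2_eq_square mult_ac)
      then have "C' * p n * e n \<le> C' * p n * ((e n)\<^sup>2 / (\<alpha> * real n))"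
        using C p0 by (intro mult_left_mono) auto
      also have "\<dots> = C' / \<alpha> * (p n / real n) * (e n)\<^sup>2" by simp
      finally have "\<bar>Z n\<bar> \<le> C' / \<alpha> * (p n / real n) * (e n)\<^sup>2"
        using Z'[of n] by linarith
      then show ?case
        using c C \<alpha> elim by (intro quot) auto
    qed
  qed
  have eq: "\<sigma> * (1 / real n) * (w i n + 1 / D n * (\<Sum>j\<in>UNIV. lam i n * lam j n * w j n) - 1 / D n * lam i n * Z n)
      = \<sigma> * (w i n / real n + (\<Sum>j\<in>UNIV. (lam i n * lam j n * w j n) / (real n * D n)) - (lam i n * Z n) / (real n * D n))" for n
    unfolding sum_divide_distrib[symmetric] by (simp add: add_divide_distrib diff_divide_distrib algebra_simps)
  have "(\<lambda>n. \<sigma> * (w i n / real n + (\<Sum>j\<in>UNIV. (lam i n * lam j n * w j n) / (real n * D n)) - (lam i n * Z n) / (real n * D n)))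
      \<longlonglongrightarrow> \<sigma> * (0 + (\<Sum>j\<in>(UNIV::'p set). 0) - 0)"
    by (intro tendsto_intros t1 t2 t3)
  then show "(\<lambda>n. \<sigma> * (1 / real n) * (w i n + 1 / D n * (\<Sum>j\<in>UNIV. lam i n * lam j n * w j n) - 1 / D n * lam i n * Z n)) \<longlonglongrightarrow> 0"
    unfolding eq by simp
  have eq': "- \<sigma> * (1 / (real n * D n)) * ((\<Sum>i\<in>UNIV. lam i n * w i n) - Z n)
      = - \<sigma> * ((\<Sum>i\<in>UNIV. (lam i n * w i n) / (real n * D n)) - Z n / (real n * D n))" for n
    unfolding sum_divide_distrib[symmetric] by (simp add: diff_divide_distrib algebra_simps)
  have "(\<lambda>n. - \<sigma> * ((\<Sum>i\<in>UNIV. (lam i n * w i n) / (real n * D n)) - Z n / (real n * D n)))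
      \<longlonglongrightarrow> - \<sigma> * ((\<Sum>i\<in>(UNIV::'p set). 0) - 0)"
    by (intro tendsto_intros t4 t5)
  then show "(\<lambda>n. - \<sigma> * (1 / (real n * D n)) * ((\<Sum>i\<in>UNIV. lam i n * w i n) - Z n)) \<longlonglongrightarrow> 0"
    unfolding eq' by simp
qed

subsection \<open>The normal equations\<close>

lemma sum_option:
  "(\<Sum>k\<in>UNIV. f k) = f None + (\<Sum>i\<in>UNIV. f (Some (i::'p::finite)))"
  by (simp add: UNIV_option_conv sum.reindex)

lemma Q_mat_mult:
  fixes y :: "real ^ ('p::finite) option"
  shows "(Q_mat \<phi> x n *v y) $ Some i = real n * y $ Some i + (LINT t:{0..real n}|lborel. \<phi> i t * x t) * y $ None"
    and "(Q_mat \<phi> x n *v y) $ None = (\<Sum>j\<in>UNIV. (LINT t:{0..real n}|lborel. \<phi> j t * x t) * y $ Some j)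
      + (LINT t:{0..real n}|lborel. (x t)\<^sup>2) * y $ None"
proof -
  have "(\<Sum>j\<in>UNIV. (if i = j then real n else 0) * y $ Some j) = real n * y $ Some i"
    by (subst sum.remove[of _ i]) auto
  then show "(Q_mat \<phi> x n *v y) $ Some i = real n * y $ Some i + (LINT t:{0..real n}|lborel. \<phi> i t * x t) * y $ None"
    by (simp add: matrix_vector_mult_def Q_mat_def sum_option)
  show "(Q_mat \<phi> x n *v y) $ None = (\<Sum>j\<in>UNIV. (LINT t:{0..real n}|lborel. \<phi> j t * x t) * y $ Some j)
      + (LINT t:{0..real n}|lborel. (x t)\<^sup>2) * y $ None"
    by (simp add: matrix_vector_mult_def Q_mat_def sum_option)
qed

text \<open>Block elimination: the first p rows of Q y = 0 force y_i = -\<Lambda>_i y_None, and the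
  last row then reads n D y_None = 0. Thus n D is the Schur complement of the block n E_p.\<close>

lemma Q_mat_solve:
  fixes \<phi> :: "'p::finite \<Rightarrow> real \<Rightarrow> real" and z :: "real ^ 'p option"
  assumes n: "1 \<le> n" and D: "Dn \<phi> x n \<noteq> 0"
  shows "matrix_inv (Q_mat \<phi> x n) *v (Q_mat \<phi> x n *v z) = z"
proof -
  let ?Q = "Q_mat \<phi> x n"
  let ?a = "\<lambda>i. LINT t:{0..real n}|lborel. \<phi> i t * x t"
  let ?b = "LINT t:{0..real n}|lborel. (x t)\<^sup>2"
  have n0: "real n \<noteq> 0" using n by simp
  have a: "?a i = real n * Lam \<phi> x n i" for i
    using n0 by (simp add: Lam_def)
  have b: "?b = real n * (Dn \<phi> x n + (\<Sum>i\<in>UNIV. (Lam \<phi> x n i)\<^sup>2))"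
    using n0 by (simp add: Dn_def)
  have "y = 0" if y: "?Q *v y = 0" for y
  proof -
    have yi: "y $ Some i = - Lam \<phi> x n i * y $ None" for i
    proof -
      have "(?Q *v y) $ Some i = 0" using y by simp
      then have "real n * (y $ Some i + Lam \<phi> x n i * y $ None) = 0"
        unfolding Q_mat_mult a by (simp add: distrib_left mult.assoc)
      then show ?thesis using n0 by simp
    qed
    have "(?Q *v y) $ None = 0" using y by simp
    then have "real n * (Dn \<phi> x n * y $ None) = 0"
      unfolding Q_mat_mult a b yi
      by (simp add: sum_negf sum_distrib_left sum_distrib_right power2_eq_square algebra_simps)
    then have y0: "y $ None = 0" using n0 D by simp
    show "y = 0"
      unfolding vec_eq_iff
    proof
      fix k show "y $ k = 0 $ k"
        using y0 yi by (cases k) auto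
    qed
  qed
  then have "\<exists>P. P ** ?Q = mat 1"
    using matrix_left_invertible_ker[of ?Q] by blast
  then have "invertible ?Q"
    by (simp add: invertible_left_inverse)
  then have "matrix_inv ?Q ** ?Q = mat 1"
    unfolding invertible_def matrix_inv_def by (rule someI2_ex) blast
  then show ?thesis
    by (simp add: matrix_vector_mul_assoc)
qed

lemma set_integrable_bounded:
  fixes f :: "real \<Rightarrow> real"
  assumes "f \<in> borel_measurable borel" "\<And>s. \<bar>f s\<bar> \<le> K"
  shows "set_integrable lborel {a..b} f"
  using set_integrable_bounded_continuous[OF assms, of a b "\<lambda>_. 1"] by simp

locale seasonal_path = ou_path +
  fixes \<phi> :: "'p::finite \<Rightarrow> real \<Rightarrow> real" and \<mu> :: "'p \<Rightarrow> real" and F :: real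
  assumes \<phi>_measurable [measurable]: "\<And>i. \<phi> i \<in> borel_measurable borel"
    and \<phi>_bound: "\<And>i s. \<bar>\<phi> i s\<bar> \<le> F"
    and \<phi>_periodic: "\<And>i t. \<phi> i (t + 1) = \<phi> i t"
    and \<phi>_orthonormal: "\<And>i j. (LINT t:{0..1}|lborel. \<phi> i t * \<phi> j t) = (if i = j then 1 else 0)"
    and L_eq: "L = seasonal_mean \<mu> \<phi>"
begin

lemma \<phi>_\<phi>_set_integrable: "set_integrable lborel {a..c} (\<lambda>t. \<phi> i t * \<phi> j t)"
proof (rule set_integrable_bounded)
  show "\<bar>\<phi> i s * \<phi> j s\<bar> \<le> F * F" for s
    unfolding abs_mult using \<phi>_bound by (intro mult_mono) (auto intro: order_trans[OF abs_ge_zero])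
qed measurable

lemma \<phi>_x_set_integrable: "set_integrable lborel {0..c} (\<lambda>t. \<phi> i t * x t)"
  by (intro set_integrable_bounded_continuous[OF \<phi>_measurable \<phi>_bound] x_cont') auto

lemma x_x_set_integrable: "set_integrable lborel {0..c} (\<lambda>t. (x t)\<^sup>2)"
  by (intro borel_integrable_atLeastAtMost' continuous_intros x_cont') auto

lemmas \<phi>_\<phi>_integrable = set_borel_integral_eq_integral[OF \<phi>_\<phi>_set_integrable]
lemmas \<phi>_x_integrable = set_borel_integral_eq_integral[OF \<phi>_x_set_integrable]
lemmas x_x_integrable = set_borel_integral_eq_integral[OF x_x_set_integrable]

lemma \<phi>_shift: "\<phi> i (real n + t) = \<phi> i t"
proof (induction n)
  case (Suc n)
  then show ?case using \<phi>_periodic[of i "real n + t"] by (simp add: add_ac)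
qed simp

text \<open>Periodicity carries the orthonormality relations from [0, 1] to each of the n unit
  intervals.\<close>

lemma orthogonality: "integral {0..real n} (\<lambda>t. \<phi> i t * \<phi> j t) = (if i = j then real n else 0)"
proof (induction n)
  case (Suc n)
  let ?f = "\<lambda>t. \<phi> i t * \<phi> j t"
  have "(LINT t:{real n..real n + 1}|lborel. ?f t) = (LINT t:{0..1}|lborel. ?f t)"
  proof -
    have "(LINT t:{real n..real n + 1}|lborel. ?f t)
        = (\<integral>t. indicator {real n..real n + 1} (real n + 1 * t) *\<^sub>R ?f (real n + 1 * t) \<partial>lborel)"
      unfolding set_lebesgue_integral_def
      using lborel_integral_real_affine[of 1 "\<lambda>t. indicator {real n..real n + 1} t *\<^sub>R ?f t" "real n"] by simp
    also have "\<dots> = (LINT t:{0..1}|lborel. ?f t)"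
      unfolding set_lebesgue_integral_def
      by (intro Bochner_Integration.integral_cong) (auto simp: \<phi>_shift indicator_def)
    finally show ?thesis .
  qed
  then have "integral {real n..real n + 1} ?f = (if i = j then 1 else 0)"
    using \<phi>_orthonormal by (simp add: \<phi>_\<phi>_integrable(2))
  moreover have "integral {0..real n} ?f + integral {real n..real n + 1} ?f = integral {0..real n + 1} ?f"
    by (intro Henstock_Kurzweil_Integration.integral_combine \<phi>_\<phi>_integrable(1)) auto
  ultimately show ?case using Suc by (cases "i = j") (simp_all add: add.commute)
qed simp

text \<open>Inserting dX = (L + \<alpha> X) dt + \<sigma> dB yields the normal equations with noise;
  orthogonality produces the diagonal block of Q.\<close>

lemma P_vec_eq:
  "P_vec \<phi> L \<alpha> \<sigma> x b w n = Q_mat \<phi> x n *v (\<chi> k. case k of Some i \<Rightarrow> \<mu> i | None \<Rightarrow> \<alpha>)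
    + \<sigma> *\<^sub>R (\<chi> k. case k of Some i \<Rightarrow> w i | None \<Rightarrow> young_integral x b 0 (real n))"
proof -
  have lin: "(LINT t:{0..real n}|lborel. g t * (L t + \<alpha> * x t))
      = (\<Sum>j\<in>UNIV. \<mu> j * integral {0..real n} (\<lambda>t. \<phi> j t * g t)) + \<alpha> * integral {0..real n} (\<lambda>t. g t * x t)"
    if g: "\<And>j. set_integrable lborel {0..real n} (\<lambda>t. \<phi> j t * g t)"
      "set_integrable lborel {0..real n} (\<lambda>t. g t * x t)" for g
  proof -
    have eq: "g t * (L t + \<alpha> * x t) = (\<Sum>j\<in>UNIV. \<mu> j * (\<phi> j t * g t)) + \<alpha> * (g t * x t)" for t
      by (simp add: L_eq seasonal_mean_def algebra_simps sum_distrib_left)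
    have g': "(\<lambda>t. \<phi> j t * g t) integrable_on {0..real n}" "(\<lambda>t. g t * x t) integrable_on {0..real n}" for j
      using set_borel_integral_eq_integral(1)[OF g(1)] set_borel_integral_eq_integral(1)[OF g(2)] by auto
    have "set_integrable lborel {0..real n} (\<lambda>t. (\<Sum>j\<in>UNIV. \<mu> j * (\<phi> j t * g t)) + \<alpha> * (g t * x t))"
      using g unfolding set_integrable_def
      by (simp add: algebra_simps sum_distrib_left Bochner_Integration.integrable_sum)
    then have "(LINT t:{0..real n}|lborel. g t * (L t + \<alpha> * x t))
      = integral {0..real n} (\<lambda>t. (\<Sum>j\<in>UNIV. \<mu> j * (\<phi> j t * g t)) + \<alpha> * (g t * x t))"
      unfolding eq by (rule set_borel_integral_eq_integral(2))
    also have "\<dots> = (\<Sum>j\<in>UNIV. \<mu> j * integral {0..real n} (\<lambda>t. \<phi> j t * g t)) + \<alpha> * integral {0..real n} (\<lambda>t. g t * x t)"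
      using g' by (simp add: Henstock_Kurzweil_Integration.integral_add Henstock_Kurzweil_Integration.integral_sum
          integrable_sum integrable_on_mult_right)
    finally show ?thesis .
  qed
  have Some: "P_vec \<phi> L \<alpha> \<sigma> x b w n $ Some i = real n * \<mu> i + (LINT t:{0..real n}|lborel. \<phi> i t * x t) * \<alpha> + \<sigma> * w i" for i
  proof -
    have "(LINT t:{0..real n}|lborel. \<phi> i t * (L t + \<alpha> * x t)) = real n * \<mu> i + (LINT t:{0..real n}|lborel. \<phi> i t * x t) * \<alpha>"
      unfolding lin[OF \<phi>_\<phi>_set_integrable \<phi>_x_set_integrable] orthogonality \<phi>_x_integrable(2)
      by (simp add: if_distrib[of "\<lambda>y. _ * y"] sum.delta cong: if_cong)
    then show ?thesis by (simp add: P_vec_def dX_integral_def)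
  qed
  have None: "P_vec \<phi> L \<alpha> \<sigma> x b w n $ None = (\<Sum>j\<in>UNIV. (LINT t:{0..real n}|lborel. \<phi> j t * x t) * \<mu> j)
      + (LINT t:{0..real n}|lborel. (x t)\<^sup>2) * \<alpha> + \<sigma> * young_integral x b 0 (real n)"
    using lin[OF \<phi>_x_set_integrable x_x_set_integrable[unfolded power2_eq_square]]
    unfolding P_vec_def dX_integral_def \<phi>_x_integrable(2) power2_eq_square x_x_integrable(2)[unfolded power2_eq_square]
    by (simp add: mult.commute)
  show ?thesis
    unfolding vec_eq_iff
  proof
    fix k show "P_vec \<phi> L \<alpha> \<sigma> x b w n $ k = (Q_mat \<phi> x n *v (\<chi> k. case k of Some i \<Rightarrow> \<mu> i | None \<Rightarrow> \<alpha>)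
      + \<sigma> *\<^sub>R (\<chi> k. case k of Some i \<Rightarrow> w i | None \<Rightarrow> young_integral x b 0 (real n))) $ k"
      by (cases k) (simp_all add: Q_mat_mult Some None)
  qed
qed

text \<open>By the normal equations the error \<delta> solves Q \<delta> = \<sigma> (w, Z). The
  solution is written down by block elimination and verified row by row; invertibility of Q then
  identifies it.\<close>

lemma theta_hat_error:
  assumes n: "1 \<le> n" and D: "Dn \<phi> x n \<noteq> 0"
  shows "theta_hat \<phi> L \<alpha> \<sigma> x b w n $ Some i - \<mu> i = \<sigma> * (1 / real n) *
      (w i + 1 / Dn \<phi> x n * (\<Sum>j\<in>UNIV. Lam \<phi> x n i * Lam \<phi> x n j * w j)
        - 1 / Dn \<phi> x n * Lam \<phi> x n i * young_integral x b 0 (real n))"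
    and "theta_hat \<phi> L \<alpha> \<sigma> x b w n $ None - \<alpha> = - \<sigma> * (1 / (real n * Dn \<phi> x n)) *
      ((\<Sum>i\<in>UNIV. Lam \<phi> x n i * w i) - young_integral x b 0 (real n))"
proof -
  let ?D = "Dn \<phi> x n" and ?l = "Lam \<phi> x n" and ?Z = "young_integral x b 0 (real n)"
  define S where "S = (\<Sum>j\<in>UNIV. ?l j * w j)"
  have n0: "real n \<noteq> 0" using n by simp
  have a: "(LINT t:{0..real n}|lborel. \<phi> i t * x t) = real n * ?l i" for i
    using n0 by (simp add: Lam_def)
  have b: "(LINT t:{0..real n}|lborel. (x t)\<^sup>2) = real n * (?D + (\<Sum>i\<in>UNIV. (?l i)\<^sup>2))"
    using n0 by (simp add: Dn_def)
  \<comment> \<open>The solution of the Schur complement equation n D d = \<sigma> (Z - S).\<close>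
  define d where "d = \<sigma> / (real n * ?D) * (?Z - S)"
  have d: "real n * ?D * d = \<sigma> * (?Z - S)" using n0 D by (simp add: d_def)
  define \<delta> :: "real ^ 'p option" where
    "\<delta> = (\<chi> k. case k of Some i \<Rightarrow> \<sigma> * w i / real n - ?l i * d | None \<Rightarrow> d)"
  define \<theta> :: "real ^ 'p option" where "\<theta> = (\<chi> k. case k of Some i \<Rightarrow> \<mu> i | None \<Rightarrow> \<alpha>)"
  have "Q_mat \<phi> x n *v \<delta> = \<sigma> *\<^sub>R (\<chi> k. case k of Some i \<Rightarrow> w i | None \<Rightarrow> ?Z)"
    unfolding vec_eq_iff
  proof
    fix k
    show "(Q_mat \<phi> x n *v \<delta>) $ k = (\<sigma> *\<^sub>R (\<chi> k. case k of Some i \<Rightarrow> w i | None \<Rightarrow> ?Z)) $ k"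
    proof (cases k)
      case None
      have "(\<Sum>j\<in>UNIV. real n * ?l j * (\<sigma> * w j / real n - ?l j * d)) = \<sigma> * S - real n * (\<Sum>j\<in>UNIV. (?l j)\<^sup>2) * d"
        using n0 by (simp add: S_def right_diff_distrib sum_subtractf sum_distrib_left sum_distrib_right power2_eq_square mult_ac)
      then show ?thesis
        using d unfolding None Q_mat_mult a b by (simp add: \<delta>_def algebra_simps)
    next
      case (Some i)
      then show ?thesis using n0 unfolding Some Q_mat_mult a by (simp add: \<delta>_def algebra_simps)
    qed
  qed
  then have "P_vec \<phi> L \<alpha> \<sigma> x b w n = Q_mat \<phi> x n *v (\<theta> + \<delta>)"
    unfolding P_vec_eq \<theta>_def by (simp add: matrix_vector_right_distrib)
  then have th: "theta_hat \<phi> L \<alpha> \<sigma> x b w n = \<theta> + \<delta>"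
    using Q_mat_solve[OF n D] by (simp add: theta_hat_def)
  show "theta_hat \<phi> L \<alpha> \<sigma> x b w n $ None - \<alpha> = - \<sigma> * (1 / (real n * ?D)) * ((\<Sum>i\<in>UNIV. ?l i * w i) - ?Z)"
  proof -
    have "\<sigma> / y * (?Z - S) = - \<sigma> * (1 / y) * (S - ?Z)" for y
      by (simp add: right_diff_distrib diff_divide_distrib)
    then show ?thesis
      unfolding th S_def[symmetric] by (simp add: \<theta>_def \<delta>_def d_def)
  qed
  have "(\<Sum>j\<in>UNIV. ?l i * ?l j * w j) = ?l i * S"
    by (simp add: S_def sum_distrib_left mult.assoc)
  moreover have "\<sigma> * w i / real n - ?l i * d = \<sigma> * (1 / real n) * (w i + 1 / ?D * (?l i * S) - 1 / ?D * ?l i * ?Z)"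
    unfolding d_def by (simp add: algebra_simps add_divide_distrib diff_divide_distrib)
  ultimately show "theta_hat \<phi> L \<alpha> \<sigma> x b w n $ Some i - \<mu> i = \<sigma> * (1 / real n) *
      (w i + 1 / ?D * (\<Sum>j\<in>UNIV. ?l i * ?l j * w j) - 1 / ?D * ?l i * ?Z)"
    unfolding th by (simp add: \<theta>_def \<delta>_def)
qed

text \<open>By orthogonality \<open>Lam\<close> gives the Fourier coefficients of x on [0, n], and n
  D is the squared L2 distance from x to the span of the \<phi>_i, the defect in Bessel's
  inequality. If it vanishes, x agrees with its projection almost everywhere, in particular on
  [0, 1].\<close>

lemma Dn_eq_0_imp:
  assumes n: "1 \<le> n" and D: "Dn \<phi> x n = 0"
  obtains l where "AE t in lborel. t \<in> {0..1} \<longrightarrow> x t = (\<Sum>i\<in>UNIV. l i * \<phi> i t)"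
proof -
  let ?l = "Lam \<phi> x n"
  let ?r = "\<lambda>t. (x t - (\<Sum>i\<in>UNIV. ?l i * \<phi> i t))\<^sup>2"
  have n0: "real n \<noteq> 0" using n by simp
  have eq: "?r t = (x t)\<^sup>2 - (\<Sum>i\<in>UNIV. 2 * ?l i * (\<phi> i t * x t))
      + (\<Sum>i\<in>UNIV. \<Sum>j\<in>UNIV. ?l i * ?l j * (\<phi> i t * \<phi> j t))" for t
  proof -
    define s where "s = (\<Sum>i\<in>UNIV. ?l i * \<phi> i t)"
    have 1: "(\<Sum>i\<in>UNIV. 2 * ?l i * (\<phi> i t * x t)) = 2 * s * x t"
      by (simp add: s_def sum_distrib_left sum_distrib_right mult_ac)
    have 2: "(\<Sum>i\<in>UNIV. \<Sum>j\<in>UNIV. ?l i * ?l j * (\<phi> i t * \<phi> j t)) = s * s"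
      by (simp add: s_def sum_product mult_ac)
    show ?thesis
      unfolding 1 2 s_def[symmetric] by (simp add: power2_eq_square algebra_simps)
  qed
  have int: "set_integrable lborel {0..real n} ?r"
  proof -
    have sum: "set_integrable lborel {0..real n} (\<lambda>t. \<Sum>i\<in>I. f i t)"
      if "\<And>i. set_integrable lborel {0..real n} (f i)" for f :: "'p \<Rightarrow> real \<Rightarrow> real" and I
      using that unfolding set_integrable_def scaleR_sum_right by (intro Bochner_Integration.integrable_sum)
    show ?thesis
      unfolding eq
      by (intro set_integral_add(1) set_integral_diff(1) sum set_integrable_mult_right
          x_x_set_integrable \<phi>_x_set_integrable \<phi>_\<phi>_set_integrable)
  qed
  have "integral {0..real n} ?r = integral {0..real n} (\<lambda>t. (x t)\<^sup>2)
      - (\<Sum>i\<in>UNIV. 2 * ?l i * integral {0..real n} (\<lambda>t. \<phi> i t * x t))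
      + (\<Sum>i\<in>UNIV. \<Sum>j\<in>UNIV. ?l i * ?l j * integral {0..real n} (\<lambda>t. \<phi> i t * \<phi> j t))"
    unfolding eq
    by (simp add: Henstock_Kurzweil_Integration.integral_add Henstock_Kurzweil_Integration.integral_diff
        Henstock_Kurzweil_Integration.integral_sum integrable_sum integrable_on_mult_right integrable_diff
        x_x_integrable(1) \<phi>_x_integrable(1) \<phi>_\<phi>_integrable(1))
  also have "\<dots> = real n * Dn \<phi> x n"
  proof -
    have "integral {0..real n} (\<lambda>t. \<phi> i t * x t) = real n * ?l i" for i
      using n0 by (simp add: Lam_def \<phi>_x_integrable(2))
    moreover have "integral {0..real n} (\<lambda>t. (x t)\<^sup>2) = real n * (Dn \<phi> x n + (\<Sum>i\<in>UNIV. (?l i)\<^sup>2))"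
      using n0 by (simp add: Dn_def x_x_integrable(2))
    ultimately show ?thesis
      unfolding orthogonality
      by (simp add: if_distrib[of "\<lambda>y. _ * y"] sum.delta power2_eq_square sum_distrib_left algebra_simps
          sum.distrib[symmetric] cong: if_cong)
  qed
  finally have "(LINT t:{0..real n}|lborel. ?r t) = 0"
    using D by (simp add: set_borel_integral_eq_integral(2)[OF int])
  then have "AE t in lborel. indicator {0..real n} t *\<^sub>R ?r t = 0"
    using int unfolding set_integrable_def set_lebesgue_integral_def
    by (subst (asm) integral_nonneg_eq_0_iff_AE) auto
  then have "AE t in lborel. t \<in> {0..1} \<longrightarrow> x t = (\<Sum>i\<in>UNIV. ?l i * \<phi> i t)"
    by eventually_elim (use n in \<open>auto simp: indicator_def split: if_splits\<close>)
  then show thesis by (rule that)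
qed

end

subsection \<open>Nondegeneracy on the unit interval\<close>

lemma powr_correlation_small:
  fixes H \<eta> :: real
  assumes "0 < H" "H < 1" "0 < \<eta>"
  obtains q where "0 < q" "q < 1" "(q powr H + 2 * q powr (1 - H)) / 2 \<le> \<eta>"
proof -
  have "((\<lambda>q. (q powr H + 2 * q powr (1 - H)) / 2) \<longlongrightarrow> 0) (at_right 0)"
  proof -
    have *: "((\<lambda>q. q powr h) \<longlongrightarrow> 0) (at_right 0)" if "0 < h" for h :: real
      using that by real_asymp
    have "((\<lambda>q. (q powr H + 2 * q powr (1 - H)) / 2) \<longlongrightarrow> (0 + 2 * 0) / 2) (at_right 0)"
      using assms by (intro tendsto_intros *) auto
    then show ?thesis by simp
  qed
  then have "eventually (\<lambda>q. (q powr H + 2 * q powr (1 - H)) / 2 < \<eta>) (at_right 0)"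
    using assms(3) by (rule order_tendstoD)
  moreover have "eventually (\<lambda>q. q \<in> {0<..<1::real}) (at_right 0)"
    by (rule eventually_at_rightI[of 0 1]) auto
  ultimately have "eventually (\<lambda>q. (q powr H + 2 * q powr (1 - H)) / 2 < \<eta> \<and> q \<in> {0<..<1::real}) (at_right 0)"
    by (rule eventually_conj)
  then obtain q :: real where "(q powr H + 2 * q powr (1 - H)) / 2 < \<eta>" "q \<in> {0<..<1}"
    using eventually_happens'[of "at_right (0::real)"] by auto
  then show thesis using that[of q] by auto
qed

text \<open>With r = s / t the normalised covariance is (1 + r^(2H) - (1 - r)^(2H)) / (2 r^H). The
  bound 1 - 2r \<le> (1 - r)^2 \<le> (1 - r)^(2H) makes it at most (r^H + 2 r^(1-H)) / 2, which
  increases with r and tends to 0 as r does.\<close>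

lemma fbm_cov_separated:
  assumes H: "1 / 2 < H" "H < 1" and q: "0 < q" "q < 1" and st: "0 < s" "s \<le> q * t"
  shows "\<bar>fbm_cov H t s\<bar> \<le> (q powr H + 2 * q powr (1 - H)) / 2 * (t powr H * s powr H)"
proof -
  have "0 < q * t" using st by linarith
  then have t: "0 < t" using q by (simp add: zero_less_mult_iff)
  define r where "r = s / t"
  have r: "0 < r" "r \<le> q" using st t by (simp_all add: r_def field_simps)
  have s: "s = r * t" using t by (simp add: r_def)
  have r1: "r < 1" using r q by linarith
  have bern: "1 - 2 * r \<le> (1 - r) powr (2 * H)"
  proof -
    have "1 - 2 * r \<le> (1 - r)\<^sup>2" by (simp add: power2_eq_square algebra_simps)
    also have "\<dots> = (1 - r) powr 2" using r1 by simp
    also have "\<dots> \<le> (1 - r) powr (2 * H)"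
      using r r1 H by (intro powr_mono') auto
    finally show ?thesis .
  qed
  have p: "(x * t) powr (2 * H) = x powr (2 * H) * t powr (2 * H)" for x
    by (rule powr_mult)
  have "\<bar>t - s\<bar> = (1 - r) * t" using s r1 t by (simp add: algebra_simps abs_if)
  then have "fbm_cov H t s = (t powr (2 * H) + (r * t) powr (2 * H) - ((1 - r) * t) powr (2 * H)) / 2"
    unfolding fbm_cov_def using s by simp
  also have "\<dots> = t powr (2 * H) * ((1 + r powr (2 * H) - (1 - r) powr (2 * H)) / 2)"
    unfolding p by (simp add: algebra_simps)
  also have "\<dots> \<le> t powr (2 * H) * ((r powr (2 * H) + 2 * r) / 2)"
    using bern by (intro mult_left_mono) auto
  also have "\<dots> = (r powr H + 2 * r powr (1 - H)) / 2 * (t powr H * s powr H)"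
  proof -
    have "t powr H * s powr H = t powr (2 * H) * r powr H"
      unfolding s using powr_mult[of r t H] by (simp add: powr_add[symmetric] mult_ac)
    moreover have "r powr H * r powr H = r powr (2 * H)" "r powr (1 - H) * r powr H = r"
      using r by (simp_all add: powr_add[symmetric])
    moreover have "(x + 2 * y) / 2 * (z * x) = z * ((x * x + 2 * (y * x)) / 2)" for x y z :: real
      by (simp add: algebra_simps)
    ultimately show ?thesis by metis
  qed
  also have "\<dots> \<le> (q powr H + 2 * q powr (1 - H)) / 2 * (t powr H * s powr H)"
    using r H by (intro mult_right_mono divide_right_mono add_mono mult_left_mono powr_mono2) auto
  finally show ?thesis
    using fbm_cov_nonneg[of t s H] st t H by simp
qed

text \<open>At geometrically separated times the normalised covariance matrix of \<open>B\<close> is close to the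
  identity, hence positive definite by diagonal dominance.\<close>

lemma fbm_cov_positive_definite:
  assumes H: "1 / 2 < H" "H < 1"
  shows "\<exists>\<tau> :: 'n::finite \<Rightarrow> real. (\<forall>k. 0 < \<tau> k \<and> \<tau> k \<le> 1) \<and>
    (\<forall>a. a \<noteq> (\<lambda>_. 0) \<longrightarrow> 0 < (\<Sum>i\<in>UNIV. \<Sum>j\<in>UNIV. a i * a j * fbm_cov H (\<tau> i) (\<tau> j)))"
proof -
  define N where "N = real CARD('n)"
  have N: "1 \<le> N" unfolding N_def using zero_less_card_finite[where 'a='n] by linarith
  \<comment> \<open>With correlations at most 1 / (2N), the off-diagonal part is at most (\<Sum>X)^2
    / (2N), which by Cauchy-Schwarz is at most half of the diagonal part \<Sum>X^2.\<close>
  obtain q where q: "0 < q" "q < 1" "(q powr H + 2 * q powr (1 - H)) / 2 \<le> 1 / (2 * N)"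
    by (rule powr_correlation_small[of H "1 / (2 * N)"]) (use H N in auto)
  obtain e :: "'n \<Rightarrow> nat" where e: "inj e"
    using finite_imp_inj_to_nat_seg[of "UNIV :: 'n set"] by auto
  define \<tau> where "\<tau> k = q ^ e k" for k
  have \<tau>: "0 < \<tau> k" "\<tau> k \<le> 1" for k
    using q by (auto simp: \<tau>_def intro: power_le_one)
  have sep: "\<bar>fbm_cov H (\<tau> i) (\<tau> j)\<bar> \<le> 1 / (2 * N) * (\<tau> i powr H * \<tau> j powr H)" if less: "e i < e j" for i j
  proof -
    have "q ^ e j \<le> q ^ Suc (e i)" using less q by (intro power_decreasing) auto
    then have "\<bar>fbm_cov H (\<tau> i) (\<tau> j)\<bar> \<le> (q powr H + 2 * q powr (1 - H)) / 2 * (\<tau> i powr H * \<tau> j powr H)"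
      using \<tau> q by (intro fbm_cov_separated H) (auto simp: \<tau>_def)
    also have "\<dots> \<le> 1 / (2 * N) * (\<tau> i powr H * \<tau> j powr H)"
      using q(3) by (intro mult_right_mono) auto
    finally show ?thesis .
  qed
  have sym: "fbm_cov H s t = fbm_cov H t s" for s t
    by (simp add: fbm_cov_def abs_minus_commute)
  have off: "\<bar>fbm_cov H (\<tau> i) (\<tau> j)\<bar> \<le> 1 / (2 * N) * (\<tau> i powr H * \<tau> j powr H)" if "i \<noteq> j" for i j
  proof -
    have "e i \<noteq> e j" using e that by (auto dest: injD)
    then consider "e i < e j" | "e j < e i" by linarith
    then show ?thesis
    proof cases
      case 2
      then show ?thesis using sep[OF 2] by (simp add: sym mult.commute)
    qed (rule sep)
  qed
  have diag: "fbm_cov H (\<tau> i) (\<tau> i) = \<tau> i powr H * \<tau> i powr H" for i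
    using H by (simp add: fbm_cov_def powr_add[symmetric])
  have "0 < (\<Sum>i\<in>UNIV. \<Sum>j\<in>UNIV. a i * a j * fbm_cov H (\<tau> i) (\<tau> j))" if a: "a \<noteq> (\<lambda>_. 0)" for a :: "'n \<Rightarrow> real"
  proof -
    define X where "X i = \<bar>a i\<bar> * \<tau> i powr H" for i
    have X0: "0 \<le> X i" for i by (simp add: X_def)
    have le: "(if i = j then (X i)\<^sup>2 else 0) - 1 / (2 * N) * (X i * X j) \<le> a i * a j * fbm_cov H (\<tau> i) (\<tau> j)" for i j
    proof (cases "i = j")
      case True
      have "a i * a i * fbm_cov H (\<tau> i) (\<tau> i) = (X i)\<^sup>2"
        unfolding diag X_def by (simp add: power2_eq_square mult_ac abs_mult_self_eq)
      moreover have "0 \<le> 1 / (2 * N) * (X i * X i)" using N by simp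
      ultimately show ?thesis using True by simp
    next
      case False
      have "\<bar>a i * a j * fbm_cov H (\<tau> i) (\<tau> j)\<bar> \<le> \<bar>a i * a j\<bar> * (1 / (2 * N) * (\<tau> i powr H * \<tau> j powr H))"
        unfolding abs_mult[of "a i * a j"] by (intro mult_left_mono off False) simp
      also have "\<dots> = 1 / (2 * N) * (X i * X j)"
        by (simp add: X_def abs_mult)
      finally show ?thesis using False by simp
    qed
    obtain i0 where "a i0 \<noteq> 0" using a by auto
    then have "0 < (X i0)\<^sup>2" using \<tau>(1)[of i0] by (simp add: X_def)
    also have "\<dots> \<le> (\<Sum>i\<in>UNIV. (X i)\<^sup>2)" by (intro member_le_sum) auto
    finally have pos: "0 < (\<Sum>i\<in>UNIV. (X i)\<^sup>2)" .
    have "(\<Sum>i\<in>UNIV. X i)\<^sup>2 \<le> (\<Sum>i\<in>UNIV. (X i)\<^sup>2) * N"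
      unfolding N_def by (rule sum_squared_le_sum_of_squares)
    then have "1 / (2 * N) * (\<Sum>i\<in>UNIV. X i)\<^sup>2 \<le> 1 / (2 * N) * ((\<Sum>i\<in>UNIV. (X i)\<^sup>2) * N)"
      using N by (intro mult_left_mono) auto
    then have "1 / (2 * N) * (\<Sum>i\<in>UNIV. X i)\<^sup>2 \<le> (\<Sum>i\<in>UNIV. (X i)\<^sup>2) / 2"
      using N by simp
    with pos have "0 < (\<Sum>i\<in>UNIV. (X i)\<^sup>2) - 1 / (2 * N) * (\<Sum>i\<in>UNIV. X i)\<^sup>2" by linarith
    also have "\<dots> = (\<Sum>i\<in>UNIV. \<Sum>j\<in>UNIV. (if i = j then (X i)\<^sup>2 else 0) - 1 / (2 * N) * (X i * X j))"
    proof -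
      have "(\<Sum>i\<in>UNIV. X i)\<^sup>2 = (\<Sum>i\<in>UNIV. \<Sum>j\<in>UNIV. X i * X j)"
        by (simp add: power2_eq_square sum_product)
      then show ?thesis
        by (simp only: sum_subtractf sum_distrib_left) simp
    qed
    also have "\<dots> \<le> (\<Sum>i\<in>UNIV. \<Sum>j\<in>UNIV. a i * a j * fbm_cov H (\<tau> i) (\<tau> j))"
      by (intro sum_mono le)
    finally show ?thesis .
  qed
  then show ?thesis using \<tau> by blast
qed

lemma continuous_AE_zero:
  fixes g :: "real \<Rightarrow> real"
  assumes g: "continuous_on {0..1} g" and ae: "AE t in lborel. t \<in> {0..1} \<longrightarrow> g t = 0" and t: "t \<in> {0..1}"
  shows "g t = 0"
proof -
  have cont: "continuous_on {0..1} (\<lambda>t. \<bar>g t\<bar>)" by (intro continuous_intros g)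
  note int = borel_integrable_atLeastAtMost'[OF cont]
  have "integral {0..1} (\<lambda>t. \<bar>g t\<bar>) = (LINT t:{0..1}|lborel. \<bar>g t\<bar>)"
    by (rule set_borel_integral_eq_integral(2)[OF int, symmetric])
  also have "\<dots> = (\<integral>t. 0 \<partial>(lborel :: real measure))"
    unfolding set_lebesgue_integral_def
    using int[unfolded set_integrable_def] ae
    by (intro integral_cong_AE) (auto simp: indicator_def elim!: eventually_mono)
  finally have "integral {0..1} (\<lambda>t. \<bar>g t\<bar>) = 0" by simp
  then show ?thesis
    using integral_eq_0_iff[OF cont] t by simp
qed

text \<open>The paths of \<open>B\<close> on \<open>[0, 1]\<close> that produce a degenerate solution fill a space of dimension at
  most \<open>p + 1\<close>, so \<open>p + 2\<close> point evaluations satisfy a linear relation on it. Passing to continuous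
  representatives makes point evaluations meaningful.\<close>

lemma degenerate_paths_relation:
  fixes \<phi> :: "'p::finite \<Rightarrow> real \<Rightarrow> real" and \<tau> :: "'p option option \<Rightarrow> real" and f :: "real \<Rightarrow> real"
  assumes \<tau>: "\<And>k. 0 \<le> \<tau> k" "\<And>k. \<tau> k \<le> 1"
  shows "\<exists>a. a \<noteq> (\<lambda>_. 0) \<and> (\<forall>g l. continuous_on {0..1} g \<longrightarrow>
      (AE t in lborel. t \<in> {0..1} \<longrightarrow> g t = (\<Sum>i\<in>UNIV. l i * \<phi> i t)) \<longrightarrow>
      (\<Sum>k\<in>UNIV. a k * (g (\<tau> k) - \<alpha> * integral {0..\<tau> k} g - f (\<tau> k))) = 0)"
proof -
  define rep where "rep g l \<longleftrightarrow> continuous_on {0..1} g \<and> (AE t in lborel. t \<in> {0..1} \<longrightarrow> g t = (\<Sum>i\<in>UNIV. l i * \<phi> i t))"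
    for g l
  \<comment> \<open>The scalar \<rho> in front of f turns an affine family into a linear one, at the
    price of one dimension. Actual paths have \<rho> = 1, and \<open>ev\<close> then gives the
    values of \<open>\<sigma> * B\<close> at the times \<tau>.\<close>
  define ev where "ev g \<rho> = (\<chi> k. g (\<tau> k) - \<alpha> * integral {0..\<tau> k} g - \<rho> * f (\<tau> k))" for g \<rho>
  define S where "S = {ev g \<rho> | g \<rho>. \<exists>l. rep g l}"
  have rep_sum: "rep (\<lambda>t. \<Sum>k\<in>K. c k * g k t) (\<lambda>i. \<Sum>k\<in>K. c k * l k i)"
    if K: "finite K" "\<And>k. k \<in> K \<Longrightarrow> rep (g k) (l k)" for K :: "'k set" and c g l
  proof -
    have "AE t in lborel. \<forall>k\<in>K. t \<in> {0..1} \<longrightarrow> g k t = (\<Sum>i\<in>UNIV. l k i * \<phi> i t)"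
      using K unfolding rep_def by (intro AE_finite_allI) auto
    then have "AE t in lborel. t \<in> {0..1} \<longrightarrow> (\<Sum>k\<in>K. c k * g k t) = (\<Sum>i\<in>UNIV. (\<Sum>k\<in>K. c k * l k i) * \<phi> i t)"
    proof eventually_elim
      case (elim t)
      have "(\<Sum>k\<in>K. c k * (\<Sum>i\<in>UNIV. l k i * \<phi> i t)) = (\<Sum>i\<in>UNIV. (\<Sum>k\<in>K. c k * l k i) * \<phi> i t)"
        unfolding sum_distrib_left sum_distrib_right by (subst sum.swap) (simp add: mult.assoc)
      with elim show ?case by simp
    qed
    moreover have "continuous_on {0..1} (\<lambda>t. \<Sum>k\<in>K. c k * g k t)"
      using K unfolding rep_def by (intro continuous_intros) auto
    ultimately show ?thesis unfolding rep_def by simp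
  qed
  have ev_sum: "(\<Sum>k\<in>K. c k *\<^sub>R ev (g k) (\<rho> k)) = ev (\<lambda>t. \<Sum>k\<in>K. c k * g k t) (\<Sum>k\<in>K. c k * \<rho> k)"
    if K: "finite K" "\<And>k. k \<in> K \<Longrightarrow> continuous_on {0..1} (g k)" for K :: "'k set" and c g \<rho>
    unfolding vec_eq_iff
  proof
    fix j
    have int: "g k integrable_on {0..\<tau> j}" if "k \<in> K" for k
      using K(2)[OF that] \<tau>[of j] by (intro integrable_continuous_real) (auto elim: continuous_on_subset)
    have "integral {0..\<tau> j} (\<lambda>t. \<Sum>k\<in>K. c k * g k t) = (\<Sum>k\<in>K. c k * integral {0..\<tau> j} (g k))"
      using K(1) int by (subst Henstock_Kurzweil_Integration.integral_sum) (auto intro!: integrable_on_mult_right)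
    then show "(\<Sum>k\<in>K. c k *\<^sub>R ev (g k) (\<rho> k)) $ j = ev (\<lambda>t. \<Sum>k\<in>K. c k * g k t) (\<Sum>k\<in>K. c k * \<rho> k) $ j"
      by (simp add: ev_def sum_subtractf sum.distrib sum_distrib_left sum_distrib_right algebra_simps)
  qed
  have subspace: "subspace S"
  proof -
    have comb: "c *\<^sub>R u + d *\<^sub>R v \<in> S" if uv: "u \<in> S" "v \<in> S" for u v c d
    proof -
      obtain g1 \<rho>1 l1 g2 \<rho>2 l2 where *: "u = ev g1 \<rho>1" "rep g1 l1" "v = ev g2 \<rho>2" "rep g2 l2"
        using uv unfolding S_def by blast
      let ?g = "case_bool g1 g2" and ?l = "case_bool l1 l2" and ?r = "case_bool \<rho>1 \<rho>2" and ?c = "case_bool c d"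
      have "rep (?g k) (?l k)" for k using * by (cases k) auto
      then have "rep (\<lambda>t. \<Sum>k\<in>UNIV. ?c k * ?g k t) (\<lambda>i. \<Sum>k\<in>UNIV. ?c k * ?l k i)"
        "(\<Sum>k\<in>UNIV. ?c k *\<^sub>R ev (?g k) (?r k)) = ev (\<lambda>t. \<Sum>k\<in>UNIV. ?c k * ?g k t) (\<Sum>k\<in>UNIV. ?c k * ?r k)"
        by (intro rep_sum ev_sum; simp add: rep_def)+
      moreover have "(\<Sum>k\<in>UNIV. ?c k *\<^sub>R ev (?g k) (?r k)) = c *\<^sub>R u + d *\<^sub>R v"
        using * by (simp add: UNIV_bool add.commute)
      ultimately show ?thesis unfolding S_def mem_Collect_eq by metis
    qed
    have "rep (\<lambda>_. 0) (\<lambda>_. 0)" by (simp add: rep_def)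
    moreover have "ev (\<lambda>_. 0) 0 = 0" by (simp add: ev_def vec_eq_iff)
    ultimately have "0 \<in> S" unfolding S_def by force
    then show ?thesis
      using comb[of _ _ 1 1] comb[of _ _ _ 0] by (auto simp: subspace_def)
  qed
  have "S \<noteq> UNIV"
  proof
    assume "S = UNIV"
    then have "\<forall>k. axis k 1 \<in> S" by simp
    then have "\<forall>k. \<exists>g \<rho> l. axis k 1 = ev g \<rho> \<and> rep g l" unfolding S_def by blast
    then obtain g \<rho> l where g: "\<And>k. axis k 1 = ev (g k) (\<rho> k)" "\<And>k. rep (g k) (l k)" by metis
    \<comment> \<open>Sends a vector to the p + 1 parameters (\<rho>, l) of the corresponding
      combination of the chosen preimages of the p + 2 basis vectors. A nonzero v in its kernel
      gives a function that vanishes almost everywhere, hence everywhere by continuity, so v =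
      \<open>ev\<close> of zero data = 0.\<close>
    define T :: "real ^ 'p option option \<Rightarrow> real ^ 'p option" where
      "T v = (\<Sum>k\<in>UNIV. v $ k *\<^sub>R (\<chi> j. case j of None \<Rightarrow> \<rho> k | Some i \<Rightarrow> l k i))" for v
    have "linear T"
      unfolding T_def by (intro linearI) (simp_all add: scaleR_left_distrib sum.distrib scaleR_sum_right)
    have "\<not> inj T"
    proof
      assume "inj T"
      then have "dim (T ` UNIV) = dim (UNIV :: (real ^ 'p option option) set)"
        by (intro dim_image_eq[OF \<open>linear T\<close>]) auto
      moreover have "dim (T ` UNIV) \<le> CARD('p option)" by (rule dim_subset_UNIV_cart)
      ultimately show False by simp
    qed
    then obtain v where v: "T v = 0" "v \<noteq> 0"
      using linear_injective_0[OF \<open>linear T\<close>] by auto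
    have T_nth: "T v $ j = (\<Sum>k\<in>UNIV. v $ k * (case j of None \<Rightarrow> \<rho> k | Some i \<Rightarrow> l k i))" for j
      by (simp add: T_def)
    have zero: "(\<Sum>k\<in>UNIV. v $ k * \<rho> k) = 0" "(\<Sum>k\<in>UNIV. v $ k * l k i) = 0" for i
      using T_nth[of None] T_nth[of "Some i"] v(1) by auto
    have "rep (\<lambda>t. \<Sum>k\<in>UNIV. v $ k * g k t) (\<lambda>i. \<Sum>k\<in>UNIV. v $ k * l k i)"
      by (intro rep_sum g) auto
    then have G0: "(\<Sum>k\<in>UNIV. v $ k * g k t) = 0" if "t \<in> {0..1}" for t
      unfolding rep_def zero by (intro continuous_AE_zero[OF _ _ that]) auto
    have "v = (\<Sum>k\<in>UNIV. v $ k *\<^sub>R axis k 1)"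
      using basis_expansion[of v] by (simp add: scalar_mult_eq_scaleR)
    also have "\<dots> = ev (\<lambda>t. \<Sum>k\<in>UNIV. v $ k * g k t) (\<Sum>k\<in>UNIV. v $ k * \<rho> k)"
      unfolding g(1) using g(2) by (intro ev_sum) (auto simp: rep_def)
    also have "\<dots> = 0"
    proof -
      have "integral {0..\<tau> j} (\<lambda>t. \<Sum>k\<in>UNIV. v $ k * g k t) = integral {0..\<tau> j} (\<lambda>_. 0)" for j
        using \<tau>[of j] by (intro Henstock_Kurzweil_Integration.integral_cong G0) auto
      then show ?thesis
        using G0 \<tau> by (simp add: ev_def vec_eq_iff zero)
    qed
    finally show False using v(2) by simp
  qed
  \<comment> \<open>A nonzero vector orthogonal to the proper subspace S supplies the coefficients
    of the relation.\<close>
  then have "dim S < DIM(real ^ 'p option option)"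
    using dim_subset_UNIV[of S] dim_eq_full[of S] span_eq_iff[of S] subspace by fastforce
  then obtain v where v: "v \<noteq> 0" "\<And>u. u \<in> span S \<Longrightarrow> orthogonal v u"
    using orthogonal_to_subspace_exists by metis
  show ?thesis
  proof (intro exI[of _ "\<lambda>k. v $ k"] conjI allI impI)
    show "(\<lambda>k. v $ k) \<noteq> (\<lambda>_. 0)" using v(1) by (auto simp: vec_eq_iff fun_eq_iff)
    fix g l assume "continuous_on {0..1} g" "AE t in lborel. t \<in> {0..1} \<longrightarrow> g t = (\<Sum>i\<in>UNIV. l i * \<phi> i t)"
    then have "ev g 1 \<in> S" unfolding S_def rep_def by auto
    then have "v \<bullet> ev g 1 = 0" using v(2) span_base by (auto simp: orthogonal_def)
    then show "(\<Sum>k\<in>UNIV. v $ k * (g (\<tau> k) - \<alpha> * integral {0..\<tau> k} g - f (\<tau> k))) = 0"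
      by (simp add: inner_vec_def ev_def)
  qed
qed

lemma (in prob_space) AE_gaussian_neq:
  assumes Y: "gaussian_rv M Y" "expectation Y = 0" and v: "0 < expectation (\<lambda>\<omega>. (Y \<omega>)\<^sup>2)"
  shows "AE \<omega> in M. Y \<omega> \<noteq> a"
proof (rule AE_limit_neq_of_anticoncentration[of "\<lambda>_. Y" 0 _ "2 / sqrt (expectation (\<lambda>\<omega>. (Y \<omega>)\<^sup>2))"])
  show "Y \<in> borel_measurable M" using Y by (simp add: gaussian_rv_def)
  show "prob {\<omega>\<in>space M. \<bar>Y \<omega> - a\<bar> \<le> \<epsilon>} \<le> 2 / sqrt (expectation (\<lambda>\<omega>. (Y \<omega>)\<^sup>2)) * \<epsilon>" if "0 < \<epsilon>" for \<epsilon>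
    using centred_gaussian_anticoncentration[OF Y v order_refl that, of a] by simp
qed auto

text \<open>The order of quantifiers matters: g and l will depend on \<omega>, so the null set has
  to be fixed before them. It is the event that the combination with the fixed coefficients a
  vanishes, and this combination has positive variance.\<close>

lemma (in fbm) AE_path_nondegenerate:
  fixes \<phi> :: "'p::finite \<Rightarrow> real \<Rightarrow> real" and f :: "real \<Rightarrow> real"
  assumes "\<sigma> \<noteq> 0"
  shows "AE \<omega> in M. \<forall>g l. continuous_on {0..1} g \<longrightarrow>
    (AE t in lborel. t \<in> {0..1} \<longrightarrow> g t = (\<Sum>i\<in>UNIV. l i * \<phi> i t)) \<longrightarrow>
    (\<exists>t\<in>{0..1}. \<sigma> * B t \<omega> \<noteq> g t - \<alpha> * integral {0..t} g - f t)"
proof -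
  obtain \<tau> :: "'p option option \<Rightarrow> real" where \<tau>': "\<forall>k. 0 < \<tau> k \<and> \<tau> k \<le> 1"
    "\<forall>a. a \<noteq> (\<lambda>_. 0) \<longrightarrow> 0 < (\<Sum>i\<in>UNIV. \<Sum>j\<in>UNIV. a i * a j * fbm_cov H (\<tau> i) (\<tau> j))"
    using fbm_cov_positive_definite[OF H_gt H_less] by blast
  have \<tau>: "0 < \<tau> k" "\<tau> k \<le> 1" for k using \<tau>'(1) by auto
  have \<tau>0: "0 \<le> \<tau> k" for k using \<tau>(1)[of k] by simp
  obtain a where a: "a \<noteq> (\<lambda>_. 0)"
    and rel: "\<forall>g l. continuous_on {0..1} g \<longrightarrow>
      (AE t in lborel. t \<in> {0..1} \<longrightarrow> g t = (\<Sum>i\<in>UNIV. l i * \<phi> i t)) \<longrightarrow>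
      (\<Sum>k\<in>UNIV. a k * (g (\<tau> k) - \<alpha> * integral {0..\<tau> k} g - f (\<tau> k))) = 0"
    using degenerate_paths_relation[of \<tau> \<phi> \<alpha> f] \<tau>0 \<tau>(2) by blast
  have nz: "AE \<omega> in M. (\<Sum>k\<in>UNIV. a k * B (\<tau> k) \<omega>) \<noteq> 0"
    using \<tau>'(2)[rule_format, OF a] \<tau>0
    by (intro AE_gaussian_neq gaussian_lincomb mean_lincomb) (auto simp: variance_lincomb)
  show ?thesis
  proof (rule eventually_mono[OF nz], intro allI impI, rule ccontr)
    fix \<omega> g l
    assume ne: "(\<Sum>k\<in>UNIV. a k * B (\<tau> k) \<omega>) \<noteq> 0"
      and g: "continuous_on {0..1} g" "AE t in lborel. t \<in> {0..1} \<longrightarrow> g t = (\<Sum>i\<in>UNIV. l i * \<phi> i t)"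
      and "\<not> (\<exists>t\<in>{0..1}. \<sigma> * B t \<omega> \<noteq> g t - \<alpha> * integral {0..t} g - f t)"
    then have "g (\<tau> k) - \<alpha> * integral {0..\<tau> k} g - f (\<tau> k) = \<sigma> * B (\<tau> k) \<omega>" for k
      using \<tau>0 \<tau>(2) by simp
    then have "\<sigma> * (\<Sum>k\<in>UNIV. a k * B (\<tau> k) \<omega>) = 0"
      using rel[rule_format, OF g] by (simp add: sum_distrib_left mult_ac)
    then show False using ne assms by simp
  qed
qed

subsection \<open>The limit of the discounted path does not vanish\<close>

text \<open>The integral of exp(-\<alpha> s) over the j-th dyadic interval of level k. With these
  exact weights the error of a Riemann sum comes from the oscillation of b alone.\<close>

definition exp_weight :: "real \<Rightarrow> nat \<Rightarrow> nat \<Rightarrow> real" where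
  "exp_weight \<alpha> k j = (exp (- \<alpha> * (real j / 2 ^ k)) - exp (- \<alpha> * (real (Suc j) / 2 ^ k))) / \<alpha>"

lemma exp_weight_nonneg:
  assumes "0 < \<alpha>"
  shows "0 \<le> exp_weight \<alpha> k j"
proof -
  have "\<alpha> * (real j / 2 ^ k) \<le> \<alpha> * (real (Suc j) / 2 ^ k)"
    using assms by (intro mult_left_mono divide_right_mono) auto
  then show ?thesis unfolding exp_weight_def using assms by simp
qed

lemma sum_exp_weight:
  assumes "m \<le> n"
  shows "(\<Sum>j=m..<n. exp_weight \<alpha> k j) = (exp (- \<alpha> * (real m / 2 ^ k)) - exp (- \<alpha> * (real n / 2 ^ k))) / \<alpha>"
  using sum_Suc_diff'[OF assms, of "\<lambda>j. - exp (- \<alpha> * (real j / 2 ^ k))"]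
  by (simp add: exp_weight_def sum_divide_distrib[symmetric] del: of_nat_Suc)

text \<open>On every dyadic interval b stays within c of its value at the left end point, and the
  weights add up to at most 1 / \<alpha>. The error is thus at most c / \<alpha>, although the range
  [0, 2^k] grows while the mesh 2^(-k) shrinks.\<close>

lemma dyadic_riemann_sum:
  assumes b: "continuous_on {0..} b" "dyadic_bound b r k0" and r: "0 < r" "r < 1"
    and \<alpha>: "0 < \<alpha>" and k: "k0 \<le> k"
  shows "\<bar>integral {0..2 ^ k} (\<lambda>s. exp (- \<alpha> * s) * b s) - (\<Sum>j<4 ^ k. exp_weight \<alpha> k j * b (real j / 2 ^ k))\<bar>
    \<le> r ^ k / (1 - r) / \<alpha>"
proof -
  let ?t = "\<lambda>j. real j / 2 ^ k"
  define c where "c = r ^ k / (1 - r)"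
  have c: "0 \<le> c" using r by (simp add: c_def)
  have cont: "continuous_on {u..v} (\<lambda>s. exp (- \<alpha> * s) * b s)" if "0 \<le> u" for u v
    using that by (intro continuous_intros continuous_on_subset[OF b(1)]) auto
  have tj: "?t j \<le> ?t (Suc j)" for j
    by (intro divide_right_mono) auto
  have piece: "\<bar>integral {?t j..?t (Suc j)} (\<lambda>s. exp (- \<alpha> * s) * b s) - exp_weight \<alpha> k j * b (?t j)\<bar> \<le> exp_weight \<alpha> k j * c"
    if j: "j < 4 ^ k" for j
  proof -
    have w: "((\<lambda>s. exp (- \<alpha> * s) * y) has_integral exp_weight \<alpha> k j * y) {?t j..?t (Suc j)}" for y
    proof -
      have "((\<lambda>s. exp (- \<alpha> * s)) has_integral exp_weight \<alpha> k j) {?t j..?t (Suc j)}"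
      proof -
        have "exp_weight \<alpha> k j = (exp (- \<alpha> * ?t (Suc j)) - exp (- \<alpha> * ?t j)) / (- \<alpha>)"
          unfolding exp_weight_def using minus_divide_divide[of "exp (- \<alpha> * ?t j) - exp (- \<alpha> * ?t (Suc j))" \<alpha>]
          by simp
        then show ?thesis
          using exp_has_integral[of "- \<alpha>" "?t j" "?t (Suc j)"] \<alpha> tj[of j] by simp
      qed
      then show ?thesis by (rule has_integral_mult_left)
    qed
    have int: "(\<lambda>s. exp (- \<alpha> * s) * b s) integrable_on {?t j..?t (Suc j)}"
      by (intro integrable_continuous_real cont) simp
    have "integral {?t j..?t (Suc j)} (\<lambda>s. exp (- \<alpha> * s) * b s) - exp_weight \<alpha> k j * b (?t j)
      = integral {?t j..?t (Suc j)} (\<lambda>s. exp (- \<alpha> * s) * b s - exp (- \<alpha> * s) * b (?t j))"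
      unfolding Henstock_Kurzweil_Integration.integral_diff[OF int has_integral_integrable[OF w]] integral_unique[OF w] ..
    also have "\<bar>\<dots>\<bar> \<le> exp_weight \<alpha> k j * c"
    proof (rule integral_abs_le[OF _ w])
      show "(\<lambda>s. exp (- \<alpha> * s) * b s - exp (- \<alpha> * s) * b (?t j)) integrable_on {?t j..?t (Suc j)}"
        by (intro integrable_diff int has_integral_integrable[OF w])
      fix s assume s: "s \<in> {?t j..?t (Suc j)}"
      have "\<bar>b s - b (?t j)\<bar> \<le> c"
      proof (cases "s = ?t (Suc j)")
        \<comment> \<open>At the right end point the truncation is already j + 1, so the increment
          bound is used there instead of the approximation.\<close>
        case True
        have "\<bar>b (?t (Suc j)) - b (?t j)\<bar> \<le> r ^ k"
          using b(2) k j unfolding dyadic_bound_def by blast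
        also have "r ^ k \<le> c"
          unfolding c_def using r by (simp add: pos_le_divide_eq mult_left_le)
        finally show ?thesis using True by simp
      next
        case False
        then have "s < ?t (Suc j)" using s by auto
        then have sj: "real j \<le> s * 2 ^ k" "s * 2 ^ k < real j + 1"
          using s by (simp_all add: pos_divide_le_eq pos_less_divide_eq add.commute)
        then have "\<lfloor>s * 2 ^ k\<rfloor> = int j" by linarith
        then have fl: "nat \<lfloor>s * 2 ^ k\<rfloor> = j" by simp
        have "real (Suc j) \<le> real (4 ^ k)" using j unfolding of_nat_le_iff by simp
        then have "s * 2 ^ k < 2 ^ k * 2 ^ k"
          using sj by (simp add: power_mult_distrib[symmetric])
        then have "s < 2 ^ k" by simp
        moreover have "0 \<le> s" using s by (auto intro: order_trans[rotated])
        ultimately have "\<bar>b s - b (real (nat \<lfloor>s * 2 ^ k\<rfloor>) / 2 ^ k)\<bar> \<le> r ^ k / (1 - r)"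
          by (intro dyadic_approximation[OF b r k])
        then show ?thesis unfolding fl c_def .
      qed
      then show "\<bar>exp (- \<alpha> * s) * b s - exp (- \<alpha> * s) * b (?t j)\<bar> \<le> exp (- \<alpha> * s) * c"
        by (simp add: right_diff_distrib[symmetric] abs_mult mult_left_mono)
    qed
    finally show ?thesis .
  qed
  have "\<bar>integral {0..?t m} (\<lambda>s. exp (- \<alpha> * s) * b s) - (\<Sum>j<m. exp_weight \<alpha> k j * b (?t j))\<bar>
      \<le> (\<Sum>j<m. exp_weight \<alpha> k j) * c" if "m \<le> 4 ^ k" for m
    using that
  proof (induction m)
    case (Suc m)
    have "integral {0..?t m} (\<lambda>s. exp (- \<alpha> * s) * b s) + integral {?t m..?t (Suc m)} (\<lambda>s. exp (- \<alpha> * s) * b s)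
        = integral {0..?t (Suc m)} (\<lambda>s. exp (- \<alpha> * s) * b s)"
      by (intro Henstock_Kurzweil_Integration.integral_combine tj integrable_continuous_real cont) auto
    moreover have "\<bar>integral {?t m..?t (Suc m)} (\<lambda>s. exp (- \<alpha> * s) * b s) - exp_weight \<alpha> k m * b (?t m)\<bar> \<le> exp_weight \<alpha> k m * c"
      by (rule piece) (use Suc.prems in simp)
    moreover have "\<bar>integral {0..?t m} (\<lambda>s. exp (- \<alpha> * s) * b s) - (\<Sum>j<m. exp_weight \<alpha> k j * b (?t j))\<bar>
      \<le> (\<Sum>j<m. exp_weight \<alpha> k j) * c"
      by (rule Suc.IH) (use Suc.prems in simp)
    ultimately show ?case by (simp add: distrib_right del: of_nat_Suc)
  qed simp
  from this[of "4 ^ k"]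
  have "\<bar>integral {0..?t (4 ^ k)} (\<lambda>s. exp (- \<alpha> * s) * b s) - (\<Sum>j<4 ^ k. exp_weight \<alpha> k j * b (?t j))\<bar>
      \<le> (\<Sum>j<4 ^ k. exp_weight \<alpha> k j) * c" by simp
  also have "\<dots> \<le> 1 / \<alpha> * c"
    using sum_exp_weight[of 0 "4 ^ k" \<alpha> k] \<alpha> c
    by (intro mult_right_mono) (auto simp: atLeast0LessThan divide_right_mono)
  also have "?t (4 ^ k) = 2 ^ k"
  proof -
    have "(4::real) ^ k = 2 ^ k * 2 ^ k" by (simp add: power_mult_distrib[symmetric])
    then show ?thesis by simp
  qed
  finally show ?thesis by (simp add: c_def mult.commute)
qed

text \<open>For times in [1, 2] both powers are at least 1 and that of the distance is at most 1, so
  covariances are at least 1/2. All other terms of the variance are nonnegative and are dropped. The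
  sample times in [1, 2) have total weight (exp(-\<alpha>) - exp(-2\<alpha>)) / \<alpha>, which is
  independent of k; k \<ge> 1 places them inside the range of summation.\<close>

lemma (in fbm) riemann_sum_variance:
  assumes \<alpha>: "0 < \<alpha>" and k: "1 \<le> k"
  shows "((exp (- \<alpha>) - exp (- 2 * \<alpha>)) / \<alpha>)\<^sup>2 / 2
    \<le> expectation (\<lambda>\<omega>. (\<Sum>j<4 ^ k. exp_weight \<alpha> k j * B (real j / 2 ^ k) \<omega>)\<^sup>2)"
proof -
  let ?w = "exp_weight \<alpha> k" and ?t = "\<lambda>j. real j / 2 ^ k"
  let ?J = "{2 ^ k..<2 * 2 ^ k} :: nat set"
  have sub: "?J \<subseteq> {..<4 ^ k}"
  proof -
    have "(2::nat) * 2 ^ k \<le> 2 ^ k * 2 ^ k"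
      using power_increasing[OF k, of "2::nat"] by (intro mult_right_mono) auto
    also have "\<dots> = 4 ^ k" by (simp add: power_mult_distrib[symmetric])
    finally show ?thesis by auto
  qed
  have cov: "1 / 2 \<le> fbm_cov H (?t i) (?t j)" if "i \<in> ?J" "j \<in> ?J" for i j
  proof -
    have t: "1 \<le> ?t n" "?t n \<le> 2" if "n \<in> ?J" for n
    proof -
      have "2 ^ k \<le> n" "n \<le> 2 * 2 ^ k" using that by auto
      then have "real (2 ^ k) \<le> real n" "real n \<le> real (2 * 2 ^ k)"
        unfolding of_nat_le_iff .
      then show "1 \<le> ?t n" "?t n \<le> 2" by (simp_all add: pos_le_divide_eq pos_divide_le_eq)
    qed
    have "\<bar>?t i - ?t j\<bar> \<le> 1" using t[OF that(1)] t[OF that(2)] by linarith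
    then have "\<bar>?t i - ?t j\<bar> powr (2 * H) \<le> 1 powr (2 * H)"
      using H_gt by (intro powr_mono2) auto
    moreover have "1 \<le> ?t i powr (2 * H)" "1 \<le> ?t j powr (2 * H)"
      using t[OF that(1)] t[OF that(2)] H_gt by (auto intro!: ge_one_powr_ge_zero)
    ultimately show ?thesis by (simp add: fbm_cov_def)
  qed
  have "((exp (- \<alpha>) - exp (- 2 * \<alpha>)) / \<alpha>)\<^sup>2 / 2 = (\<Sum>i\<in>?J. ?w i)\<^sup>2 * (1 / 2)"
    by (subst sum_exp_weight) (auto simp: mult.commute)
  also have "\<dots> = (\<Sum>i\<in>?J. \<Sum>j\<in>?J. ?w i * ?w j * (1 / 2))"
  proof -
    have "(\<Sum>i\<in>?J. ?w i)\<^sup>2 = (\<Sum>i\<in>?J. \<Sum>j\<in>?J. ?w i * ?w j)"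
      by (simp add: power2_eq_square sum_product)
    then show ?thesis by (simp only: sum_distrib_right)
  qed
  also have "\<dots> \<le> (\<Sum>i\<in>?J. \<Sum>j\<in>?J. ?w i * ?w j * fbm_cov H (?t i) (?t j))"
    by (intro sum_mono mult_left_mono cov mult_nonneg_nonneg exp_weight_nonneg \<alpha>)
  also have "\<dots> \<le> (\<Sum>i\<in>?J. \<Sum>j<4 ^ k. ?w i * ?w j * fbm_cov H (?t i) (?t j))"
    using H_gt sub by (intro sum_mono sum_mono2 mult_nonneg_nonneg exp_weight_nonneg fbm_cov_nonneg \<alpha>) auto
  also have "\<dots> \<le> (\<Sum>i<4 ^ k. \<Sum>j<4 ^ k. ?w i * ?w j * fbm_cov H (?t i) (?t j))"
    using H_gt sub by (intro sum_mono2 sum_nonneg mult_nonneg_nonneg exp_weight_nonneg fbm_cov_nonneg \<alpha>) auto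
  also have "\<dots> = expectation (\<lambda>\<omega>. (\<Sum>j<4 ^ k. ?w j * B (?t j) \<omega>)\<^sup>2)"
    by (rule variance_lincomb[symmetric]) auto
  finally show ?thesis .
qed

text \<open>The deterministic shift \<open>d k\<close> only moves the centre of the window, to which
  the anticoncentration bound is insensitive; the variance bound makes it uniform in k.\<close>

lemma (in fbm) AE_riemann_limit_neq_0:
  assumes \<alpha>: "0 < \<alpha>" and c: "c \<noteq> 0"
    and lim: "AE \<omega> in M. (\<lambda>k. d k + c * (\<Sum>j<4 ^ k. exp_weight \<alpha> k j * B (real j / 2 ^ k) \<omega>)) \<longlonglongrightarrow> Z \<omega>"
  shows "AE \<omega> in M. Z \<omega> \<noteq> 0"
proof -
  let ?Y = "\<lambda>k \<omega>. \<Sum>j<4 ^ k. exp_weight \<alpha> k j * B (real j / 2 ^ k) \<omega>"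
  define v where "v = ((exp (- \<alpha>) - exp (- 2 * \<alpha>)) / \<alpha>)\<^sup>2 / 2"
  have v: "0 < v" using \<alpha> by (simp add: v_def)
  show ?thesis
  proof (rule AE_limit_neq_of_anticoncentration[OF _ _ lim, where ?k0.0=1 and K="2 / sqrt v / \<bar>c\<bar>"])
    show "(\<lambda>\<omega>. d k + c * ?Y k \<omega>) \<in> borel_measurable M" for k
      by measurable
    fix k :: nat and \<epsilon> :: real assume k: "1 \<le> k" and \<epsilon>: "0 < \<epsilon>"
    have "\<bar>d k + c * y - 0\<bar> \<le> \<epsilon> \<longleftrightarrow> \<bar>y - (- d k / c)\<bar> \<le> \<epsilon> / \<bar>c\<bar>" for y
    proof -
      have "d k + c * y = c * (y - (- d k / c))" using c by (simp add: field_simps)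
      then have "\<bar>d k + c * y - 0\<bar> = \<bar>c\<bar> * \<bar>y - (- d k / c)\<bar>" by (simp add: abs_mult)
      then show ?thesis using c by (simp add: pos_le_divide_eq mult.commute)
    qed
    then have "prob {\<omega>\<in>space M. \<bar>d k + c * ?Y k \<omega> - 0\<bar> \<le> \<epsilon>} = prob {\<omega>\<in>space M. \<bar>?Y k \<omega> - (- d k / c)\<bar> \<le> \<epsilon> / \<bar>c\<bar>}"
      by simp
    also have "\<dots> \<le> 2 * (\<epsilon> / \<bar>c\<bar>) / sqrt v"
      using c \<epsilon> riemann_sum_variance[OF \<alpha> k]
      by (intro centred_gaussian_anticoncentration v gaussian_lincomb mean_lincomb) (auto simp: v_def)
    finally show "prob {\<omega>\<in>space M. \<bar>d k + c * ?Y k \<omega> - 0\<bar> \<le> \<epsilon>} \<le> 2 / sqrt v / \<bar>c\<bar> * \<epsilon>"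
      by (simp add: mult.commute)
  qed
qed

context ou_path_growth
begin

lemma x_integral_equation:
  assumes "0 \<le> t"
  shows "x t = x0 + integral {0..t} L + \<alpha> * integral {0..t} x + \<sigma> * b t"
proof -
  have "integral {0..t} drift = integral {0..t} L + \<alpha> * integral {0..t} x"
    unfolding drift_def[abs_def]
    using L_integrable integrable_continuous_real[OF x_cont'[of 0 t]]
    by (subst Henstock_Kurzweil_Integration.integral_add) (auto intro!: integrable_on_mult_right)
  then show ?thesis using x_eq[OF assms] by (simp add: v_def)
qed

text \<open>Exhibits \<xi> as a pointwise limit of a deterministic sequence plus centred Gaussian
  sums, the form in which anticoncentration applies.\<close>

lemma discounted_riemann_limit:
  assumes b: "dyadic_bound b r k0" and r: "0 < r" "r < 1" and \<xi>: "(discounted \<longlongrightarrow> \<xi>) at_top"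
  shows "(\<lambda>k. (x0 + \<alpha> * integral {0..2 ^ k} (\<lambda>s. exp (- \<alpha> * s) * integral {0..s} L))
    + \<alpha> * \<sigma> * (\<Sum>j<4 ^ k. exp_weight \<alpha> k j * b (real j / 2 ^ k))) \<longlonglongrightarrow> \<xi>"
proof -
  let ?S = "\<lambda>k. \<Sum>j<4 ^ k. exp_weight \<alpha> k j * b (real j / 2 ^ k)"
  let ?I = "\<lambda>k::nat. integral {0..2 ^ k} (\<lambda>s. exp (- \<alpha> * s) * b s)"
  have "filterlim (\<lambda>k::nat. (2::real) ^ k) at_top sequentially"
    by real_asymp
  then have lim: "(\<lambda>k. discounted (2 ^ k)) \<longlonglongrightarrow> \<xi>"
    using \<xi> by (rule filterlim_compose[rotated])
  have "(\<lambda>k. ?S k - ?I k) \<longlonglongrightarrow> 0"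
  proof (rule Lim_null_comparison)
    show "eventually (\<lambda>k. norm (?S k - ?I k) \<le> r ^ k / (1 - r) / \<alpha>) sequentially"
      using eventually_ge_at_top[of k0]
      by eventually_elim (use dyadic_riemann_sum[OF b_cont b r \<alpha>] in \<open>simp add: abs_minus_commute\<close>)
    have "(\<lambda>k. r ^ k / (1 - r) / \<alpha>) \<longlonglongrightarrow> 0 / (1 - r) / \<alpha>"
      using r \<alpha> by (intro tendsto_intros LIMSEQ_realpow_zero) auto
    then show "(\<lambda>k. r ^ k / (1 - r) / \<alpha>) \<longlonglongrightarrow> 0" by simp
  qed
  then have "(\<lambda>k. discounted (2 ^ k) + \<alpha> * \<sigma> * (?S k - ?I k)) \<longlonglongrightarrow> \<xi> + \<alpha> * \<sigma> * 0"
    by (intro tendsto_intros lim)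
  moreover have "discounted (2 ^ k) + \<alpha> * \<sigma> * (?S k - ?I k)
      = (x0 + \<alpha> * integral {0..2 ^ k} (\<lambda>s. exp (- \<alpha> * s) * integral {0..s} L)) + \<alpha> * \<sigma> * ?S k" for k
  proof -
    have "forcing = (\<lambda>s. exp (- \<alpha> * s) * ell s + \<sigma> * (exp (- \<alpha> * s) * b s))"
      by (simp add: fun_eq_iff forcing_def algebra_simps)
    moreover have "(\<lambda>s. exp (- \<alpha> * s) * ell s) integrable_on {0..2 ^ k}"
      "(\<lambda>s. \<sigma> * (exp (- \<alpha> * s) * b s)) integrable_on {0..2 ^ k}"
      by (intro integrable_continuous_real continuous_intros ell_cont b_cont'; simp)+
    ultimately have "integral {0..2 ^ k} forcing
        = integral {0..2 ^ k} (\<lambda>s. exp (- \<alpha> * s) * ell s) + \<sigma> * ?I k"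
      by (simp add: Henstock_Kurzweil_Integration.integral_add)
    then show ?thesis by (simp add: discounted_def ell_def[abs_def] algebra_simps)
  qed
  ultimately show ?thesis by simp
qed

end

subsection \<open>Strong consistency\<close>

locale seasonal_growth_path =
  seasonal_path x b L \<alpha> \<sigma> x0 K \<phi> \<mu> F + ou_path_growth x b L \<alpha> \<sigma> x0 K G \<gamma>
  for x b L \<alpha> \<sigma> x0 K and \<phi> :: "'p::finite \<Rightarrow> real \<Rightarrow> real" and \<mu> F G \<gamma>
begin

lemma Dn_neq_0:
  assumes n: "1 \<le> n"
    and nondeg: "\<And>l. AE t in lborel. t \<in> {0..1} \<longrightarrow> x t = (\<Sum>i\<in>UNIV. l i * \<phi> i t) \<Longrightarrow>
      \<exists>t\<in>{0..1}. \<sigma> * b t \<noteq> x t - \<alpha> * integral {0..t} x - (x0 + integral {0..t} L)"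
  shows "Dn \<phi> x n \<noteq> 0"
proof
  assume "Dn \<phi> x n = 0"
  then obtain l where "AE t in lborel. t \<in> {0..1} \<longrightarrow> x t = (\<Sum>i\<in>UNIV. l i * \<phi> i t)"
    by (rule Dn_eq_0_imp[OF n])
  from nondeg[OF this] show False
    using x_integral_equation by auto
qed

lemma estimator_consistent:
  assumes \<beta>: "1 / 2 < \<beta>" "\<beta> < 1"
    and hoelder: "\<And>n::nat. \<exists>C \<delta>. 0 < \<delta> \<and> 0 \<le> C \<and> (\<forall>s t. 0 \<le> s \<longrightarrow> s \<le> t \<longrightarrow> t \<le> real n \<longrightarrow> t - s \<le> \<delta>
      \<longrightarrow> \<bar>b t - b s\<bar> \<le> C * (t - s) powr \<beta>)"
    and \<xi>: "(discounted \<longlongrightarrow> \<xi>) at_top" "\<xi> \<noteq> 0"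
    and w: "\<And>i. eventually (\<lambda>n. \<bar>w i n\<bar> \<le> 2 * real n powr \<gamma>) sequentially"
    and D: "\<And>n. 1 \<le> n \<Longrightarrow> Dn \<phi> x n \<noteq> 0"
  shows "(\<lambda>n. theta_hat \<phi> L \<alpha> \<sigma> x b (\<lambda>i. w i n) n $ Some i - \<mu> i) \<longlonglongrightarrow> 0"
    and "(\<lambda>n. theta_hat \<phi> L \<alpha> \<sigma> x b (\<lambda>i. w i n) n $ None - \<alpha>) \<longlonglongrightarrow> 0"
proof -
  have "\<exists>C. 0 \<le> C \<and> (\<forall>n. \<bar>LINT t:{0..real n}|lborel. \<phi> i t * x t\<bar> \<le> C * exp (\<alpha> * real n))" for i
    using integral_bounded_times_x[OF \<phi>_measurable \<phi>_bound, of i] by metis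
  then obtain Ci where Ci: "\<And>i. 0 \<le> Ci i" "\<And>i n. \<bar>LINT t:{0..real n}|lborel. \<phi> i t * x t\<bar> \<le> Ci i * exp (\<alpha> * real n)"
    by metis
  define C where "C = (\<Sum>i\<in>UNIV. Ci i)"
  have C: "0 \<le> C" "Ci i \<le> C" for i
    using Ci(1) by (auto simp: C_def intro!: sum_nonneg member_le_sum)
  have lam: "\<bar>Lam \<phi> x n i\<bar> \<le> C * exp (\<alpha> * real n) / real n" if "1 \<le> n" for i n
  proof -
    have "\<bar>LINT t:{0..real n}|lborel. \<phi> i t * x t\<bar> \<le> C * exp (\<alpha> * real n)"
      by (rule order_trans[OF Ci(2) mult_right_mono[OF C(2)]]) simp
    then show ?thesis
      using that by (simp add: Lam_def abs_mult divide_right_mono)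
  qed
  obtain c where c: "0 < c"
    "eventually (\<lambda>n. c * (exp (\<alpha> * real n))\<^sup>2 \<le> (LINT t:{0..real n}|lborel. (x t)\<^sup>2)) sequentially"
    by (rule integral_x_square_lower[OF \<xi>])
  \<comment> \<open>From N on, the squares of the \<open>Lam\<close> take away at most half of the
    lower bound for the integral of the squared path.\<close>
  obtain N :: nat where N: "2 * real CARD('p) * C\<^sup>2 / c \<le> real N"
    using real_arch_simple by blast
  have low: "eventually (\<lambda>n. c / 2 * (exp (\<alpha> * real n))\<^sup>2 \<le> real n * Dn \<phi> x n) sequentially"
    using c(2) eventually_ge_at_top[of "max 1 N"]
  proof eventually_elim
    case (elim n)
    let ?e = "(exp (\<alpha> * real n))\<^sup>2"
    have n: "1 \<le> n" "N \<le> n" using elim by auto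
    have sq: "(Lam \<phi> x n i)\<^sup>2 \<le> C\<^sup>2 * ?e / (real n)\<^sup>2" for i
      using power_mono[OF lam[OF n(1)] abs_ge_zero, of i 2] by (simp add: power_divide power_mult_distrib)
    have "(\<Sum>i\<in>UNIV. (Lam \<phi> x n i)\<^sup>2) \<le> (\<Sum>i\<in>(UNIV::'p set). C\<^sup>2 * ?e / (real n)\<^sup>2)"
      by (intro sum_mono sq)
    then have "real n * (\<Sum>i\<in>UNIV. (Lam \<phi> x n i)\<^sup>2) \<le> real n * (real CARD('p) * (C\<^sup>2 * ?e / (real n)\<^sup>2))"
      by (intro mult_left_mono) auto
    also have "\<dots> = (real CARD('p) * C\<^sup>2 / real n) * ?e"
      using n by (simp add: power2_eq_square)
    also have "\<dots> \<le> (c / 2) * ?e"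
    proof (intro mult_right_mono)
      have "2 * real CARD('p) * C\<^sup>2 / c \<le> real n" using N n(2) by linarith
      then show "real CARD('p) * C\<^sup>2 / real n \<le> c / 2"
        using c(1) n(1) by (simp add: field_simps)
    qed simp
    finally have "real n * (\<Sum>i\<in>UNIV. (Lam \<phi> x n i)\<^sup>2) \<le> c / 2 * ?e" .
    moreover have "real n * Dn \<phi> x n = (LINT t:{0..real n}|lborel. (x t)\<^sup>2) - real n * (\<Sum>i\<in>UNIV. (Lam \<phi> x n i)\<^sup>2)"
      using n by (simp add: Dn_def right_diff_distrib)
    ultimately show ?case using elim(1) by linarith
  qed
  obtain C' where C': "0 \<le> C'" "\<And>n. \<bar>young_integral x b 0 (real n)\<bar> \<le> C' * (1 + real n) powr \<gamma> * exp (\<alpha> * real n)"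
    by (rule young_integral_growth[OF \<beta> hoelder]) blast
  note lims = estimator_error_limits[where lam="\<lambda>i n. Lam \<phi> x n i" and D="Dn \<phi> x" and Z="\<lambda>n. young_integral x b 0 (real n)" and w=w
      and \<sigma>=\<sigma>, OF \<alpha> \<gamma> half_gt_zero[OF c(1)] C(1) C'(1) lam w C'(2) low]
  show "(\<lambda>n. theta_hat \<phi> L \<alpha> \<sigma> x b (\<lambda>i. w i n) n $ Some i - \<mu> i) \<longlonglongrightarrow> 0"
    by (rule Lim_transform_eventually[OF lims(1)[of i]], assumption)
      (use eventually_ge_at_top[of 1] in \<open>eventually_elim, simp add: theta_hat_error D\<close>)
  show "(\<lambda>n. theta_hat \<phi> L \<alpha> \<sigma> x b (\<lambda>i. w i n) n $ None - \<alpha>) \<longlonglongrightarrow> 0"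
    by (rule Lim_transform_eventually[OF lims(2)], assumption)
      (use eventually_ge_at_top[of 1] in \<open>eventually_elim, simp add: theta_hat_error D\<close>)
qed

end

theorem theorem5p1:
  fixes M :: "'a measure"
    and B X :: "real \<Rightarrow> 'a \<Rightarrow> real"
    and H \<alpha> \<sigma> x0 :: real
    and \<phi> :: "'p::finite \<Rightarrow> real \<Rightarrow> real"
    and \<mu> :: "'p \<Rightarrow> real"
    and L :: "real \<Rightarrow> real"
    and W :: "'p \<Rightarrow> nat \<Rightarrow> 'a \<Rightarrow> real"
    and hat_theta :: "nat \<Rightarrow> 'a \<Rightarrow> real ^ 'p option"
    and \<Lambda> :: "nat \<Rightarrow> 'p \<Rightarrow> 'a \<Rightarrow> real"
    and D Z :: "nat \<Rightarrow> 'a \<Rightarrow> real"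
  assumes "1 / 2 < H" and "H < 1"
    and "fractional_brownian_motion M H B"
    and "\<And>i. \<phi> i \<in> borel_measurable borel"
    and "\<And>i. bounded (range (\<phi> i))"
    and "\<And>i t. \<phi> i (t + 1) = \<phi> i t"
    and "\<And>i j. (LINT t:{0..1}|lborel. \<phi> i t * \<phi> j t) = (if i = j then 1 else 0)"
    and "0 < \<alpha>" and "\<sigma> \<noteq> 0"
    and L_def: "L = seasonal_mean \<mu> \<phi>"
    and "is_continuous_solution M B x0 L \<alpha> \<sigma> X"
    and "\<And>i n. is_wiener_integral M H B (real n) (\<phi> i) (W i n)"
    and Z_def: "\<And>n \<omega>. Z n \<omega> = young_integral (\<lambda>t. X t \<omega>) (\<lambda>t. B t \<omega>) 0 (real n)"
    and \<Lambda>_def: "\<And>n i \<omega>. \<Lambda> n i \<omega> = Lam \<phi> (\<lambda>t. X t \<omega>) n i"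
    and D_def: "\<And>n \<omega>. D n \<omega> = Dn \<phi> (\<lambda>t. X t \<omega>) n"
    and hat_theta_def: "\<And>n \<omega>. hat_theta n \<omega> =
          theta_hat \<phi> L \<alpha> \<sigma> (\<lambda>t. X t \<omega>) (\<lambda>t. B t \<omega>) (\<lambda>i. W i n \<omega>) n"
  shows "(\<forall>i. AE \<omega> in M.
            (\<forall>n\<ge>1. hat_theta n \<omega> $ Some i - \<mu> i =
               \<sigma> * (1 / real n) *
                 (W i n \<omega>
                  + 1 / D n \<omega> * (\<Sum>j\<in>UNIV. \<Lambda> n i \<omega> * \<Lambda> n j \<omega> * W j n \<omega>)
                  - 1 / D n \<omega> * \<Lambda> n i \<omega> * Z n \<omega>)) \<and>
            (\<lambda>n. hat_theta n \<omega> $ Some i - \<mu> i) \<longlonglongrightarrow> 0) \<and>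
         (AE \<omega> in M.
            (\<forall>n\<ge>1. hat_theta n \<omega> $ None - \<alpha> =
               - \<sigma> * (1 / (real n * D n \<omega>)) *
                 ((\<Sum>i\<in>UNIV. \<Lambda> n i \<omega> * W i n \<omega>) - Z n \<omega>)) \<and>
            (\<lambda>n. hat_theta n \<omega> $ None - \<alpha>) \<longlonglongrightarrow> 0)"
proof -
  interpret fbm M H B
    by unfold_locales (fact assms)+
  \<comment> \<open>Midpoints: \<beta> lies between 1/2 and H, for Young integration and dyadic
    increments, and \<gamma> between H and 1, for growth and decay of p / n. They satisfy 1 -
    \<beta> < 1/2 < \<gamma>, as the growth lemma requires.\<close>
  define \<beta> where "\<beta> = (H + 1 / 2) / 2"
  define \<gamma> where "\<gamma> = (H + 1) / 2"
  have \<beta>: "1 / 2 < \<beta>" "\<beta> < H" "0 < \<beta>" "\<beta> < 1" and \<gamma>: "H < \<gamma>" "0 < \<gamma>" "\<gamma> < 1" "1 - \<beta> \<le> \<gamma>"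
    using H_gt H_less by (auto simp: \<beta>_def \<gamma>_def field_simps)
  let ?r = "2 powr - \<beta> :: real"
  have r: "0 < ?r" "?r < 1" using \<beta> powr_less_mono[of "- \<beta>" 0 "2::real"] by simp_all
  have "\<exists>F. \<forall>s. \<bar>\<phi> i s\<bar> \<le> F" for i
    using assms(5)[of i] by (auto simp: bounded_iff)
  then obtain Fi where Fi: "\<And>i s. \<bar>\<phi> i s\<bar> \<le> Fi i" by metis
  define F where "F = (\<Sum>i\<in>UNIV. \<bar>Fi i\<bar>)"
  have F: "\<bar>\<phi> i s\<bar> \<le> F" for i s
  proof -
    have "\<bar>Fi i\<bar> \<le> F" unfolding F_def by (intro member_le_sum) auto
    then show ?thesis using Fi[of i s] by linarith
  qed
  define K where "K = (\<Sum>i\<in>UNIV. \<bar>\<mu> i\<bar> * F)"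
  have L_bound: "\<bar>L s\<bar> \<le> K" for s
    unfolding L_def seasonal_mean_def K_def
    by (intro order_trans[OF sum_abs] sum_mono) (simp add: abs_mult mult_left_mono F)
  have L_meas: "L \<in> borel_measurable borel"
    unfolding L_def seasonal_mean_def[abs_def] using assms(4) by measurable
  let ?x = "\<lambda>\<omega> t. X t \<omega>" and ?b = "\<lambda>\<omega> t. B t \<omega>"
  let ?d = "\<lambda>k::nat. x0 + \<alpha> * integral {0..2 ^ k} (\<lambda>s. exp (- \<alpha> * s) * integral {0..s} L)"
  let ?S = "\<lambda>k \<omega>. \<Sum>j<4 ^ k. exp_weight \<alpha> k j * B (real j / 2 ^ k) \<omega>"
  \<comment> \<open>The growth constant G and the dyadic level k0 depend on \<omega>, so they are
    quantified inside the predicate.\<close>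
  define good where "good \<omega> \<longleftrightarrow> (\<exists>G k0. seasonal_growth_path (?x \<omega>) (?b \<omega>) L \<alpha> \<sigma> x0 K \<phi> \<mu> F G \<gamma> \<and>
      dyadic_bound (?b \<omega>) ?r k0)" for \<omega>
  have good: "AE \<omega> in M. good \<omega>"
    using assms(11)[unfolded is_continuous_solution_def, THEN conjunct2] AE_B_continuous
      AE_dyadic_increments[OF \<beta>(2)] AE_B_nat_growth[OF \<gamma>(1)]
  proof eventually_elim
    case (elim \<omega>)
    obtain k0 where k0: "dyadic_bound (?b \<omega>) ?r k0"
      using elim(3) unfolding eventually_sequentially dyadic_bound_def by blast
    obtain G where G: "0 \<le> G" "\<And>t. 0 \<le> t \<Longrightarrow> \<bar>B t \<omega>\<bar> \<le> G * (1 + t) powr \<gamma>"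
      using dyadic_growth[OF elim(2) k0 \<beta>(3,4) \<gamma>(4) elim(4)] by blast
    have "seasonal_growth_path (?x \<omega>) (?b \<omega>) L \<alpha> \<sigma> x0 K \<phi> \<mu> F G \<gamma>"
      by unfold_locales (use elim(1,2) L_meas L_bound F assms G \<gamma> in auto)
    then show ?case using k0 unfolding good_def by blast
  qed
  \<comment> \<open>The limit \<xi> exists only inside the interpretation for a single path. Writing
    it as \<open>lim\<close> of the Riemann sums gives a function of \<omega> to which the almost
    sure statement can refer.\<close>
  have "AE \<omega> in M. (\<lambda>k. ?d k + \<alpha> * \<sigma> * ?S k \<omega>) \<longlonglongrightarrow> lim (\<lambda>k. ?d k + \<alpha> * \<sigma> * ?S k \<omega>)"
    using good
  proof eventually_elim
    case (elim \<omega>)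
    then obtain G k0 where *: "seasonal_growth_path (?x \<omega>) (?b \<omega>) L \<alpha> \<sigma> x0 K \<phi> \<mu> F G \<gamma>"
      "dyadic_bound (?b \<omega>) ?r k0" unfolding good_def by blast
    interpret seasonal_growth_path "?x \<omega>" "?b \<omega>" L \<alpha> \<sigma> x0 K \<phi> \<mu> F G \<gamma> by (rule *(1))
    obtain \<xi> where "(discounted \<longlongrightarrow> \<xi>) at_top" using discounted_limit by blast
    from discounted_riemann_limit[OF *(2) r this] show ?case
      by (simp add: convergent_LIMSEQ_iff[symmetric] convergentI)
  qed
  then have "AE \<omega> in M. lim (\<lambda>k. ?d k + \<alpha> * \<sigma> * ?S k \<omega>) \<noteq> 0"
    using assms by (intro AE_riemann_limit_neq_0[of \<alpha> "\<alpha> * \<sigma>" ?d]) auto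
  moreover have "AE \<omega> in M. \<forall>i. eventually (\<lambda>n. \<bar>W i n \<omega>\<bar> \<le> 2 * real n powr \<gamma>) sequentially"
    unfolding AE_all_countable by (intro allI AE_wiener_integral_growth[OF F assms(4,12) \<gamma>(1)])
  moreover note good AE_path_nondegenerate[OF assms(9), of \<phi> \<alpha> "\<lambda>t. x0 + integral {0..t} L"]
  ultimately have main: "AE \<omega> in M.
      (\<forall>n\<ge>1. D n \<omega> \<noteq> 0) \<and> good \<omega> \<and> (\<forall>i. (\<lambda>n. hat_theta n \<omega> $ Some i - \<mu> i) \<longlonglongrightarrow> 0) \<and>
      (\<lambda>n. hat_theta n \<omega> $ None - \<alpha>) \<longlonglongrightarrow> 0"
  proof eventually_elim
    case (elim \<omega>)
    then obtain G k0 where *: "seasonal_growth_path (?x \<omega>) (?b \<omega>) L \<alpha> \<sigma> x0 K \<phi> \<mu> F G \<gamma>"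
      "dyadic_bound (?b \<omega>) ?r k0" unfolding good_def by blast
    interpret seasonal_growth_path "?x \<omega>" "?b \<omega>" L \<alpha> \<sigma> x0 K \<phi> \<mu> F G \<gamma> by (rule *(1))
    obtain \<xi> where \<xi>: "(discounted \<longlongrightarrow> \<xi>) at_top" using discounted_limit by blast
    have "\<xi> \<noteq> 0"
      using limI[OF discounted_riemann_limit[OF *(2) r \<xi>]] elim(1) by simp
    have D: "Dn \<phi> (?x \<omega>) n \<noteq> 0" if "1 \<le> n" for n
      using elim(4) x_cont'[OF order_refl] by (intro Dn_neq_0[OF that]) blast
    have hoelder: "\<exists>C \<delta>. 0 < \<delta> \<and> 0 \<le> C \<and> (\<forall>s t. 0 \<le> s \<longrightarrow> s \<le> t \<longrightarrow> t \<le> real n \<longrightarrow> t - s \<le> \<delta>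
        \<longrightarrow> \<bar>B t \<omega> - B s \<omega>\<bar> \<le> C * (t - s) powr \<beta>)" for n :: nat
      by (rule dyadic_local_hoelder[OF b_cont *(2) \<beta>(3,4), of "real n"]) blast
    note lims = estimator_consistent[OF \<beta>(1,4) hoelder \<xi> \<open>\<xi> \<noteq> 0\<close> _ D, of "\<lambda>i n. W i n \<omega>"]
    show ?case
      using D lims elim by (auto simp: D_def hat_theta_def)
  qed
  have err: "hat_theta n \<omega> $ Some i - \<mu> i = \<sigma> * (1 / real n) *
        (W i n \<omega> + 1 / D n \<omega> * (\<Sum>j\<in>UNIV. \<Lambda> n i \<omega> * \<Lambda> n j \<omega> * W j n \<omega>) - 1 / D n \<omega> * \<Lambda> n i \<omega> * Z n \<omega>)"
      "hat_theta n \<omega> $ None - \<alpha> = - \<sigma> * (1 / (real n * D n \<omega>)) * ((\<Sum>i\<in>UNIV. \<Lambda> n i \<omega> * W i n \<omega>) - Z n \<omega>)"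
    if "good \<omega>" "1 \<le> n" "D n \<omega> \<noteq> 0" for \<omega> n i
  proof -
    obtain G where "seasonal_growth_path (?x \<omega>) (?b \<omega>) L \<alpha> \<sigma> x0 K \<phi> \<mu> F G \<gamma>"
      using \<open>good \<omega>\<close> unfolding good_def by blast
    then interpret seasonal_growth_path "?x \<omega>" "?b \<omega>" L \<alpha> \<sigma> x0 K \<phi> \<mu> F G \<gamma> .
    show "hat_theta n \<omega> $ Some i - \<mu> i = \<sigma> * (1 / real n) *
        (W i n \<omega> + 1 / D n \<omega> * (\<Sum>j\<in>UNIV. \<Lambda> n i \<omega> * \<Lambda> n j \<omega> * W j n \<omega>) - 1 / D n \<omega> * \<Lambda> n i \<omega> * Z n \<omega>)"
      "hat_theta n \<omega> $ None - \<alpha> = - \<sigma> * (1 / (real n * D n \<omega>)) * ((\<Sum>i\<in>UNIV. \<Lambda> n i \<omega> * W i n \<omega>) - Z n \<omega>)"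
      using theta_hat_error[OF that(2), where w="\<lambda>i. W i n \<omega>"] that(3)
      unfolding D_def hat_theta_def \<Lambda>_def Z_def by blast+
  qed
  show ?thesis
  proof (intro conjI allI, goal_cases)
    case (1 i)
    from main show ?case by (rule eventually_mono) (use err(1) in blast)
  next
    case 2
    from main show ?case by (rule eventually_mono) (use err(2) in blast)
  qed
qed

end
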